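(* Let $n \geq 1$ and $s>0$. Let $P(D)$ be the pseudo-differential operator given by $\widehat{(P(D)f)}(\xi) = p(\xi)\widehat{f}(\xi)$, where $p:\mathbb{R}^n\to\mathbb{R}$ is a continuous function such that $$A|\xi|^{2s} + c \leq p(\xi) \leq B|\xi|^{2s} \quad \text{for all } \xi\in\mathbb{R}^n$$ with suitable constants $A>0$, $B>0$ and $c\in\mathbb{R}$. Assume that $V:\mathbb{R}^n\to\mathbb{R}$ has a Fourier transform $\widehat{V}\in L^1(\mathbb{R}^n)\cap L^2(\mathbb{R}^n)$ with $\widehat{V}(\xi)<0$ for almost every $\xi\in\mathbb{R}^n$ (in particular $\widehat{V}$ is real-valued). Let $$E_0=\inf\{\langle f,(P(D)+V)f\rangle : f\in H^s(\mathbb{R}^n),\ \|f\|_{L^2}=1\}$$ and suppose that $E_0<\inf_{\xi\in\mathbb{R}^n}p(\xi)$. Then the following properties hold. (a) Uniqueness: The ground state solution $\psi\in H^s(\mathbb{R}^n)$ of $P(D)\psi+V\psi=E_0\psi$ is unique up to a constant phase; that is, any two ground states $\psi_1,\psi_2$ satisfy $\psi_2=e^{\mathrm{i}\alpha}\psi_1$ for some $\alpha\in\mathbb{R}$. Moreover, there is a constant $\theta\in\mathbb{R}$ such that $$e^{\mathrm{i}\theta}\widehat{\psi}(\xi)>0\quad\text{for all }\xi\in\mathbb{R}^n.$$ (b) Symmetry: Up to a constant phase (i.e. after multiplication of $\psi$ by a constant of modulus one), the ground state $\psi$ in (a) satisfies $$\psi(-x)=\overline{\psi(x)}\quad\text{for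 a.e. }x\in\mathbb{R}^n.$$ If, in addition, the symbol is even, i.e. $p(-\xi)=p(\xi)$ for all $\xi$, then $\psi$ is real-valued up to a constant phase.
   Context: Functions in $H^s(\mathbb{R}^n)$ and $L^2(\mathbb{R}^n)$ are complex-valued, and $\langle f,g\rangle=\int_{\mathbb{R}^n}\overline{f}g\,dx$. The Fourier transform is $\widehat{f}(\xi)=\int_{\mathbb{R}^n}f(x)e^{-2\pi \mathrm{i}x\cdot\xi}\,dx$, extended to $L^2(\mathbb{R}^n)$ by density. The quadratic form is understood as $\langle f,(P(D)+V)f\rangle=\int_{\mathbb{R}^n}p(\xi)|\widehat{f}(\xi)|^2\,d\xi+\int_{\mathbb{R}^n}V|f|^2\,dx$ for $f\in H^s(\mathbb{R}^n)$ (note that $V$ is bounded since $\widehat V\in L^1$). A (linear) ground state is a minimizer $\psi\in H^s(\mathbb{R}^n)$, $\|\psi\|_{L^2}=1$, of the variational problem defining $E_0$; equivalently, an $L^2$-normalized solution $\psi\in H^s(\mathbb{R}^n)$ of $P(D)\psi+V\psi=E_0\psi$. The Fourier transform $\widehat\psi$ of a ground state is identified with its continuous representative, which is how the pointwise statement for all $\xi$ is understood. *)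

theory Defs
  imports "HOL-Analysis.Analysis"
begin

definition L2_fun :: "('a::euclidean_space \<Rightarrow> complex) set" where
  "L2_fun = {f. f \<in> borel_measurable lebesgue \<and> integrable lebesgue (\<lambda>x. (cmod (f x))\<^sup>2)}"

definition L2_nrm :: "('a::euclidean_space \<Rightarrow> complex) \<Rightarrow> real" where
  "L2_nrm f = sqrt (\<integral>x. (cmod (f x))\<^sup>2 \<partial>lebesgue)"

text \<open>Membership in \<open>L2_fun\<close> is part of convergence: the Bochner integral in \<open>L2_nrm\<close> is 0
  for functions that are not square integrable.\<close>
definition L2_tendsto ::
  "(nat \<Rightarrow> 'a::euclidean_space \<Rightarrow> complex) \<Rightarrow> ('a \<Rightarrow> complex) \<Rightarrow> bool" where
  "L2_tendsto F f \<longleftrightarrow> (\<forall>k. F k \<in> L2_fun) \<and> f \<in> L2_fun \<and>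
     (\<lambda>k. L2_nrm (\<lambda>x. F k x - f x)) \<longlonglongrightarrow> 0"

definition fourier_integral :: "('a::euclidean_space \<Rightarrow> complex) \<Rightarrow> 'a \<Rightarrow> complex" where
  "fourier_integral f \<xi> =
     (\<integral>x. f x * exp (- 2 * of_real pi * \<i> * of_real (x \<bullet> \<xi>)) \<partial>lebesgue)"

text \<open>Extension of the Fourier integral from \<open>L\<^sup>1 \<inter> L\<^sup>2\<close> to \<open>L\<^sup>2\<close> by density: \<open>g\<close> is the
  \<open>L\<^sup>2\<close> limit of the Fourier integrals of functions approximating \<open>f\<close>.  It is determined by
  \<open>f\<close> up to a null set; \<open>fourier\<close> picks some representative, so every use below is
  insensitive to changes on null sets.\<close>
definition is_fourier ::
  "('a::euclidean_space \<Rightarrow> complex) \<Rightarrow> ('a \<Rightarrow> complex) \<Rightarrow> bool" where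
  "is_fourier f g \<longleftrightarrow> (\<exists>F. (\<forall>k. integrable lebesgue (F k)) \<and>
     L2_tendsto F f \<and> L2_tendsto (\<lambda>k. fourier_integral (F k)) g)"

definition fourier :: "('a::euclidean_space \<Rightarrow> complex) \<Rightarrow> 'a \<Rightarrow> complex" where
  "fourier f = (SOME g. is_fourier f g)"

definition sobolev :: "real \<Rightarrow> ('a::euclidean_space \<Rightarrow> complex) set" where
  "sobolev s = {f \<in> L2_fun.
     (\<lambda>\<xi>. of_real ((1 + (norm \<xi>)\<^sup>2) powr (s / 2)) * fourier f \<xi>) \<in> L2_fun}"

definition energy_form ::
  "('a::euclidean_space \<Rightarrow> real) \<Rightarrow> ('a \<Rightarrow> real) \<Rightarrow> ('a \<Rightarrow> complex) \<Rightarrow> real" where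
  "energy_form p V f =
     (\<integral>\<xi>. p \<xi> * (cmod (fourier f \<xi>))\<^sup>2 \<partial>lebesgue) + (\<integral>x. V x * (cmod (f x))\<^sup>2 \<partial>lebesgue)"

definition ground_energy ::
  "real \<Rightarrow> ('a::euclidean_space \<Rightarrow> real) \<Rightarrow> ('a \<Rightarrow> real) \<Rightarrow> real" where
  "ground_energy s p V = Inf {energy_form p V f | f. f \<in> sobolev s \<and> L2_nrm f = 1}"

definition ground_state ::
  "real \<Rightarrow> ('a::euclidean_space \<Rightarrow> real) \<Rightarrow> ('a \<Rightarrow> real) \<Rightarrow> ('a \<Rightarrow> complex) \<Rightarrow> bool" where
  "ground_state s p V \<psi> \<longleftrightarrow> \<psi> \<in> sobolev s \<and> L2_nrm \<psi> = 1 \<and> energy_form p V \<psi> = ground_energy s p V"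

text \<open>\<open>is_PD p f g\<close> means \<open>g = P(D) f\<close> for the operator with symbol \<open>p\<close>.\<close>
definition is_PD ::
  "('a::euclidean_space \<Rightarrow> real) \<Rightarrow> ('a \<Rightarrow> complex) \<Rightarrow> ('a \<Rightarrow> complex) \<Rightarrow> bool" where
  "is_PD p f g \<longleftrightarrow> f \<in> L2_fun \<and> g \<in> L2_fun \<and>
     (AE \<xi> in lebesgue. fourier g \<xi> = of_real (p \<xi>) * fourier f \<xi>)"

text \<open>\<open>P(D) \<psi> + V \<psi> = E \<psi>\<close>.  For \<open>\<psi> \<in> H\<^sup>s\<close> and bounded \<open>V\<close> the equation forces
  \<open>P(D) \<psi> = E \<psi> - V \<psi> \<in> L\<^sup>2\<close>, so asking for \<open>P(D) \<psi>\<close> in \<open>L\<^sup>2\<close> rather than in \<open>H\<^bsup>-s\<^esup>\<close>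
  excludes no solutions.\<close>
definition solves_eigen_eq ::
  "('a::euclidean_space \<Rightarrow> real) \<Rightarrow> ('a \<Rightarrow> real) \<Rightarrow> real \<Rightarrow> ('a \<Rightarrow> complex) \<Rightarrow> bool" where
  "solves_eigen_eq p V E \<psi> \<longleftrightarrow> (\<exists>g. is_PD p \<psi> g \<and>
     (AE x in lebesgue. g x + of_real (V x) * \<psi> x = of_real E * \<psi> x))"

end

theory Submission
  imports Defs "HOL-Probability.Characteristic_Functions"
begin

text \<open>
  On the Fourier side the form becomes \<open>\<integral> p |u|\<^sup>2 - \<integral> cnj u (W * u)\<close> with \<open>W\<close> the negative of the
  Fourier transform of \<open>V\<close>, so \<open>W > 0\<close> almost everywhere.  Passing from \<open>u\<close> to \<open>|u|\<close> keeps the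
  first term and can only lower the form.  For a minimizer the triangle inequality
  \<open>|W * u| \<le> W * |u|\<close> is therefore an equality, which forces \<open>u = phase \<cdot> |u|\<close>, and the
  Euler-Lagrange equation \<open>(p - E) u = W * u\<close> shows that
  \<open>|u| = (W * |u|) / (p - E)\<close> is continuous and positive everywhere.  The minimizers
  are the normalized solutions of a linear equation; if two positive ones differed, their difference
  would have a constant sign, contradicting equality of norms.  Positivity of the
  Fourier transform gives \<open>\<psi>(-x) = cnj (\<psi> x)\<close>, and for even \<open>p\<close> uniqueness applied to \<open>\<psi>\<close> and
  \<open>cnj \<psi>\<close> makes \<open>\<psi>\<close> real up to a phase.

  The facts on the Fourier transform this needs are Plancherel's theorem (by Gaussian regularisation),
  surjectivity on \<open>L\<^sup>2\<close>, and that multiplication by \<open>V\<close> becomes convolution.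
\<close>

section \<open>Square integrable functions\<close>

text \<open>Subtracting \<open>E\<close> from the symbol makes the form nonnegative on the whole
  form domain, not only on the unit sphere, and minimizers become its normalized zeros. The first
  variation then needs no Lagrange multiplier. The gap assumption says that \<open>p - E\<close> is
  strictly positive, which is what permits dividing by it at every frequency.

  The transform of an L^2 function is determined only almost everywhere, while positivity is claimed
  at every frequency. The bridge is that a convolution of two L^2 functions is defined and
  continuous everywhere, because translation is continuous in L^2; the same continuity drives the
  Plancherel argument. Integrability of \<open>W\<close> has another role: it bounds
  \<open>V\<close> and justifies Fubini when a convolution is paired with an L^2 function.

  For \<open>u\<close> in the form domain, \<open>(p - E) u - W * u\<close> is not known to be
  square integrable. Equations are therefore tested against truncations of the residual itself,
  which always lie in the form domain.\<close>

lemma L2_funI: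
  "f \<in> borel_measurable lebesgue \<Longrightarrow> integrable lebesgue (\<lambda>x. (cmod (f x))\<^sup>2) \<Longrightarrow> f \<in> L2_fun"
  by (simp add: L2_fun_def)

lemma L2_fun_measurable: "f \<in> L2_fun \<Longrightarrow> f \<in> borel_measurable lebesgue"
  by (simp add: L2_fun_def)

lemma L2_fun_integrable: "f \<in> L2_fun \<Longrightarrow> integrable lebesgue (\<lambda>x. (cmod (f x))\<^sup>2)"
  by (simp add: L2_fun_def)

text \<open>Lebesgue measure is complete: preimages under \<open>f\<close> and \<open>g\<close>
  differ by a null set, so they are measurable together. This lets representatives be exchanged
  freely below.\<close>

lemma measurable_lebesgue_cong_AE:
  fixes f g :: "'a::euclidean_space \<Rightarrow> 'b::topological_space"
  assumes "f \<in> borel_measurable lebesgue" "AE x in lebesgue. f x = g x"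
  shows "g \<in> borel_measurable lebesgue"
proof (rule measurableI)
  fix S :: "'b set" assume S: "S \<in> sets borel"
  have "f -` S \<inter> space lebesgue \<in> sets lebesgue"
    using assms(1) S by (rule measurable_sets)
  moreover have "AE x in lebesgue. x \<in> f -` S \<inter> space lebesgue \<longleftrightarrow> x \<in> g -` S \<inter> space lebesgue"
    using assms(2) by eventually_elim auto
  ultimately show "g -` S \<inter> space lebesgue \<in> sets lebesgue"
    using completion.in_sets_AE[of "f -` S \<inter> space lebesgue" "g -` S \<inter> space lebesgue"] by auto
qed simp

lemma L2_fun_cong_AE:
  assumes "f \<in> L2_fun" "AE x in lebesgue. f x = g x"
  shows "g \<in> L2_fun"
proof (rule L2_funI)
  show g: "g \<in> borel_measurable lebesgue"
    by (rule measurable_lebesgue_cong_AE[OF L2_fun_measurable[OF assms(1)] assms(2)])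
  show "integrable lebesgue (\<lambda>x. (cmod (g x))\<^sup>2)"
  proof (rule integrable_cong_AE_imp[OF L2_fun_integrable[OF assms(1)]])
    show "(\<lambda>x. (cmod (g x))\<^sup>2) \<in> borel_measurable lebesgue" using g by measurable
    show "AE x in lebesgue. (cmod (f x))\<^sup>2 = (cmod (g x))\<^sup>2"
      using assms(2) by eventually_elim simp
  qed
qed

lemma L2_nrm_cong_AE:
  assumes "f \<in> L2_fun" "AE x in lebesgue. f x = g x"
  shows "L2_nrm f = L2_nrm g"
proof -
  have g: "g \<in> L2_fun" by (rule L2_fun_cong_AE[OF assms])
  have [measurable]: "f \<in> borel_measurable lebesgue" "g \<in> borel_measurable lebesgue"
    using assms(1) g by (auto dest: L2_fun_measurable)
  have "(\<integral>x. (cmod (f x))\<^sup>2 \<partial>lebesgue) = (\<integral>x. (cmod (g x))\<^sup>2 \<partial>lebesgue)"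
  proof (rule integral_cong_AE)
    show "AE x in lebesgue. (cmod (f x))\<^sup>2 = (cmod (g x))\<^sup>2"
      using assms(2) by eventually_elim simp
  qed measurable
  then show ?thesis by (simp add: L2_nrm_def)
qed

lemma L2_fun_bound:
  assumes "f \<in> L2_fun" "g \<in> borel_measurable lebesgue"
    and "AE x in lebesgue. cmod (g x) \<le> C * cmod (f x)"
  shows "g \<in> L2_fun"
proof (rule L2_funI[OF assms(2)])
  show "integrable lebesgue (\<lambda>x. (cmod (g x))\<^sup>2)"
  proof (rule Bochner_Integration.integrable_bound)
    show "integrable lebesgue (\<lambda>x. C\<^sup>2 * (cmod (f x))\<^sup>2)"
      using L2_fun_integrable[OF assms(1)] by simp
    show "(\<lambda>x. (cmod (g x))\<^sup>2) \<in> borel_measurable lebesgue" using assms(2) by measurable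
    show "AE x in lebesgue. norm ((cmod (g x))\<^sup>2) \<le> norm (C\<^sup>2 * (cmod (f x))\<^sup>2)"
      using assms(3)
    proof eventually_elim
      case (elim x)
      have "(cmod (g x))\<^sup>2 \<le> (C * cmod (f x))\<^sup>2"
        by (rule power_mono[OF elim]) simp
      then show ?case by (simp add: power_mult_distrib abs_mult)
    qed
  qed
qed

lemma cmod_add_square_le: "(cmod (a + b))\<^sup>2 \<le> 2 * (cmod a)\<^sup>2 + 2 * (cmod b)\<^sup>2"
proof -
  have "(cmod (a + b))\<^sup>2 \<le> (cmod a + cmod b)\<^sup>2"
    by (intro power_mono norm_triangle_ineq) simp
  also have "\<dots> \<le> 2 * (cmod a)\<^sup>2 + 2 * (cmod b)\<^sup>2"
    using sum_squares_bound[of "cmod a" "cmod b"] by (simp add: power2_sum)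
  finally show ?thesis .
qed

lemma L2_fun_add:
  assumes "f \<in> L2_fun" "g \<in> L2_fun"
  shows "(\<lambda>x. f x + g x) \<in> L2_fun"
proof (rule L2_funI)
  have [measurable]: "f \<in> borel_measurable lebesgue" "g \<in> borel_measurable lebesgue"
    using assms by (auto dest: L2_fun_measurable)
  show "(\<lambda>x. f x + g x) \<in> borel_measurable lebesgue" by measurable
  show "integrable lebesgue (\<lambda>x. (cmod (f x + g x))\<^sup>2)"
  proof (rule Bochner_Integration.integrable_bound)
    show "integrable lebesgue (\<lambda>x. 2 * (cmod (f x))\<^sup>2 + 2 * (cmod (g x))\<^sup>2)"
      using assms by (intro Bochner_Integration.integrable_add integrable_mult_right L2_fun_integrable)
    show "AE x in lebesgue. norm ((cmod (f x + g x))\<^sup>2) \<le> norm (2 * (cmod (f x))\<^sup>2 + 2 * (cmod (g x))\<^sup>2)"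
      using cmod_add_square_le by auto
  qed measurable
qed

lemma L2_fun_cmult: "f \<in> L2_fun \<Longrightarrow> (\<lambda>x. c * f x) \<in> L2_fun"
  by (rule L2_fun_bound[where C = "cmod c"]) (auto simp: norm_mult dest: L2_fun_measurable)

lemma L2_fun_minus: "f \<in> L2_fun \<Longrightarrow> (\<lambda>x. - f x) \<in> L2_fun"
  using L2_fun_cmult[of f "-1"] by simp

lemma L2_fun_diff: "f \<in> L2_fun \<Longrightarrow> g \<in> L2_fun \<Longrightarrow> (\<lambda>x. f x - g x) \<in> L2_fun"
  using L2_fun_add[OF _ L2_fun_minus, of f g] by simp

lemma borel_measurable_cnj [measurable (raw)]:
  "f \<in> borel_measurable M \<Longrightarrow> (\<lambda>x. cnj (f x)) \<in> borel_measurable M"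
  by (rule borel_measurable_continuous_on) (auto intro: continuous_intros)

lemma L2_fun_cnj: "f \<in> L2_fun \<Longrightarrow> (\<lambda>x. cnj (f x)) \<in> L2_fun"
  by (rule L2_fun_bound[where C = 1]) (auto dest!: L2_fun_measurable)

lemma L2_fun_cmod: "f \<in> L2_fun \<Longrightarrow> (\<lambda>x. complex_of_real (cmod (f x))) \<in> L2_fun"
  by (rule L2_fun_bound[where C = 1]) (auto dest!: L2_fun_measurable)

lemma L2_fun_zero: "(\<lambda>x. 0) \<in> L2_fun"
  by (rule L2_funI) auto

lemma L2_mult_integrable:
  assumes "f \<in> L2_fun" "g \<in> L2_fun"
  shows "integrable lebesgue (\<lambda>x. f x * g x)"
proof (rule Bochner_Integration.integrable_bound)
  have [measurable]: "f \<in> borel_measurable lebesgue" "g \<in> borel_measurable lebesgue"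
    using assms by (auto dest: L2_fun_measurable)
  show "integrable lebesgue (\<lambda>x. (cmod (f x))\<^sup>2 + (cmod (g x))\<^sup>2)"
    using assms by (intro Bochner_Integration.integrable_add L2_fun_integrable)
  show "(\<lambda>x. f x * g x) \<in> borel_measurable lebesgue" by measurable
  have "cmod a * cmod b \<le> (cmod a)\<^sup>2 + (cmod b)\<^sup>2" for a b
    using sum_squares_bound[of "cmod a" "cmod b"] mult_nonneg_nonneg[OF norm_ge_zero[of a] norm_ge_zero[of b]]
    by linarith
  then show "AE x in lebesgue. norm (f x * g x) \<le> norm ((cmod (f x))\<^sup>2 + (cmod (g x))\<^sup>2)"
    by (auto simp: norm_mult)
qed

section \<open>Inner product, Cauchy-Schwarz and convergence in L^2\<close>

definition L2_ip :: "('a::euclidean_space \<Rightarrow> complex) \<Rightarrow> ('a \<Rightarrow> complex) \<Rightarrow> complex" where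
  "L2_ip f g = (\<integral>x. cnj (f x) * g x \<partial>lebesgue)"

lemma L2_ip_integrable:
  "f \<in> L2_fun \<Longrightarrow> g \<in> L2_fun \<Longrightarrow> integrable lebesgue (\<lambda>x. cnj (f x) * g x)"
  by (intro L2_mult_integrable L2_fun_cnj)

lemma L2_nrm_nonneg [simp]: "0 \<le> L2_nrm f"
  by (simp add: L2_nrm_def integral_nonneg_AE)

lemma L2_nrm_square: "(L2_nrm f)\<^sup>2 = (\<integral>x. (cmod (f x))\<^sup>2 \<partial>lebesgue)"
  by (simp add: L2_nrm_def integral_nonneg_AE)

lemma L2_ip_self: "L2_ip f f = of_real ((L2_nrm f)\<^sup>2)"
  unfolding L2_ip_def L2_nrm_square
  by (simp add: complex_norm_square mult.commute del: of_real_power flip: integral_complex_of_real)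

lemma L2_nrm_cmult: "L2_nrm (\<lambda>x. c * f x) = cmod c * L2_nrm f"
  by (simp add: L2_nrm_def norm_mult power_mult_distrib real_sqrt_mult)

lemma L2_nrm_cnj: "L2_nrm (\<lambda>x. cnj (f x)) = L2_nrm f"
  by (simp add: L2_nrm_def)

lemma L2_nrm_diff_commute: "L2_nrm (\<lambda>x. f x - g x) = L2_nrm (\<lambda>x. g x - f x)"
  by (simp add: L2_nrm_def norm_minus_commute)

lemma L2_nrm_eq_0:
  assumes "f \<in> L2_fun" shows "L2_nrm f = 0 \<longleftrightarrow> (AE x in lebesgue. f x = 0)"
  using integral_nonneg_eq_0_iff_AE[OF L2_fun_integrable[OF assms]]
  by (simp add: L2_nrm_def)

lemma nn_integral_L2:
  assumes "f \<in> L2_fun"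
  shows "(\<integral>\<^sup>+x. ennreal ((cmod (f x))\<^sup>2) \<partial>lebesgue) = ennreal ((L2_nrm f)\<^sup>2)"
  unfolding L2_nrm_square by (rule nn_integral_eq_integral[OF L2_fun_integrable[OF assms]]) simp

lemma L2_Cauchy_Schwarz_norm:
  assumes "f \<in> L2_fun" "g \<in> L2_fun"
  shows "(\<integral>x. cmod (f x * g x) \<partial>lebesgue) \<le> L2_nrm f * L2_nrm g"
proof -
  have [measurable]: "f \<in> borel_measurable lebesgue" "g \<in> borel_measurable lebesgue"
    using assms by (auto dest: L2_fun_measurable)
  let ?I = "\<integral>x. cmod (f x * g x) \<partial>lebesgue"
  have I: "0 \<le> ?I" by (simp add: integral_nonneg_AE)
  have "ennreal (?I\<^sup>2) = (\<integral>\<^sup>+x. ennreal (cmod (f x * g x)) \<partial>lebesgue)\<^sup>2"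
    using nn_integral_eq_integral[OF integrable_norm[OF L2_mult_integrable[OF assms]]] I
    by (simp add: ennreal_power)
  also have "\<dots> = (\<integral>\<^sup>+x. ennreal (cmod (f x)) * ennreal (cmod (g x)) \<partial>lebesgue)\<^sup>2"
    by (simp add: norm_mult ennreal_mult)
  also have "\<dots> \<le> (\<integral>\<^sup>+x. (ennreal (cmod (f x)))\<^sup>2 \<partial>lebesgue) * (\<integral>\<^sup>+x. (ennreal (cmod (g x)))\<^sup>2 \<partial>lebesgue)"
    by (rule Cauchy_Schwarz_nn_integral) measurable
  also have "\<dots> = ennreal ((L2_nrm f * L2_nrm g)\<^sup>2)"
    using assms by (simp add: ennreal_power nn_integral_L2 power_mult_distrib ennreal_mult)
  finally have "?I\<^sup>2 \<le> (L2_nrm f * L2_nrm g)\<^sup>2" by simp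
  then show ?thesis by (rule power2_le_imp_le) simp
qed

lemma L2_Cauchy_Schwarz:
  assumes "f \<in> L2_fun" "g \<in> L2_fun"
  shows "cmod (\<integral>x. f x * g x \<partial>lebesgue) \<le> L2_nrm f * L2_nrm g"
  using integral_norm_bound[of lebesgue "\<lambda>x. f x * g x"] L2_Cauchy_Schwarz_norm[OF assms] by linarith

lemma L2_ip_Cauchy_Schwarz:
  assumes "f \<in> L2_fun" "g \<in> L2_fun"
  shows "cmod (L2_ip f g) \<le> L2_nrm f * L2_nrm g"
  using L2_Cauchy_Schwarz[OF L2_fun_cnj[OF assms(1)] assms(2)]
  by (simp add: L2_ip_def L2_nrm_cnj)

lemma L2_ip_cnj: "L2_ip f g = cnj (L2_ip g f)"
  by (simp add: L2_ip_def mult.commute flip: Bochner_Integration.integral_cnj)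

lemma L2_ip_cong_AE:
  assumes "f \<in> L2_fun" "g \<in> L2_fun" "AE x in lebesgue. f x = f' x" "AE x in lebesgue. g x = g' x"
  shows "L2_ip f g = L2_ip f' g'"
  unfolding L2_ip_def
proof (rule integral_cong_AE)
  have "f' \<in> L2_fun" "g' \<in> L2_fun"
    using L2_fun_cong_AE[OF assms(1,3)] L2_fun_cong_AE[OF assms(2,4)] by auto
  with assms have [measurable]: "f \<in> borel_measurable lebesgue" "g \<in> borel_measurable lebesgue"
    "f' \<in> borel_measurable lebesgue" "g' \<in> borel_measurable lebesgue"
    by (auto dest: L2_fun_measurable)
  show "(\<lambda>x. cnj (f x) * g x) \<in> borel_measurable lebesgue" by measurable
  show "(\<lambda>x. cnj (f' x) * g' x) \<in> borel_measurable lebesgue" by measurable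
  show "AE x in lebesgue. cnj (f x) * g x = cnj (f' x) * g' x"
    using assms(3,4) by eventually_elim simp
qed

lemma L2_ip_add_right:
  "f \<in> L2_fun \<Longrightarrow> g \<in> L2_fun \<Longrightarrow> h \<in> L2_fun \<Longrightarrow>
    L2_ip f (\<lambda>x. g x + h x) = L2_ip f g + L2_ip f h"
  by (simp add: L2_ip_def distrib_left L2_ip_integrable)

lemma L2_ip_cmult_right: "L2_ip f (\<lambda>x. c * g x) = c * L2_ip f g"
  by (simp add: L2_ip_def mult.left_commute)

lemma L2_ip_add_left:
  "f \<in> L2_fun \<Longrightarrow> g \<in> L2_fun \<Longrightarrow> h \<in> L2_fun \<Longrightarrow>
    L2_ip (\<lambda>x. g x + h x) f = L2_ip g f + L2_ip h f"
  by (simp add: L2_ip_add_right L2_ip_cnj[of "\<lambda>x. g x + h x" f] L2_ip_cnj[of g f] L2_ip_cnj[of h f])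

lemma L2_ip_diff_right:
  "f \<in> L2_fun \<Longrightarrow> g \<in> L2_fun \<Longrightarrow> h \<in> L2_fun \<Longrightarrow>
    L2_ip f (\<lambda>x. g x - h x) = L2_ip f g - L2_ip f h"
  by (simp add: L2_ip_def right_diff_distrib L2_ip_integrable)

lemma L2_ip_diff_left:
  "f \<in> L2_fun \<Longrightarrow> g \<in> L2_fun \<Longrightarrow> h \<in> L2_fun \<Longrightarrow>
    L2_ip (\<lambda>x. g x - h x) f = L2_ip g f - L2_ip h f"
  by (simp add: L2_ip_diff_right L2_ip_cnj[of "\<lambda>x. g x - h x" f] L2_ip_cnj[of g f] L2_ip_cnj[of h f])

lemma L2_nrm_square_add:
  assumes "f \<in> L2_fun" "g \<in> L2_fun"
  shows "(L2_nrm (\<lambda>x. f x + g x))\<^sup>2 = (L2_nrm f)\<^sup>2 + 2 * Re (L2_ip f g) + (L2_nrm g)\<^sup>2"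
proof -
  have "complex_of_real ((L2_nrm (\<lambda>x. f x + g x))\<^sup>2)
      = L2_ip f f + L2_ip f g + cnj (L2_ip f g) + L2_ip g g"
    using assms
    by (simp add: L2_ip_self[symmetric] L2_ip_add_right L2_ip_add_left L2_fun_add L2_ip_cnj[of g f]
        del: of_real_power)
  from arg_cong[OF this, of Re] show ?thesis by (simp add: L2_ip_self)
qed

lemma L2_nrm_triangle:
  assumes "f \<in> L2_fun" "g \<in> L2_fun"
  shows "L2_nrm (\<lambda>x. f x + g x) \<le> L2_nrm f + L2_nrm g"
proof (rule power2_le_imp_le)
  have "Re (L2_ip f g) \<le> L2_nrm f * L2_nrm g"
    using complex_Re_le_cmod[of "L2_ip f g"] L2_ip_Cauchy_Schwarz[OF assms] by linarith
  then show "(L2_nrm (\<lambda>x. f x + g x))\<^sup>2 \<le> (L2_nrm f + L2_nrm g)\<^sup>2"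
    using assms by (simp add: L2_nrm_square_add power2_sum)
qed simp

lemma L2_nrm_diff_triangle:
  assumes "f \<in> L2_fun" "g \<in> L2_fun" "h \<in> L2_fun"
  shows "L2_nrm (\<lambda>x. f x - h x) \<le> L2_nrm (\<lambda>x. f x - g x) + L2_nrm (\<lambda>x. g x - h x)"
  using L2_nrm_triangle[OF L2_fun_diff[OF assms(1,2)] L2_fun_diff[OF assms(2,3)]] by simp

lemma L2_nrm_diff_abs:
  assumes "f \<in> L2_fun" "g \<in> L2_fun"
  shows "\<bar>L2_nrm f - L2_nrm g\<bar> \<le> L2_nrm (\<lambda>x. f x - g x)"
  using L2_nrm_triangle[OF assms(2) L2_fun_diff[OF assms]]
    L2_nrm_triangle[OF assms(1) L2_fun_diff[OF assms(2,1)]]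
  by (simp add: L2_nrm_diff_commute[of g f])

lemma L2_tendsto_nrm:
  assumes "L2_tendsto F f" shows "(\<lambda>k. L2_nrm (F k)) \<longlonglongrightarrow> L2_nrm f"
proof -
  have F: "\<And>k. F k \<in> L2_fun" and f: "f \<in> L2_fun"
    and lim: "(\<lambda>k. L2_nrm (\<lambda>x. F k x - f x)) \<longlonglongrightarrow> 0"
    using assms by (auto simp: L2_tendsto_def)
  have "(\<lambda>k. L2_nrm (F k) - L2_nrm f) \<longlonglongrightarrow> 0"
    using lim L2_nrm_diff_abs[OF F f] by (rule_tac Lim_null_comparison) (auto intro: always_eventually)
  then show ?thesis by (rule LIM_zero_cancel)
qed

lemma L2_tendsto_const: "f \<in> L2_fun \<Longrightarrow> L2_tendsto (\<lambda>_. f) f"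
  by (simp add: L2_tendsto_def L2_nrm_def)

lemma L2_tendsto_add:
  assumes "L2_tendsto F f" "L2_tendsto G g"
  shows "L2_tendsto (\<lambda>k x. F k x + G k x) (\<lambda>x. f x + g x)"
proof -
  have F: "\<And>k. F k \<in> L2_fun" and f: "f \<in> L2_fun" and G: "\<And>k. G k \<in> L2_fun" and g: "g \<in> L2_fun"
    and lim: "(\<lambda>k. L2_nrm (\<lambda>x. F k x - f x)) \<longlonglongrightarrow> 0" "(\<lambda>k. L2_nrm (\<lambda>x. G k x - g x)) \<longlonglongrightarrow> 0"
    using assms by (auto simp: L2_tendsto_def)
  have "(\<lambda>k. L2_nrm (\<lambda>x. F k x + G k x - (f x + g x))) \<longlonglongrightarrow> 0"
  proof (rule Lim_null_comparison)
    show "(\<lambda>k. L2_nrm (\<lambda>x. F k x - f x) + L2_nrm (\<lambda>x. G k x - g x)) \<longlonglongrightarrow> 0"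
      using tendsto_add[OF lim] by simp
    show "\<forall>\<^sub>F k in sequentially. norm (L2_nrm (\<lambda>x. F k x + G k x - (f x + g x)))
        \<le> L2_nrm (\<lambda>x. F k x - f x) + L2_nrm (\<lambda>x. G k x - g x)"
      using L2_nrm_triangle[OF L2_fun_diff[OF F f] L2_fun_diff[OF G g]]
      by (simp add: algebra_simps)
  qed
  then show ?thesis using F f G g by (simp add: L2_tendsto_def L2_fun_add)
qed

lemma L2_tendsto_cmult:
  assumes "L2_tendsto F f" shows "L2_tendsto (\<lambda>k x. c * F k x) (\<lambda>x. c * f x)"
  using assms tendsto_mult_left[of "\<lambda>k. L2_nrm (\<lambda>x. F k x - f x)" 0 sequentially "cmod c"]
  by (auto simp: L2_tendsto_def L2_fun_cmult L2_nrm_cmult simp flip: right_diff_distrib)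

lemma L2_tendsto_ip:
  assumes "L2_tendsto F f" "L2_tendsto G g"
  shows "(\<lambda>k. L2_ip (F k) (G k)) \<longlonglongrightarrow> L2_ip f g"
proof -
  have F: "\<And>k. F k \<in> L2_fun" and f: "f \<in> L2_fun" and G: "\<And>k. G k \<in> L2_fun" and g: "g \<in> L2_fun"
    and lim: "(\<lambda>k. L2_nrm (\<lambda>x. F k x - f x)) \<longlonglongrightarrow> 0" "(\<lambda>k. L2_nrm (\<lambda>x. G k x - g x)) \<longlonglongrightarrow> 0"
    using assms by (auto simp: L2_tendsto_def)
  have "(\<lambda>k. L2_ip (F k) (G k) - L2_ip f g) \<longlonglongrightarrow> 0"
  proof (rule Lim_null_comparison)
    show "(\<lambda>k. L2_nrm (\<lambda>x. F k x - f x) * L2_nrm (G k) + L2_nrm f * L2_nrm (\<lambda>x. G k x - g x)) \<longlonglongrightarrow> 0"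
      using tendsto_add[OF tendsto_mult[OF lim(1) L2_tendsto_nrm[OF assms(2)]]
          tendsto_mult[OF tendsto_const[of "L2_nrm f"] lim(2)]] by simp
    have "norm (L2_ip (F k) (G k) - L2_ip f g)
      \<le> L2_nrm (\<lambda>x. F k x - f x) * L2_nrm (G k) + L2_nrm f * L2_nrm (\<lambda>x. G k x - g x)" for k
    proof -
      have "L2_ip (F k) (G k) - L2_ip f g
          = L2_ip (\<lambda>x. F k x - f x) (G k) + L2_ip f (\<lambda>x. G k x - g x)"
        using F f G g by (simp add: L2_ip_diff_left L2_ip_diff_right)
      then show ?thesis
        using L2_ip_Cauchy_Schwarz[OF L2_fun_diff[OF F f] G, of k k]
          L2_ip_Cauchy_Schwarz[OF f L2_fun_diff[OF G g], of k]
        by (metis (no_types, lifting) add_mono norm_triangle_le)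
    qed
    then show "\<forall>\<^sub>F k in sequentially. norm (L2_ip (F k) (G k) - L2_ip f g)
      \<le> L2_nrm (\<lambda>x. F k x - f x) * L2_nrm (G k) + L2_nrm f * L2_nrm (\<lambda>x. G k x - g x)"
      by simp
  qed
  then show ?thesis by (rule LIM_zero_cancel)
qed

lemma L2_nrm_diff_eq_0:
  assumes "f \<in> L2_fun" "g \<in> L2_fun" "L2_nrm (\<lambda>x. f x - g x) = 0"
  shows "AE x in lebesgue. f x = g x"
  using assms L2_nrm_eq_0[OF L2_fun_diff[OF assms(1,2)]] by simp

lemma L2_tendsto_cong_AE:
  assumes "L2_tendsto F f" "AE x in lebesgue. f x = g x"
  shows "L2_tendsto F g"
proof -
  have F: "\<And>k. F k \<in> L2_fun" and f: "f \<in> L2_fun" using assms by (auto simp: L2_tendsto_def)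
  have "L2_nrm (\<lambda>x. F k x - f x) = L2_nrm (\<lambda>x. F k x - g x)" for k
    using assms(2) by (intro L2_nrm_cong_AE L2_fun_diff F f) auto
  then show ?thesis using assms L2_fun_cong_AE[OF f assms(2)] by (simp add: L2_tendsto_def)
qed

text \<open>The differences are bounded by \<open>2 * C * cmod (h x)\<close>, so their squares have
  an integrable majorant and dominated convergence applies to them.\<close>

lemma L2_tendsto_dominated:
  assumes F: "\<And>k. F k \<in> borel_measurable lebesgue" and f: "f \<in> borel_measurable lebesgue"
    and h: "h \<in> L2_fun" and dom: "\<And>k. AE x in lebesgue. cmod (F k x) \<le> C * cmod (h x)"
    and lim: "AE x in lebesgue. (\<lambda>k. F k x) \<longlonglongrightarrow> f x"
  shows "L2_tendsto F f"
proof -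
  have F2: "F k \<in> L2_fun" for k by (rule L2_fun_bound[OF h F dom])
  have "AE x in lebesgue. \<forall>k. cmod (F k x) \<le> C * cmod (h x)"
    using dom by (simp add: AE_all_countable)
  with lim have domf: "AE x in lebesgue. cmod (f x) \<le> C * cmod (h x)"
  proof eventually_elim
    case (elim x)
    show ?case
      by (rule LIMSEQ_le_const2[OF tendsto_norm[OF elim(1)]]) (use elim in auto)
  qed
  have f2: "f \<in> L2_fun" by (rule L2_fun_bound[OF h f domf])
  have "(\<lambda>k. \<integral>x. (cmod (F k x - f x))\<^sup>2 \<partial>lebesgue) \<longlonglongrightarrow> (\<integral>x. 0 \<partial>(lebesgue::'a measure))"
  proof (rule integral_dominated_convergence)
    show "integrable lebesgue (\<lambda>x. 4 * C\<^sup>2 * (cmod (h x))\<^sup>2)"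
      using L2_fun_integrable[OF h] by simp
    show "AE x in lebesgue. (\<lambda>k. (cmod (F k x - f x))\<^sup>2) \<longlonglongrightarrow> 0"
      using lim
    proof eventually_elim
      case (elim x)
      have "(\<lambda>k. (cmod (F k x - f x))\<^sup>2) \<longlonglongrightarrow> (cmod (f x - f x))\<^sup>2"
        by (intro tendsto_intros elim)
      then show ?case by simp
    qed
    fix k
    show "AE x in lebesgue. norm ((cmod (F k x - f x))\<^sup>2) \<le> 4 * C\<^sup>2 * (cmod (h x))\<^sup>2"
      using dom[of k] domf
    proof eventually_elim
      case (elim x)
      have "cmod (F k x - f x) \<le> 2 * (C * cmod (h x))"
        using elim norm_triangle_ineq4[of "F k x" "f x"] by linarith
      then have "(cmod (F k x - f x))\<^sup>2 \<le> (2 * (C * cmod (h x)))\<^sup>2"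
        by (rule power_mono) simp
      then show ?case by (simp add: power_mult_distrib)
    qed
    show "(\<lambda>x. (cmod (F k x - f x))\<^sup>2) \<in> borel_measurable lebesgue"
      using F[of k] f by measurable
  qed simp
  from tendsto_real_sqrt[OF this] show ?thesis
    using F2 f2 by (simp add: L2_tendsto_def L2_nrm_def)
qed

text \<open>Weighting the increments by \<open>2 ^ k\<close> makes their squares summable almost everywhere, hence
  the increments themselves geometrically small.\<close>

lemma L2_complete_geometric:
  assumes F: "\<And>k. F k \<in> L2_fun"
    and geo: "\<And>k. L2_nrm (\<lambda>x. F (Suc k) x - F k x) \<le> C * (1/2) ^ k"
  shows "\<exists>f. L2_tendsto F f"
proof -
  have [measurable]: "F k \<in> borel_measurable lebesgue" for k using F by (rule L2_fun_measurable)
  define D where "D k x = F (Suc k) x - F k x" for k x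
  have D: "D k \<in> L2_fun" for k unfolding D_def by (intro L2_fun_diff F)
  have [measurable]: "D k \<in> borel_measurable lebesgue" for k using D by (rule L2_fun_measurable)
  have C: "0 \<le> C" using order_trans[OF L2_nrm_nonneg geo[of 0]] by simp
  have "(\<integral>\<^sup>+x. (\<Sum>k. ennreal (2 ^ k * (cmod (D k x))\<^sup>2)) \<partial>lebesgue)
      = (\<Sum>k. \<integral>\<^sup>+x. ennreal (2 ^ k * (cmod (D k x))\<^sup>2) \<partial>lebesgue)"
    by (rule nn_integral_suminf) measurable
  also have "\<dots> = (\<Sum>k. ennreal (2 ^ k * (L2_nrm (D k))\<^sup>2))"
    using D by (simp add: ennreal_mult nn_integral_cmult nn_integral_L2)
  also have "\<dots> \<le> (\<Sum>k. ennreal (C\<^sup>2 * (1/2) ^ k))"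
  proof (intro suminf_le ennreal_leI)
    fix k
    have "(L2_nrm (D k))\<^sup>2 \<le> (C * (1/2) ^ k)\<^sup>2"
      using geo[of k] unfolding D_def by (intro power_mono) auto
    then have "2 ^ k * (L2_nrm (D k))\<^sup>2 \<le> 2 ^ k * (C * (1/2) ^ k)\<^sup>2" by simp
    also have "\<dots> = C\<^sup>2 * (1/2) ^ k"
      by (simp add: power_mult_distrib power2_eq_square field_simps)
    finally show "2 ^ k * (L2_nrm (D k))\<^sup>2 \<le> C\<^sup>2 * (1/2) ^ k" .
  qed auto
  also have "\<dots> = ennreal (\<Sum>k. C\<^sup>2 * (1/2) ^ k)"
    by (rule suminf_ennreal2) (auto intro!: summable_mult summable_geometric)
  also have "\<dots> < \<infinity>" by simp
  finally have "AE x in lebesgue. (\<Sum>k. ennreal (2 ^ k * (cmod (D k x))\<^sup>2)) \<noteq> \<infinity>"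
    by (intro nn_integral_PInf_AE) auto
  then have "AE x in lebesgue. convergent (\<lambda>k. F k x)"
  proof eventually_elim
    case (elim x)
    have s: "summable (\<lambda>k. 2 ^ k * (cmod (D k x))\<^sup>2)"
      by (rule summable_suminf_not_top) (use elim in auto)
    have "summable (\<lambda>k. cmod (D k x))"
    proof (rule summable_comparison_test'[of "\<lambda>k. 2 ^ k * (cmod (D k x))\<^sup>2 + (1/2) ^ k" 0])
      show "summable (\<lambda>k. 2 ^ k * (cmod (D k x))\<^sup>2 + (1/2) ^ k)"
        by (intro summable_add s summable_geometric) simp
      fix k :: nat
      let ?c = "cmod (D k x)" and ?t = "sqrt 2 ^ k"
      have "?t\<^sup>2 = ((sqrt 2)\<^sup>2) ^ k" by (simp only: power_mult[symmetric] mult.commute)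
      then have t: "?t > 0" "?t\<^sup>2 = 2 ^ k" by simp_all
      \<comment> \<open>Arithmetic-geometric mean for the factorization of \<open>?c\<close> into
        \<open>?t * ?c\<close> and \<open>1 / ?t\<close>; since \<open>?t\<close> squared is 2^k,
        both squares are summable in k.\<close>
      have "2 * ?c \<le> (?t * ?c)\<^sup>2 + (1 / ?t)\<^sup>2"
        using sum_squares_bound[of "?t * ?c" "1 / ?t"] t by simp
      then have "?c \<le> (?t * ?c)\<^sup>2 + (1 / ?t)\<^sup>2"
        using norm_ge_zero[of "D k x"] by linarith
      also have "\<dots> = 2 ^ k * ?c\<^sup>2 + (1/2) ^ k"
        using t by (simp add: power_mult_distrib power_divide)
      finally show "norm ?c \<le> 2 ^ k * ?c\<^sup>2 + (1/2) ^ k" by simp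
    qed
    then have "summable (\<lambda>k. D k x)" by (rule summable_norm_cancel)
    then have "convergent (\<lambda>n. \<Sum>k<n. D k x)" by (simp add: summable_iff_convergent)
    moreover have "(\<Sum>k<n. D k x) = F n x - F 0 x" for n
      unfolding D_def by (rule sum_lessThan_telescope)
    ultimately have "convergent (\<lambda>n. F n x - F 0 x)" by simp
    then have "convergent (\<lambda>n. (F n x - F 0 x) + F 0 x)"
      by (intro convergent_add convergent_const)
    then show ?case by simp
  qed
  then have lim: "AE x in lebesgue. (\<lambda>k. F k x) \<longlonglongrightarrow> lim (\<lambda>k. F k x)"
    by eventually_elim (simp add: convergent_LIMSEQ_iff)
  \<comment> \<open>\<open>lim\<close> takes an arbitrary value where the sequence diverges, which
    happens only on a null set; \<open>f\<close> is measurable all the same.\<close>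
  define f where "f x = lim (\<lambda>k. F k x)" for x
  have [measurable]: "f \<in> borel_measurable lebesgue"
    unfolding f_def by (rule borel_measurable_lim_metric) measurable
  have tail: "L2_nrm (\<lambda>x. F (j + n) x - F j x) \<le> 2 * C * (1/2) ^ j" for j n
  proof -
    \<comment> \<open>The subtracted term is the part of the geometric series not yet spent. With it
      the induction closes, because
      \<open>2 * C * (1/2) ^ m - C * (1/2) ^ m = 2 * C * (1/2) ^ Suc m\<close>.\<close>
    have "L2_nrm (\<lambda>x. F (j + n) x - F j x) \<le> 2 * C * (1/2) ^ j - 2 * C * (1/2) ^ (j + n)"
    proof (induction n)
      case 0
      show ?case by (simp add: L2_nrm_def)
    next
      case (Suc n)
      have "L2_nrm (\<lambda>x. F (j + Suc n) x - F j x)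
        \<le> L2_nrm (\<lambda>x. F (j + Suc n) x - F (j + n) x) + L2_nrm (\<lambda>x. F (j + n) x - F j x)"
        by (intro L2_nrm_diff_triangle F)
      also have "\<dots> \<le> C * (1/2) ^ (j + n) + (2 * C * (1/2) ^ j - 2 * C * (1/2) ^ (j + n))"
        using geo[of "j + n"] Suc by simp
      also have "\<dots> = 2 * C * (1/2) ^ j - 2 * C * (1/2) ^ (j + Suc n)" by simp
      finally show ?case .
    qed
    also have "\<dots> \<le> 2 * C * (1/2) ^ j" using C by simp
    finally show ?thesis .
  qed
  \<comment> \<open>Fatou's lemma lets n tend to infinity in \<open>tail\<close> before
    \<open>f\<close> is known to be square integrable; working with nonnegative integrals makes this
    legitimate.\<close>
  have fatou: "(\<integral>\<^sup>+x. ennreal ((cmod (f x - F j x))\<^sup>2) \<partial>lebesgue) \<le> ennreal ((2 * C * (1/2) ^ j)\<^sup>2)" for j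
  proof -
    have "(\<integral>\<^sup>+x. ennreal ((cmod (f x - F j x))\<^sup>2) \<partial>lebesgue)
        = (\<integral>\<^sup>+x. liminf (\<lambda>n. ennreal ((cmod (F (j + n) x - F j x))\<^sup>2)) \<partial>lebesgue)"
    proof (rule nn_integral_cong_AE)
      show "AE x in lebesgue. ennreal ((cmod (f x - F j x))\<^sup>2)
          = liminf (\<lambda>n. ennreal ((cmod (F (j + n) x - F j x))\<^sup>2))"
        using lim
      proof eventually_elim
        case (elim x)
        have "(\<lambda>n. F (j + n) x) \<longlonglongrightarrow> f x"
          using LIMSEQ_ignore_initial_segment[OF elim, of j] by (simp add: f_def add.commute)
        then have "(\<lambda>n. ennreal ((cmod (F (j + n) x - F j x))\<^sup>2)) \<longlonglongrightarrow> ennreal ((cmod (f x - F j x))\<^sup>2)"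
          by (intro tendsto_ennrealI tendsto_intros)
        then show ?case by (rule lim_imp_Liminf[symmetric, rotated]) simp
      qed
    qed
    also have "\<dots> \<le> liminf (\<lambda>n. \<integral>\<^sup>+x. ennreal ((cmod (F (j + n) x - F j x))\<^sup>2) \<partial>lebesgue)"
      by (rule nn_integral_liminf) measurable
    also have "\<dots> = liminf (\<lambda>n. ennreal ((L2_nrm (\<lambda>x. F (j + n) x - F j x))\<^sup>2))"
      by (simp add: nn_integral_L2 L2_fun_diff F)
    also have "\<dots> \<le> liminf (\<lambda>n::nat. ennreal ((2 * C * (1/2) ^ j)\<^sup>2))"
      by (intro Liminf_mono always_eventually allI ennreal_leI power_mono tail) simp
    also have "\<dots> = ennreal ((2 * C * (1/2) ^ j)\<^sup>2)"
      by (rule Liminf_const) simp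
    finally show ?thesis .
  qed
  have fF: "(\<lambda>x. f x - F j x) \<in> L2_fun" for j
  proof (rule L2_funI)
    have "(\<integral>\<^sup>+x. ennreal ((cmod (f x - F j x))\<^sup>2) \<partial>lebesgue) < \<infinity>"
      using fatou[of j] by (rule order.strict_trans1) simp
    then show "integrable lebesgue (\<lambda>x. (cmod (f x - F j x))\<^sup>2)"
      by (intro integrableI_bounded) auto
  qed measurable
  have "f \<in> L2_fun" using L2_fun_add[OF fF F, of 0 0] by simp
  moreover have "L2_nrm (\<lambda>x. F j x - f x) \<le> 2 * C * (1/2) ^ j" for j
  proof -
    have "ennreal ((L2_nrm (\<lambda>x. f x - F j x))\<^sup>2) \<le> ennreal ((2 * C * (1/2) ^ j)\<^sup>2)"
      using fatou[of j] nn_integral_L2[OF fF, of j] by simp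
    then have "(L2_nrm (\<lambda>x. f x - F j x))\<^sup>2 \<le> (2 * C * (1/2) ^ j)\<^sup>2"
      by (subst (asm) ennreal_le_iff) auto
    then show ?thesis
      by (subst L2_nrm_diff_commute) (rule power2_le_imp_le, use C in auto)
  qed
  moreover have "(\<lambda>j. 2 * C * (1/2) ^ j) \<longlonglongrightarrow> 0"
    using tendsto_mult_left[OF LIMSEQ_realpow_zero[of "1/2"], of "2 * C"] by simp
  ultimately have "(\<lambda>j. L2_nrm (\<lambda>x. F j x - f x)) \<longlonglongrightarrow> 0"
    by (rule_tac Lim_null_comparison[of _ "\<lambda>j. 2 * C * (1/2) ^ j"]) auto
  with \<open>f \<in> L2_fun\<close> F show ?thesis by (auto simp: L2_tendsto_def)
qed

section \<open>Translation is continuous in \<open>L\<^sup>2\<close>\<close>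

text \<open>The Fubini arguments need joint measurability of expressions such as f(x + t), which
  Borel functions provide; L^2 functions are replaced by Borel representatives there.\<close>

lemma lebesgue_ex_borel:
  fixes f :: "'a::euclidean_space \<Rightarrow> complex"
  assumes "f \<in> borel_measurable lebesgue"
  obtains f' where "f' \<in> borel_measurable borel" "AE x in lebesgue. f x = f' x"
proof -
  have "(\<lambda>x. Re (f x)) \<in> borel_measurable lebesgue" "(\<lambda>x. Im (f x)) \<in> borel_measurable lebesgue"
    using assms by measurable
  from this[THEN completion_ex_borel_measurable_real] obtain u v :: "'a \<Rightarrow> real"
    where uv: "u \<in> borel_measurable borel" "v \<in> borel_measurable borel"
      "AE x in lborel. Re (f x) = u x" "AE x in lborel. Im (f x) = v x"
    by auto
  show thesis
  proof
    show "(\<lambda>x. of_real (u x) + \<i> * of_real (v x)) \<in> borel_measurable borel"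
      using uv(1,2) by measurable
    have "AE x in lebesgue. Re (f x) = u x" "AE x in lebesgue. Im (f x) = v x"
      using uv(3,4) by (auto intro: AE_completion)
    then show "AE x in lebesgue. f x = of_real (u x) + \<i> * of_real (v x)"
      by eventually_elim (simp add: complex_eq_iff)
  qed
qed

lemma integral_lebesgue_lborel:
  fixes f :: "'a::euclidean_space \<Rightarrow> 'b::{banach, second_countable_topology}"
  shows "f \<in> borel_measurable borel \<Longrightarrow> integral\<^sup>L lebesgue f = integral\<^sup>L lborel f"
  by (rule integral_completion) simp

lemma integrable_lebesgue_lborel:
  fixes f :: "'a::euclidean_space \<Rightarrow> 'b::{banach, second_countable_topology}"
  shows "f \<in> borel_measurable borel \<Longrightarrow> integrable lebesgue f \<longleftrightarrow> integrable lborel f"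
  by (rule integrable_completion) simp

lemma measurable_lebesgueI:
  fixes f :: "'a::euclidean_space \<Rightarrow> 'b::topological_space"
  shows "f \<in> borel_measurable borel \<Longrightarrow> f \<in> borel_measurable lebesgue"
  by (rule measurable_completion) simp

section \<open>Maps preserving Lebesgue measure: translations and reflections\<close>

definition lebesgue_preserving :: "('a::euclidean_space \<Rightarrow> 'a) \<Rightarrow> bool" where
  "lebesgue_preserving T \<longleftrightarrow> T \<in> lebesgue \<rightarrow>\<^sub>M lebesgue \<and> distr lebesgue lebesgue T = lebesgue"

text \<open>Dilation by \<open>c\<close> changes Lebesgue measure by the factor |c|^n, which is 1
  here; \<open>c = 1\<close> and \<open>c = -1\<close> are the cases of interest.\<close>

lemma lebesgue_preserving_affine:
  fixes t :: "'a::euclidean_space"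
  assumes "\<bar>c\<bar> = 1"
  shows "lebesgue_preserving (\<lambda>x. t + c *\<^sub>R x)"
proof -
  have c: "c \<noteq> 0" using assms by auto
  have T: "(\<lambda>x::'a. t + (\<Sum>j\<in>Basis. (c * (x \<bullet> j)) *\<^sub>R j)) = (\<lambda>x. t + c *\<^sub>R x)"
    unfolding scaleR_scaleR[symmetric] scaleR_sum_right[symmetric] euclidean_representation ..
  show ?thesis
    using lebesgue_affine_euclidean[of "\<lambda>_. c" t] lebesgue_affine_measurable[of "\<lambda>_. c" t] c
    unfolding T by (simp add: lebesgue_preserving_def assms density_1)
qed

lemma lebesgue_preserving_translate: "lebesgue_preserving (\<lambda>x. x + t)"
  using lebesgue_preserving_affine[of 1 t] by (simp add: add.commute)

lemma lebesgue_preserving_reflect: "lebesgue_preserving (\<lambda>x. t - x)"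
  using lebesgue_preserving_affine[of "-1" t] by simp

lemma lebesgue_preserving_uminus: "lebesgue_preserving uminus"
  using lebesgue_preserving_reflect[of 0] by simp

context
  fixes T :: "'a::euclidean_space \<Rightarrow> 'a"
  assumes T: "lebesgue_preserving T"
begin

lemma lebesgue_preserving_measurable:
  "f \<in> borel_measurable lebesgue \<Longrightarrow> (\<lambda>x. f (T x)) \<in> borel_measurable lebesgue"
  using T by (auto simp: lebesgue_preserving_def intro: measurable_compose)

lemma lebesgue_preserving_integral:
  fixes f :: "'a \<Rightarrow> 'b::{banach, second_countable_topology}"
  shows "f \<in> borel_measurable lebesgue \<Longrightarrow> (\<integral>x. f (T x) \<partial>lebesgue) = integral\<^sup>L lebesgue f"
  using T integral_distr[of T lebesgue lebesgue f] by (simp add: lebesgue_preserving_def)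

lemma lebesgue_preserving_integrable:
  fixes f :: "'a \<Rightarrow> 'b::{banach, second_countable_topology}"
  shows "integrable lebesgue f \<Longrightarrow> integrable lebesgue (\<lambda>x. f (T x))"
  using T integrable_distr[of T lebesgue lebesgue f] by (simp add: lebesgue_preserving_def)

lemma lebesgue_preserving_AE:
  "AE x in lebesgue. P x \<Longrightarrow> AE x in lebesgue. P (T x)"
  using T AE_distrD[of T lebesgue lebesgue P] by (metis lebesgue_preserving_def)

lemma lebesgue_preserving_L2:
  assumes "f \<in> L2_fun" shows "(\<lambda>x. f (T x)) \<in> L2_fun"
  using lebesgue_preserving_integrable[OF L2_fun_integrable[OF assms]]
    lebesgue_preserving_measurable[OF L2_fun_measurable[OF assms]] by (rule L2_funI[rotated])

lemma lebesgue_preserving_L2_nrm: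
  assumes "f \<in> L2_fun" shows "L2_nrm (\<lambda>x. f (T x)) = L2_nrm f"
  using lebesgue_preserving_integral[OF borel_measurable_integrable[OF L2_fun_integrable[OF assms]]]
  by (simp add: L2_nrm_def)

lemma lebesgue_preserving_L2_tendsto:
  assumes "L2_tendsto F f" shows "L2_tendsto (\<lambda>k x. F k (T x)) (\<lambda>x. f (T x))"
proof -
  have F: "\<And>k. F k \<in> L2_fun" and f: "f \<in> L2_fun" using assms by (auto simp: L2_tendsto_def)
  show ?thesis
    using assms lebesgue_preserving_L2_nrm[OF L2_fun_diff[OF F f]]
    by (simp add: L2_tendsto_def lebesgue_preserving_L2)
qed

end

text \<open>Continuity at zero is phrased with sequences of shifts because L^2 convergence is
  defined for sequences.\<close>

definition translation_continuous :: "('a::euclidean_space \<Rightarrow> complex) \<Rightarrow> bool" where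
  "translation_continuous f \<longleftrightarrow>
     (\<forall>t. t \<longlonglongrightarrow> 0 \<longrightarrow> L2_tendsto (\<lambda>k x. f (x + t k)) f)"

lemma translation_continuous_add:
  "translation_continuous f \<Longrightarrow> translation_continuous g \<Longrightarrow> translation_continuous (\<lambda>x. f x + g x)"
  unfolding translation_continuous_def using L2_tendsto_add by fast

lemma translation_continuous_cmult:
  "translation_continuous f \<Longrightarrow> translation_continuous (\<lambda>x. c * f x)"
  unfolding translation_continuous_def using L2_tendsto_cmult by fast

text \<open>A three-epsilon argument: translation is an isometry, so replacing \<open>f\<close> by
  \<open>G j\<close> costs the same error before and after the shift.\<close>

lemma translation_continuous_limit:
  assumes lim: "L2_tendsto G f" and G: "\<And>j. translation_continuous (G j)"
  shows "translation_continuous f"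
  unfolding translation_continuous_def
proof (intro allI impI)
  fix t :: "nat \<Rightarrow> 'a" assume t: "t \<longlonglongrightarrow> 0"
  have f: "f \<in> L2_fun" and Gj: "\<And>j. G j \<in> L2_fun"
    and nl: "(\<lambda>j. L2_nrm (\<lambda>x. G j x - f x)) \<longlonglongrightarrow> 0"
    using lim by (auto simp: L2_tendsto_def)
  note shift = lebesgue_preserving_L2[OF lebesgue_preserving_translate]
  have "(\<lambda>k. L2_nrm (\<lambda>x. f (x + t k) - f x)) \<longlonglongrightarrow> 0"
  proof (rule LIMSEQ_I)
    fix e :: real assume e: "e > 0"
    then obtain j where j: "L2_nrm (\<lambda>x. G j x - f x) < e / 3"
      using LIMSEQ_D[OF nl, of "e / 3"] by auto
    have "(\<lambda>k. L2_nrm (\<lambda>x. G j (x + t k) - G j x)) \<longlonglongrightarrow> 0"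
      using G[of j] t by (auto simp: translation_continuous_def L2_tendsto_def)
    from LIMSEQ_D[OF this, of "e / 3"] e obtain K
      where K: "\<And>k. k \<ge> K \<Longrightarrow> L2_nrm (\<lambda>x. G j (x + t k) - G j x) < e / 3" by auto
    have "L2_nrm (\<lambda>x. f (x + t k) - f x) < e" if "k \<ge> K" for k
    proof -
      have "L2_nrm (\<lambda>x. f (x + t k) - f x)
        \<le> L2_nrm (\<lambda>x. f (x + t k) - G j (x + t k)) + L2_nrm (\<lambda>x. G j (x + t k) - f x)"
        by (intro L2_nrm_diff_triangle shift f Gj)
      also have "L2_nrm (\<lambda>x. G j (x + t k) - f x)
        \<le> L2_nrm (\<lambda>x. G j (x + t k) - G j x) + L2_nrm (\<lambda>x. G j x - f x)"
        by (intro L2_nrm_diff_triangle shift f Gj)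
      also have "L2_nrm (\<lambda>x. f (x + t k) - G j (x + t k)) = L2_nrm (\<lambda>x. G j x - f x)"
        using lebesgue_preserving_L2_nrm[OF lebesgue_preserving_translate L2_fun_diff[OF f Gj], of "t k" j]
        by (simp add: L2_nrm_diff_commute[of f])
      finally show ?thesis using K[OF that] j by simp
    qed
    then show "\<exists>K. \<forall>k\<ge>K. norm (L2_nrm (\<lambda>x. f (x + t k) - f x) - 0) < e" by auto
  qed
  then show "L2_tendsto (\<lambda>k x. f (x + t k)) f"
    using f shift[OF f] by (simp add: L2_tendsto_def)
qed

lemma L2_fun_indicator:
  assumes "A \<in> sets lebesgue" "emeasure lebesgue A < \<infinity>"
  shows "(\<lambda>x. of_real (indicator A x)) \<in> L2_fun"
proof (rule L2_funI)
  show "(\<lambda>x. complex_of_real (indicator A x)) \<in> borel_measurable lebesgue"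
    using assms(1) by measurable
  have "(\<lambda>x. (cmod (of_real (indicator A x)))\<^sup>2) = (indicator A :: 'a \<Rightarrow> real)"
    by (auto simp: indicator_def)
  then show "integrable lebesgue (\<lambda>x. (cmod (of_real (indicator A x)))\<^sup>2)"
    using integrable_real_indicator[OF assms] by simp
qed

text \<open>The squared distance equals twice the measure of \<open>U\<close> minus twice that of
  the overlap of \<open>U\<close> with its translate. The overlap converges because a point of the
  open set stays inside under small shifts; points outside contribute nothing, so the boundary may
  have any measure.\<close>

lemma translation_continuous_indicator_open:
  assumes "open U" "emeasure lebesgue U < \<infinity>"
  shows "translation_continuous (\<lambda>x. of_real (indicator U x))"
  unfolding translation_continuous_def
proof (intro allI impI)
  fix t :: "nat \<Rightarrow> 'a" assume t: "t \<longlonglongrightarrow> 0"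
  let ?i = "indicator U :: 'a \<Rightarrow> real"
  have U: "U \<in> sets lebesgue" using assms(1) by auto
  have int: "integrable lebesgue ?i" by (rule integrable_real_indicator[OF U assms(2)])
  have i2: "(\<lambda>x. of_real (?i x)) \<in> L2_fun" by (rule L2_fun_indicator[OF U assms(2)])
  note tr = lebesgue_preserving_translate
  have [measurable]: "?i \<in> borel_measurable lebesgue" "(\<lambda>x. ?i (x + t k)) \<in> borel_measurable lebesgue" for k
    using U lebesgue_preserving_measurable[OF tr, of ?i "t k"] by measurable
  have prod_int: "integrable lebesgue (\<lambda>x. ?i x * ?i (x + t k))" for k
    by (rule Bochner_Integration.integrable_bound[OF int]) (measurable, auto simp: indicator_def)
  have "(\<lambda>k. \<integral>x. ?i x * ?i (x + t k) \<partial>lebesgue) \<longlonglongrightarrow> (\<integral>x. ?i x \<partial>lebesgue)"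
  proof (rule integral_dominated_convergence[OF _ _ int])
    show "AE x in lebesgue. (\<lambda>k. ?i x * ?i (x + t k)) \<longlonglongrightarrow> ?i x"
    proof (rule AE_I2)
      fix x :: 'a
      show "(\<lambda>k. ?i x * ?i (x + t k)) \<longlonglongrightarrow> ?i x"
      proof (cases "x \<in> U")
        case True
        have "(\<lambda>k. x + t k) \<longlonglongrightarrow> x" using tendsto_add[OF tendsto_const t, of x] by simp
        then have "\<forall>\<^sub>F k in sequentially. x + t k \<in> U"
          using assms(1) True by (rule topological_tendstoD)
        then have "\<forall>\<^sub>F k in sequentially. ?i x * ?i (x + t k) = ?i x"
          by eventually_elim (simp add: True)
        then show ?thesis by (rule tendsto_eventually)
      qed simp
    qed
    show "AE x in lebesgue. norm (?i x * ?i (x + t k)) \<le> ?i x" for k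
      by (auto simp: indicator_def)
  qed measurable
  then have "(\<lambda>k. 2 * (\<integral>x. ?i x \<partial>lebesgue) - 2 * (\<integral>x. ?i x * ?i (x + t k) \<partial>lebesgue)) \<longlonglongrightarrow>
      2 * (\<integral>x. ?i x \<partial>lebesgue) - 2 * (\<integral>x. ?i x \<partial>lebesgue)"
    by (intro tendsto_intros)
  moreover have "(\<integral>x. (cmod (of_real (?i (x + t k)) - of_real (?i x)))\<^sup>2 \<partial>lebesgue)
      = 2 * (\<integral>x. ?i x \<partial>lebesgue) - 2 * (\<integral>x. ?i x * ?i (x + t k) \<partial>lebesgue)" for k
  proof -
    have "(\<integral>x. (cmod (of_real (?i (x + t k)) - of_real (?i x)))\<^sup>2 \<partial>lebesgue)
        = (\<integral>x. ?i (x + t k) + ?i x - 2 * (?i x * ?i (x + t k)) \<partial>lebesgue)"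
      by (rule Bochner_Integration.integral_cong) (auto simp: indicator_def)
    also have "\<dots> = (\<integral>x. ?i (x + t k) \<partial>lebesgue) + (\<integral>x. ?i x \<partial>lebesgue)
        - 2 * (\<integral>x. ?i x * ?i (x + t k) \<partial>lebesgue)"
      using int prod_int lebesgue_preserving_integrable[OF tr int, of "t k"] by simp
    also have "(\<integral>x. ?i (x + t k) \<partial>lebesgue) = (\<integral>x. ?i x \<partial>lebesgue)"
      by (rule lebesgue_preserving_integral[OF tr]) measurable
    finally show ?thesis by simp
  qed
  ultimately have "(\<lambda>k. \<integral>x. (cmod (of_real (?i (x + t k)) - of_real (?i x)))\<^sup>2 \<partial>lebesgue) \<longlonglongrightarrow> 0"
    by simp
  from tendsto_real_sqrt[OF this]
  show "L2_tendsto (\<lambda>k x. of_real (?i (x + t k))) (\<lambda>x. of_real (?i x))"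
    using i2 lebesgue_preserving_L2[OF tr i2] by (simp add: L2_tendsto_def L2_nrm_def)
qed

text \<open>Outer regularity: \<open>A\<close> is approximated in L^2 by open supersets whose excess
  has measure below 1/(j+1).\<close>

lemma translation_continuous_indicator:
  assumes A: "A \<in> sets lebesgue" "emeasure lebesgue A < \<infinity>"
  shows "translation_continuous (\<lambda>x. of_real (indicator A x))"
proof -
  have "\<exists>U. open U \<and> A \<subseteq> U \<and> U - A \<in> lmeasurable \<and> emeasure lebesgue (U - A) < ennreal (1 / real (Suc j))" for j
    by (rule sets_lebesgue_outer_open[OF A(1), of "1 / real (Suc j)"]) (simp, blast)
  then have "\<forall>j. \<exists>U. open U \<and> A \<subseteq> U \<and> U - A \<in> lmeasurable \<and> emeasure lebesgue (U - A) < ennreal (1 / real (Suc j))"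
    by (rule allI)
  from choice[OF this] obtain U where U': "\<forall>j. open (U j) \<and> A \<subseteq> U j \<and> U j - A \<in> lmeasurable \<and>
      emeasure lebesgue (U j - A) < ennreal (1 / real (Suc j))" ..
  have U: "\<And>j. open (U j)" "\<And>j. A \<subseteq> U j" "\<And>j. U j - A \<in> lmeasurable"
    "\<And>j. emeasure lebesgue (U j - A) < ennreal (1 / real (Suc j))"
    using U' by blast+
  have fin: "emeasure lebesgue (U j) < \<infinity>" for j
  proof -
    have "emeasure lebesgue (U j) = emeasure lebesgue (A \<union> (U j - A))"
      using U(2)[of j] by (simp add: Un_absorb1)
    also have "\<dots> \<le> emeasure lebesgue A + emeasure lebesgue (U j - A)"
      using A U(3)[of j] by (intro emeasure_subadditive) (auto simp: fmeasurable_def)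
    also have "\<dots> < \<infinity>"
      using A(2) U(3)[of j] by (auto simp: fmeasurable_def)
    finally show ?thesis .
  qed
  have Us: "U j \<in> sets lebesgue" for j using U(1) by auto
  have nrm: "L2_nrm (\<lambda>x. of_real (indicator (U j) x) - of_real (indicator A x)) \<le> sqrt (1 / real (Suc j))" for j
  proof -
    have "(\<integral>x. (cmod (of_real (indicator (U j) x) - of_real (indicator A x)))\<^sup>2 \<partial>lebesgue)
        = (\<integral>x. indicator (U j - A) x \<partial>lebesgue)"
      using U(2)[of j] by (intro Bochner_Integration.integral_cong) (auto simp: indicator_def)
    also have "\<dots> = measure lebesgue (U j - A)" by simp
    also have "\<dots> \<le> 1 / real (Suc j)"
    proof -
      have "ennreal (measure lebesgue (U j - A)) < ennreal (1 / real (Suc j))"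
        using U(4)[of j] emeasure_eq_measure2[OF U(3)[of j]] by metis
      then show ?thesis by (subst (asm) ennreal_less_iff) auto
    qed
    finally show ?thesis by (simp add: L2_nrm_def)
  qed
  have lim: "(\<lambda>j. sqrt (1 / real (Suc j))) \<longlonglongrightarrow> 0"
    using tendsto_real_sqrt[OF LIMSEQ_inverse_real_of_nat] by (simp add: inverse_eq_divide)
  have "(\<lambda>j. L2_nrm (\<lambda>x. of_real (indicator (U j) x) - of_real (indicator A x))) \<longlonglongrightarrow> 0"
    by (rule Lim_null_comparison[OF _ lim]) (use nrm in auto)
  then have "L2_tendsto (\<lambda>j x. of_real (indicator (U j) x)) (\<lambda>x. of_real (indicator A x))"
    using L2_fun_indicator[OF A] L2_fun_indicator[OF Us fin] by (simp add: L2_tendsto_def)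
  then show ?thesis
    by (rule translation_continuous_limit) (rule translation_continuous_indicator_open[OF U(1) fin])
qed

text \<open>Square integrability is a premise inside the proposition under induction, so each
  building block must be shown to lie in L^2 before its induction hypothesis applies.\<close>

lemma translation_continuous_nonneg:
  fixes u :: "'a::euclidean_space \<Rightarrow> real"
  assumes "u \<in> borel_measurable lebesgue" "\<And>x. 0 \<le> u x"
  shows "(\<lambda>x. of_real (u x)) \<in> L2_fun \<Longrightarrow> translation_continuous (\<lambda>x. of_real (u x))"
  using assms
proof (induction u rule: borel_measurable_induct_real)
  case (set A)
  have "(\<lambda>x. (cmod (of_real (indicator A x)))\<^sup>2) = (indicator A :: 'a \<Rightarrow> real)"
    by (auto simp: indicator_def)
  with L2_fun_integrable[OF set(2)] have "integrable lebesgue (indicator A :: 'a \<Rightarrow> real)" by simp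
  then have "emeasure lebesgue A < \<infinity>" using set(1) by (simp add: integrable_indicator_iff)
  with set(1) show ?case by (rule translation_continuous_indicator)
next
  case (mult u c)
  show ?case
  \<comment> \<open>If \<open>c\<close> vanishes, square integrability of the multiple says nothing
    about \<open>u\<close>, so the induction hypothesis is out of reach.\<close>
  proof (cases "c = 0")
    case True
    then show ?thesis by (simp add: translation_continuous_def L2_tendsto_const L2_fun_zero)
  next
    case False
    then have "(\<lambda>x. complex_of_real (u x)) \<in> L2_fun"
      using L2_fun_cmult[OF mult(5), of "of_real (inverse c)"] by (simp add: field_simps)
    from translation_continuous_cmult[OF mult(4)[OF this], of "of_real c"] show ?thesis by simp
  qed
next
  case (add u v)
  \<comment> \<open>Both summands are nonnegative and hence dominated by their sum.\<close>
  have "(\<lambda>x. complex_of_real (u x)) \<in> L2_fun" "(\<lambda>x. complex_of_real (v x)) \<in> L2_fun"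
    using add by (auto intro!: L2_fun_bound[OF add(8), where C = 1] simp flip: of_real_add)
  then show ?case using translation_continuous_add[OF add.IH(2) add.IH(1)] by simp
next
  case (seq U)
  have le: "U i x \<le> u x" for i x
    using seq.hyps(3,4) by (intro incseq_le) (auto simp: incseq_def le_fun_def)
  have dom: "cmod (of_real (U i x)) \<le> 1 * cmod (of_real (u x))" for i x
    using le[of i x] seq(2)[of i x] by simp
  have [measurable]: "U i \<in> borel_measurable lebesgue" for i by (rule seq(1))
  have Ui: "(\<lambda>x. complex_of_real (U i x)) \<in> L2_fun" for i
    by (rule L2_fun_bound[OF seq(6), where C = 1]) (use dom in auto)
  show ?case
  proof (rule translation_continuous_limit)
    show "L2_tendsto (\<lambda>i x. complex_of_real (U i x)) (\<lambda>x. of_real (u x))"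
    proof (rule L2_tendsto_dominated[OF _ L2_fun_measurable[OF seq(6)] seq(6)])
      show "AE x in lebesgue. cmod (of_real (U k x)) \<le> 1 * cmod (of_real (u x))" for k
        using dom by auto
      show "AE x in lebesgue. (\<lambda>k. complex_of_real (U k x)) \<longlonglongrightarrow> of_real (u x)"
        using seq.hyps(4) by (auto intro!: tendsto_of_real)
    qed measurable
    show "translation_continuous (\<lambda>x. complex_of_real (U i x))" for i
      by (rule seq.IH[OF Ui])
  qed
qed

text \<open>Positive and negative parts of the real and imaginary parts reduce the claim to four
  nonnegative functions, each dominated by \<open>cmod (f x)\<close>.\<close>

lemma translation_continuous_L2:
  assumes f: "f \<in> L2_fun" shows "translation_continuous f"
proof -
  have [measurable]: "f \<in> borel_measurable lebesgue" using f by (rule L2_fun_measurable)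
  have *: "translation_continuous (\<lambda>x. of_real (u (f x)))"
    if [measurable]: "u \<in> borel_measurable borel" and "\<And>z. 0 \<le> u z" "\<And>z. u z \<le> cmod z" for u
  proof (rule translation_continuous_nonneg)
    show "(\<lambda>x. complex_of_real (u (f x))) \<in> L2_fun"
      by (rule L2_fun_bound[OF f, where C = 1]) (measurable, simp add: that)
    show "(\<lambda>x. u (f x)) \<in> borel_measurable lebesgue" by measurable
    show "0 \<le> u (f x)" for x by (rule that)
  qed
  have 1: "translation_continuous (\<lambda>x. of_real (max 0 (Re (f x))))"
    by (rule *[where u = "\<lambda>z. max 0 (Re z)"]) (auto intro: complex_Re_le_cmod)
  have 2: "translation_continuous (\<lambda>x. of_real (max 0 (- Re (f x))))"
    using abs_Re_le_cmod by (intro *[where u = "\<lambda>z. max 0 (- Re z)"]) (auto simp: abs_le_iff)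
  have 3: "translation_continuous (\<lambda>x. of_real (max 0 (Im (f x))))"
    using abs_Im_le_cmod by (intro *[where u = "\<lambda>z. max 0 (Im z)"]) (auto simp: abs_le_iff)
  have 4: "translation_continuous (\<lambda>x. of_real (max 0 (- Im (f x))))"
    using abs_Im_le_cmod by (intro *[where u = "\<lambda>z. max 0 (- Im z)"]) (auto simp: abs_le_iff)
  have "translation_continuous (\<lambda>x. (of_real (max 0 (Re (f x))) + (-1) * of_real (max 0 (- Re (f x))))
      + \<i> * (of_real (max 0 (Im (f x))) + (-1) * of_real (max 0 (- Im (f x)))))"
    by (rule translation_continuous_add[OF
          translation_continuous_add[OF 1 translation_continuous_cmult[OF 2]]
          translation_continuous_cmult[OF translation_continuous_add[OF 3 translation_continuous_cmult[OF 4]]]])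
  moreover have "(of_real (max 0 (Re z)) + (-1) * of_real (max 0 (- Re z)))
      + \<i> * (of_real (max 0 (Im z)) + (-1) * of_real (max 0 (- Im z))) = z" for z
    by (simp add: complex_eq_iff max_def)
  ultimately show ?thesis by simp
qed

lemma L2_translate_tendsto:
  assumes f: "f \<in> L2_fun" and t: "t \<longlonglongrightarrow> a"
  shows "L2_tendsto (\<lambda>k x. f (x + t k)) (\<lambda>x. f (x + a))"
proof -
  have "(\<lambda>k. t k - a) \<longlonglongrightarrow> 0" using t by (simp add: LIM_zero)
  then have "L2_tendsto (\<lambda>k x. f (x + (t k - a))) f"
    using translation_continuous_L2[OF f] by (auto simp: translation_continuous_def)
  from lebesgue_preserving_L2_tendsto[OF lebesgue_preserving_translate this, of a]
  show ?thesis by simp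
qed

section \<open>The Fourier integral and the Gaussian\<close>

text \<open>The unitary character of the transform. Its symmetry in the two arguments is what moves
  the transform from one factor of an integral to the other.\<close>

definition fkernel :: "'a::euclidean_space \<Rightarrow> 'a \<Rightarrow> complex" where
  "fkernel x \<xi> = exp (- 2 * of_real pi * \<i> * of_real (x \<bullet> \<xi>))"

lemma fourier_integral_kernel:
  "fourier_integral f \<xi> = (\<integral>x. f x * fkernel x \<xi> \<partial>lebesgue)"
  by (simp add: fourier_integral_def fkernel_def)

lemma norm_fkernel [simp]: "cmod (fkernel x \<xi>) = 1"
  by (simp add: fkernel_def norm_exp_eq_Re)

lemma fkernel_commute: "fkernel x \<xi> = fkernel \<xi> x"
  by (simp add: fkernel_def inner_commute)

lemma fkernel_add: "fkernel (x + y) \<xi> = fkernel x \<xi> * fkernel y \<xi>"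
  by (simp add: fkernel_def inner_add_left distrib_left flip: exp_add)

lemma fkernel_diff: "fkernel x (\<xi> - \<eta>) = fkernel x \<xi> * cnj (fkernel x \<eta>)"
  by (simp add: fkernel_def inner_diff_right algebra_simps exp_cnj flip: exp_add)

lemma fkernel_minus: "fkernel (- x) \<xi> = cnj (fkernel x \<xi>)"
  "fkernel x (- \<xi>) = cnj (fkernel x \<xi>)"
  by (simp_all add: fkernel_def exp_cnj)

lemma fkernel_scaleR: "fkernel (c *\<^sub>R x) \<xi> = fkernel x (c *\<^sub>R \<xi>)"
  by (simp add: fkernel_def)

lemma fkernel_mult_cnj [simp]: "fkernel x \<xi> * cnj (fkernel x \<xi>) = 1"
  using complex_norm_square[of "fkernel x \<xi>"] by simp

lemma borel_measurable_fkernel [measurable]: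
  "f \<in> borel_measurable M \<Longrightarrow> g \<in> borel_measurable M \<Longrightarrow> (\<lambda>x. fkernel (f x) (g x)) \<in> borel_measurable M"
  unfolding fkernel_def by measurable

lemma measurable_fkernel_lebesgue [measurable]: "(\<lambda>x. fkernel x \<xi>) \<in> borel_measurable lebesgue"
  by (rule measurable_lebesgueI) measurable

lemma tendsto_fkernel:
  "(f \<longlongrightarrow> a) F \<Longrightarrow> ((\<lambda>k. fkernel x (f k)) \<longlongrightarrow> fkernel x a) F"
  unfolding fkernel_def by (intro tendsto_intros)

lemma integrable_fkernel:
  assumes "integrable lebesgue f" shows "integrable lebesgue (\<lambda>x. f x * fkernel x \<xi>)"
proof (rule Bochner_Integration.integrable_bound[OF assms])
  have [measurable]: "f \<in> borel_measurable lebesgue" using assms by auto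
  show "(\<lambda>x. f x * fkernel x \<xi>) \<in> borel_measurable lebesgue" by measurable
qed (simp add: norm_mult)

lemma fourier_integral_cong_AE:
  assumes "f \<in> borel_measurable lebesgue" "AE x in lebesgue. f x = g x"
  shows "fourier_integral f = fourier_integral g"
proof
  fix \<xi>
  have [measurable]: "f \<in> borel_measurable lebesgue" "g \<in> borel_measurable lebesgue"
    using assms measurable_lebesgue_cong_AE[OF assms] by auto
  show "fourier_integral f \<xi> = fourier_integral g \<xi>"
    unfolding fourier_integral_kernel
  proof (rule integral_cong_AE)
    show "AE x in lebesgue. f x * fkernel x \<xi> = g x * fkernel x \<xi>"
      using assms(2) by eventually_elim simp
  qed measurable
qed

lemma fourier_integral_add:
  assumes "integrable lebesgue f" "integrable lebesgue g"
  shows "fourier_integral (\<lambda>x. f x + g x) \<xi> = fourier_integral f \<xi> + fourier_integral g \<xi>"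
  unfolding fourier_integral_kernel using assms by (simp add: distrib_right integrable_fkernel)

lemma fourier_integral_diff:
  assumes "integrable lebesgue f" "integrable lebesgue g"
  shows "fourier_integral (\<lambda>x. f x - g x) \<xi> = fourier_integral f \<xi> - fourier_integral g \<xi>"
  unfolding fourier_integral_kernel using assms by (simp add: left_diff_distrib integrable_fkernel)

lemma fourier_integral_cmult:
  "fourier_integral (\<lambda>x. c * f x) \<xi> = c * fourier_integral f \<xi>"
  unfolding fourier_integral_kernel by (simp add: mult.assoc)

lemma fourier_integral_bound:
  "cmod (fourier_integral f \<xi>) \<le> (\<integral>x. cmod (f x) \<partial>lebesgue)"
  unfolding fourier_integral_kernel
  using integral_norm_bound[of lebesgue "\<lambda>x. f x * fkernel x \<xi>"] by (simp add: norm_mult)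

lemma continuous_fourier_integral:
  assumes f: "integrable lebesgue f"
  shows "continuous_on UNIV (fourier_integral f)"
  unfolding continuous_on_sequentially comp_def
proof (intro allI impI ballI, elim conjE)
  fix X :: "nat \<Rightarrow> 'a" and a assume X: "X \<longlonglongrightarrow> a"
  have [measurable]: "f \<in> borel_measurable lebesgue" using f by auto
  show "(\<lambda>n. fourier_integral f (X n)) \<longlonglongrightarrow> fourier_integral f a"
    unfolding fourier_integral_kernel
  proof (rule integral_dominated_convergence)
    show "integrable lebesgue (\<lambda>x. cmod (f x))" using f by simp
    show "AE x in lebesgue. (\<lambda>n. f x * fkernel x (X n)) \<longlonglongrightarrow> f x * fkernel x a"
      by (intro AE_I2 tendsto_mult tendsto_const tendsto_fkernel X)
  qed (measurable, auto simp: norm_mult)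
qed

lemma borel_measurable_fourier_integral:
  "integrable lebesgue f \<Longrightarrow> fourier_integral f \<in> borel_measurable borel"
  by (intro borel_measurable_continuous_onI continuous_fourier_integral)

section \<open>Translation, dilation and product formulas for Lebesgue integrals\<close>

lemma integral_lborel_translate:
  fixes f :: "'a::euclidean_space \<Rightarrow> 'b::{banach, second_countable_topology}"
  assumes [measurable]: "f \<in> borel_measurable borel"
  shows "(\<integral>x. f (x + t) \<partial>lborel) = integral\<^sup>L lborel f"
  using lebesgue_preserving_integral[OF lebesgue_preserving_translate measurable_lebesgueI[OF assms], of t]
  by (simp add: integral_lebesgue_lborel)

lemma integrable_lborel_translate:
  fixes f :: "'a::euclidean_space \<Rightarrow> 'b::{banach, second_countable_topology}"
  assumes [measurable]: "f \<in> borel_measurable borel" and "integrable lborel f"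
  shows "integrable lborel (\<lambda>x. f (x + t))"
  using lebesgue_preserving_integrable[OF lebesgue_preserving_translate, of f t] assms
  by (simp add: integrable_lebesgue_lborel)

lemma integral_lborel_scaleR:
  fixes f :: "'a::euclidean_space \<Rightarrow> 'b::{banach, second_countable_topology}"
  assumes [measurable]: "f \<in> borel_measurable borel" and c: "c > 0"
  shows "integral\<^sup>L lborel f = c ^ DIM('a) *\<^sub>R (\<integral>x. f (c *\<^sub>R x) \<partial>lborel)"
proof -
  have "integral\<^sup>L lborel f = integral\<^sup>L (density (distr lborel borel (\<lambda>x. 0 + c *\<^sub>R x)) (\<lambda>_. \<bar>c\<bar>^DIM('a))) f"
    using lborel_affine[of c "0::'a"] c by simp
  also have "\<dots> = c ^ DIM('a) *\<^sub>R (\<integral>x. f (c *\<^sub>R x) \<partial>lborel)"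
    using c by (subst integral_density) (auto simp: integral_distr)
  finally show ?thesis .
qed

lemma integrable_lborel_scaleR:
  fixes f :: "'a::euclidean_space \<Rightarrow> 'b::{banach, second_countable_topology}"
  assumes f: "integrable lborel f" and c: "c > 0"
  shows "integrable lborel (\<lambda>x. f (c *\<^sub>R x))"
proof -
  have [measurable]: "f \<in> borel_measurable borel" using f by auto
  have "integrable (density (distr lborel borel (\<lambda>x. 0 + c *\<^sub>R x)) (\<lambda>_. ennreal (\<bar>c\<bar>^DIM('a)))) f"
    using lborel_affine[of c "0::'a"] f c by simp
  then have "integrable lborel (\<lambda>x. c ^ DIM('a) *\<^sub>R f (c *\<^sub>R x))"
    using c by (subst (asm) integrable_density) (auto simp: integrable_distr_eq)
  from integrable_scaleR_right[OF this, of "inverse (c ^ DIM('a))"] c show ?thesis by simp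
qed

text \<open>\<open>lborel\<close> is the image of a product of one-dimensional Lebesgue measures
  under assembling a vector from its coordinates.\<close>

lemma integral_lborel_prod_Basis:
  fixes f :: "'a::euclidean_space \<Rightarrow> real \<Rightarrow> complex"
  assumes int: "\<And>b. b \<in> Basis \<Longrightarrow> integrable lborel (f b)"
  shows "integrable lborel (\<lambda>x. \<Prod>b\<in>Basis. f b (x \<bullet> b))"
    and "(\<integral>x. (\<Prod>b\<in>Basis. f b (x \<bullet> b)) \<partial>lborel) = (\<Prod>b\<in>Basis. integral\<^sup>L lborel (f b))"
proof -
  interpret product_sigma_finite "\<lambda>_::'a. lborel :: real measure" by standard
  have [measurable]: "f b \<in> borel_measurable borel" if "b \<in> Basis" for b
    using int[OF that] by (simp add: borel_measurable_integrable)
  have [measurable]: "(\<lambda>x. \<Prod>b\<in>Basis. f b (x \<bullet> b)) \<in> borel_measurable borel" by measurable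
  have [measurable]: "(\<lambda>g. \<Sum>b\<in>Basis. g b *\<^sub>R b) \<in> (\<Pi>\<^sub>M b\<in>Basis::'a set. lborel) \<rightarrow>\<^sub>M borel"
    by measurable
  have eq: "(\<Prod>b\<in>Basis. f b ((\<Sum>b\<in>Basis. g b *\<^sub>R b) \<bullet> b)) = (\<Prod>b\<in>Basis. f b (g b))" for g :: "'a \<Rightarrow> real"
    by (intro prod.cong refl) (simp add: inner_sum_left_Basis)
  show "integrable lborel (\<lambda>x. \<Prod>b\<in>Basis. f b (x \<bullet> b))"
    by (subst lborel_eq, subst integrable_distr_eq) (simp_all add: eq product_integrable_prod int)
  show "(\<integral>x. (\<Prod>b\<in>Basis. f b (x \<bullet> b)) \<partial>lborel) = (\<Prod>b\<in>Basis. integral\<^sup>L lborel (f b))"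
    by (subst lborel_eq, subst integral_distr) (simp_all add: eq product_integral_prod int)
qed

text \<open>The normalization with \<open>pi\<close> has total mass 1 and makes the Gaussian its own
  Fourier transform.\<close>

definition gaussian :: "'a::euclidean_space \<Rightarrow> real" where
  "gaussian x = exp (- pi * (norm x)\<^sup>2)"

lemma gaussian_bounds: "0 < gaussian x" "gaussian x \<le> 1"
  by (simp_all add: gaussian_def)

lemma borel_measurable_gaussian [measurable]: "gaussian \<in> borel_measurable borel"
  unfolding gaussian_def[abs_def] by measurable

text \<open>Up to rescaling, this is the characteristic function of the standard normal
  distribution.\<close>

lemma fourier_gaussian_real:
  fixes t :: real
  shows "integrable lborel (\<lambda>x. complex_of_real (gaussian x) * fkernel x t)"
    and "(\<integral>x. complex_of_real (gaussian x) * fkernel x t \<partial>lborel) = of_real (gaussian t)"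
proof -
  \<comment> \<open>The substitution y = \<open>?c * x\<close> turns exp (- pi x^2) into
    \<open>?c\<close> times the standard normal density at y. The frequency becomes
    \<open>- ?c * t\<close> since characteristic functions carry the opposite sign in the
    exponent.\<close>
  let ?c = "sqrt (2 * pi)"
  let ?g = "\<lambda>x::real. of_real (std_normal_density x) * exp (\<i> * of_real (- ?c * t * x))"
  have c: "?c > 0" "?c\<^sup>2 = 2 * pi" "?c * ?c = 2 * pi" using pi_gt_zero by (auto simp: less_imp_le)
  have eq: "of_real (gaussian x) * fkernel x t = of_real ?c * ?g (?c * x)" for x :: real
  proof -
    have "std_normal_density (?c * x) = gaussian x / ?c"
      unfolding std_normal_density_def gaussian_def by (simp add: power_mult_distrib c(2))
    moreover have "exp (\<i> * of_real (- ?c * t * (?c * x))) = fkernel x t"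
    proof -
      have e: "- ?c * t * (?c * x) = - 2 * pi * (x * t)" using c(3) by (simp add: algebra_simps)
      show ?thesis unfolding e fkernel_def by (simp add: mult_ac)
    qed
    ultimately show ?thesis using c(1) by simp
  qed
  have int: "integrable lborel ?g"
  proof (rule Bochner_Integration.integrable_bound)
    show "integrable lborel std_normal_density" using integrable_std_normal_moment[of 0] by simp
  qed (measurable, auto simp: norm_mult)
  from lborel_integrable_real_affine[OF int, of ?c 0] c(1)
  show "integrable lborel (\<lambda>x. complex_of_real (gaussian x) * fkernel x t)"
    unfolding eq by (intro integrable_mult_right) (simp add: mult_ac)
  have "(\<integral>x. of_real (gaussian x) * fkernel x t \<partial>lborel) = ?c *\<^sub>R (\<integral>x. ?g (0 + ?c * x) \<partial>lborel)"
    unfolding eq by (simp add: scaleR_conv_of_real)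
  also have "\<dots> = integral\<^sup>L lborel ?g"
    using lborel_integral_real_affine[of ?c ?g 0] c(1) by simp
  also have "\<dots> = char std_normal_distribution (- ?c * t)"
    unfolding char_def by (subst integral_density) (auto simp: scaleR_conv_of_real mult_ac)
  also have "\<dots> = of_real (gaussian t)"
    unfolding char_std_normal_distribution by (simp add: gaussian_def power_mult_distrib c(2))
  finally show "(\<integral>x. complex_of_real (gaussian x) * fkernel x t \<partial>lborel) = of_real (gaussian t)" .
qed

lemma gaussian_prod: "gaussian x = (\<Prod>b\<in>Basis. gaussian (x \<bullet> b))"
proof -
  have "(norm x)\<^sup>2 = (\<Sum>b\<in>Basis. (x \<bullet> b)\<^sup>2)"
    unfolding power2_norm_eq_inner by (subst euclidean_inner) (simp add: power2_eq_square)
  then show ?thesis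
    by (simp add: gaussian_def sum_distrib_left sum_negf flip: exp_sum)
qed

lemma fkernel_prod: "fkernel x \<xi> = (\<Prod>b\<in>Basis. fkernel (x \<bullet> b) (\<xi> \<bullet> b))"
  unfolding fkernel_def euclidean_inner[of x \<xi>]
  by (simp add: sum_distrib_left flip: exp_sum)

text \<open>The Gaussian and the character both factor over an orthonormal basis, which reduces the
  claim to dimension one.\<close>

lemma fourier_gaussian:
  fixes \<xi> :: "'a::euclidean_space"
  shows "integrable lborel (\<lambda>x::'a. complex_of_real (gaussian x) * fkernel x \<xi>)"
    and "(\<integral>x. complex_of_real (gaussian x) * fkernel x \<xi> \<partial>lborel) = of_real (gaussian \<xi>)"
proof -
  have eq: "of_real (gaussian x) * fkernel x \<xi>
      = (\<Prod>b\<in>Basis. of_real (gaussian (x \<bullet> b)) * fkernel (x \<bullet> b) (\<xi> \<bullet> b))" for x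
    by (subst gaussian_prod, subst fkernel_prod) (simp add: prod.distrib)
  show "integrable lborel (\<lambda>x::'a. complex_of_real (gaussian x) * fkernel x \<xi>)"
    unfolding eq by (rule integral_lborel_prod_Basis(1)[OF fourier_gaussian_real(1)])
  show "(\<integral>x. complex_of_real (gaussian x) * fkernel x \<xi> \<partial>lborel) = of_real (gaussian \<xi>)"
    unfolding eq
    by (subst integral_lborel_prod_Basis(2)[OF fourier_gaussian_real(1)], subst (2) gaussian_prod)
      (simp add: fourier_gaussian_real(2))
qed

lemma integrable_gaussian: "integrable lborel (gaussian :: 'a::euclidean_space \<Rightarrow> real)"
  using integrable_norm[OF fourier_gaussian(1)[of "0::'a"]]
  by (simp add: norm_mult gaussian_bounds less_imp_le)

lemma integral_gaussian: "(\<integral>x. gaussian x \<partial>(lborel :: 'a::euclidean_space measure)) = 1"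
proof -
  have "complex_of_real (\<integral>x. gaussian (x::'a) \<partial>lborel) = 1"
    using fourier_gaussian(2)[of "0::'a"] by (simp add: fkernel_def gaussian_def)
  then show ?thesis by simp
qed

lemma integrable_lborel_product:
  fixes f g :: "'a::euclidean_space \<Rightarrow> complex"
  assumes f: "integrable lborel f" and g: "integrable lborel g"
    and k[measurable]: "k \<in> borel_measurable (lborel \<Otimes>\<^sub>M lborel)" and b: "\<And>z. cmod (k z) \<le> 1"
  shows "integrable (lborel \<Otimes>\<^sub>M lborel) (\<lambda>(x, y). f x * g y * k (x, y))"
proof (rule Bochner_Integration.integrable_bound)
  have [measurable]: "f \<in> borel_measurable borel" "g \<in> borel_measurable borel" using f g by auto
  show "integrable (lborel \<Otimes>\<^sub>M lborel) (\<lambda>z. f (fst z) * g (snd z))"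
  proof (rule lborel_pair.Fubini_integrable)
    show "integrable lborel (\<lambda>x. \<integral>y. norm (f (fst (x, y)) * g (snd (x, y))) \<partial>lborel)"
      using f by (simp add: norm_mult)
    show "AE x in lborel. integrable lborel (\<lambda>y. f (fst (x, y)) * g (snd (x, y)))"
      using g by simp
  qed measurable
  show "(\<lambda>(x, y). f x * g y * k (x, y)) \<in> borel_measurable (lborel \<Otimes>\<^sub>M lborel)" by measurable
  show "AE z in lborel \<Otimes>\<^sub>M lborel. norm (case z of (x, y) \<Rightarrow> f x * g y * k (x, y)) \<le> norm (f (fst z) * g (snd z))"
    using b by (auto simp: norm_mult split_beta intro!: mult_left_le)
qed

lemma integrable_lebesgue_ex_borel:
  fixes f :: "'a::euclidean_space \<Rightarrow> complex"
  assumes "integrable lebesgue f"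
  obtains f' where "integrable lborel f'" "AE x in lebesgue. f x = f' x"
proof -
  obtain f' where f': "f' \<in> borel_measurable borel" "AE x in lebesgue. f x = f' x"
    using lebesgue_ex_borel borel_measurable_integrable[OF assms] by blast
  have "integrable lebesgue f'"
    by (rule integrable_cong_AE_imp[OF assms measurable_lebesgueI[OF f'(1)]]) (use f' in auto)
  with f' show thesis by (intro that) (auto simp: integrable_lebesgue_lborel)
qed

lemma fourier_integral_lborel:
  assumes [measurable]: "f \<in> borel_measurable borel"
  shows "fourier_integral f \<xi> = (\<integral>x. f x * fkernel x \<xi> \<partial>lborel)"
  unfolding fourier_integral_kernel by (rule integral_lebesgue_lborel) measurable

text \<open>Both sides are iterated integrals of f(x) g(y) against the symmetric kernel, so Fubini
  identifies them; passing to Borel representatives changes neither side.\<close>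

lemma fourier_integral_mult_swap:
  fixes f g :: "'a::euclidean_space \<Rightarrow> complex"
  assumes f: "integrable lebesgue f" and g: "integrable lebesgue g"
  shows "(\<integral>x. fourier_integral f x * g x \<partial>lebesgue) = (\<integral>x. f x * fourier_integral g x \<partial>lebesgue)"
proof -
  obtain f' where f': "integrable lborel f'" "AE x in lebesgue. f x = f' x"
    by (rule integrable_lebesgue_ex_borel[OF f])
  obtain g' where g': "integrable lborel g'" "AE x in lebesgue. g x = g' x"
    by (rule integrable_lebesgue_ex_borel[OF g])
  have m[measurable]: "f' \<in> borel_measurable borel" "g' \<in> borel_measurable borel"
    "f \<in> borel_measurable lebesgue" "g \<in> borel_measurable lebesgue" using f' g' f g by auto
  have ml[measurable]: "f' \<in> borel_measurable lebesgue" "g' \<in> borel_measurable lebesgue"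
    using m by (auto intro: measurable_lebesgueI)
  have F: "fourier_integral f = fourier_integral f'" and G: "fourier_integral g = fourier_integral g'"
    using f' g' by (auto intro!: fourier_integral_cong_AE m)
  have i': "integrable lebesgue f'" "integrable lebesgue g'"
    using f' g' by (auto simp: integrable_lebesgue_lborel)
  note Fm[measurable] = i'[THEN borel_measurable_fourier_integral]
  have Fl[measurable]: "fourier_integral f' \<in> borel_measurable lebesgue" "fourier_integral g' \<in> borel_measurable lebesgue"
    using Fm by (auto intro: measurable_lebesgueI)
  have int: "integrable (lborel \<Otimes>\<^sub>M lborel) (\<lambda>(x, y). f' x * g' y * fkernel x y)"
    using integrable_lborel_product[OF f'(1) g'(1), of "\<lambda>(x, y). fkernel x y"] by (simp add: split_beta)
  have "(\<integral>y. fourier_integral f y * g y \<partial>lebesgue) = (\<integral>y. fourier_integral f' y * g' y \<partial>lebesgue)"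
    unfolding F
  proof (rule integral_cong_AE)
    show "AE y in lebesgue. fourier_integral f' y * g y = fourier_integral f' y * g' y"
      using g'(2) by eventually_elim simp
  qed measurable
  also have "\<dots> = (\<integral>y. fourier_integral f' y * g' y \<partial>lborel)"
    by (rule integral_lebesgue_lborel) measurable
  also have "\<dots> = (\<integral>y. (\<integral>x. f' x * g' y * fkernel x y \<partial>lborel) \<partial>lborel)"
    by (simp add: fourier_integral_lborel mult.commute mult.left_commute
        flip: integral_mult_right_zero)
  also have "\<dots> = (\<integral>x. (\<integral>y. f' x * g' y * fkernel x y \<partial>lborel) \<partial>lborel)"
    by (rule lborel_pair.Fubini_integral[OF int])
  also have "\<dots> = (\<integral>x. f' x * fourier_integral g' x \<partial>lborel)"
    by (simp add: fourier_integral_lborel fkernel_commute mult.assoc)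
  also have "\<dots> = (\<integral>x. f' x * fourier_integral g' x \<partial>lebesgue)"
    by (rule integral_lebesgue_lborel[symmetric]) measurable
  also have "\<dots> = (\<integral>x. f x * fourier_integral g x \<partial>lebesgue)"
    unfolding G
  proof (rule integral_cong_AE)
    show "AE x in lebesgue. f' x * fourier_integral g' x = f x * fourier_integral g' x"
      using f'(2) by eventually_elim simp
  qed measurable
  finally show ?thesis .
qed

section \<open>The Fourier transform on \<open>L\<^sup>2\<close>\<close>

lemma fourier_gaussian_scaleR:
  fixes t :: "'a::euclidean_space"
  assumes c: "c > 0"
  shows "fourier_integral (\<lambda>x. complex_of_real (gaussian (x /\<^sub>R c))) t = of_real (c ^ DIM('a) * gaussian (c *\<^sub>R t))"
proof -
  have "fourier_integral (\<lambda>x. complex_of_real (gaussian (x /\<^sub>R c))) t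
      = (\<integral>x. complex_of_real (gaussian (x /\<^sub>R c)) * fkernel x t \<partial>lborel)"
    by (rule fourier_integral_lborel) measurable
  also have "\<dots> = c ^ DIM('a) *\<^sub>R (\<integral>x. complex_of_real (gaussian x) * fkernel x (c *\<^sub>R t) \<partial>lborel)"
    using c by (subst integral_lborel_scaleR[OF _ c]) (auto simp: fkernel_scaleR)
  finally show ?thesis by (simp add: fourier_gaussian scaleR_conv_of_real)
qed

text \<open>\<open>|f^|\<^sup>2\<close> is the Fourier transform of the autocorrelation \<open>h\<close> of \<open>f\<close>, so its integral against a
  Gaussian of width \<open>c\<close> is an average of \<open>h\<close> concentrating at \<open>0\<close>, where \<open>h\<close> equals \<open>\<parallel>f\<parallel>\<^sup>2\<close>.\<close>

lemma plancherel_borel: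
  fixes f :: "'a::euclidean_space \<Rightarrow> complex"
  assumes f1: "integrable lborel f" and f2: "f \<in> L2_fun"
  shows "fourier_integral f \<in> L2_fun" and "L2_nrm (fourier_integral f) = L2_nrm f"
proof -
  have [measurable]: "f \<in> borel_measurable borel" using f1 by auto
  have f1': "integrable lebesgue f" using f1 by (simp add: integrable_lebesgue_lborel)
  note Fm[measurable] = borel_measurable_fourier_integral[OF f1']
  define N where "N = L2_nrm f"
  define h where "h t = (\<integral>x. cnj (f x) * f (x + t) \<partial>lborel)" for t
  have hm[measurable]: "h \<in> borel_measurable borel" unfolding h_def[abs_def] by measurable
  note tr = lebesgue_preserving_L2[OF lebesgue_preserving_translate f2]
  have h_ip: "h t = L2_ip f (\<lambda>x. f (x + t))" for t
    unfolding h_def L2_ip_def by (rule integral_lebesgue_lborel[symmetric]) measurable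
  have h_bound: "cmod (h t) \<le> N\<^sup>2" for t
    using L2_ip_Cauchy_Schwarz[OF f2 tr, of t] lebesgue_preserving_L2_nrm[OF lebesgue_preserving_translate f2, of t]
    by (simp add: h_ip N_def power2_eq_square)
  have h_lim: "(\<lambda>k. h (t k)) \<longlonglongrightarrow> of_real (N\<^sup>2)" if "t \<longlonglongrightarrow> 0" for t
    using L2_tendsto_ip[OF L2_tendsto_const[OF f2] L2_translate_tendsto[OF f2 that]]
    by (simp add: h_ip L2_ip_self N_def)
  \<comment> \<open>By translation invariance the inner integral of the modulus is |f(x)| times the
    L^1 norm of \<open>f\<close>, which is integrable in x.\<close>
  have pair: "integrable (lborel \<Otimes>\<^sub>M lborel) (\<lambda>(x, t). cnj (f x) * f (x + t))"
  proof (rule lborel_pair.Fubini_integrable)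
    have "(\<integral>t. cmod (f (x + t)) \<partial>lborel) = (\<integral>t. cmod (f t) \<partial>lborel)" for x
      using integral_lborel_translate[of "\<lambda>t. cmod (f t)" x] by (simp add: add.commute)
    then show "integrable lborel (\<lambda>x. \<integral>t. norm (case (x, t) of (x, t) \<Rightarrow> cnj (f x) * f (x + t)) \<partial>lborel)"
      using f1 by (simp add: norm_mult)
    have "integrable lborel (\<lambda>t. f (x + t))" for x
      using integrable_lborel_translate[OF _ f1, of x] by (simp add: add.commute)
    then show "AE x in lborel. integrable lborel (\<lambda>t. case (x, t) of (x, t) \<Rightarrow> cnj (f x) * f (x + t))"
      by simp
  qed measurable
  have h1: "integrable lborel h"
    using lborel_pair.integrable_snd[OF pair] by (simp add: h_def[abs_def])
  have h1': "integrable lebesgue h" using h1 by (simp add: integrable_lebesgue_lborel)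
  have Fh: "fourier_integral h \<xi> = of_real ((cmod (fourier_integral f \<xi>))\<^sup>2)" for \<xi>
  proof -
    have pk: "integrable (lborel \<Otimes>\<^sub>M lborel) (\<lambda>(x, t). cnj (f x) * f (x + t) * fkernel t \<xi>)"
      by (rule Bochner_Integration.integrable_bound[OF pair]) (measurable, auto simp: norm_mult)
    have "fourier_integral h \<xi> = (\<integral>t. h t * fkernel t \<xi> \<partial>lborel)"
      by (rule fourier_integral_lborel) measurable
    also have "\<dots> = (\<integral>t. (\<integral>x. cnj (f x) * f (x + t) * fkernel t \<xi> \<partial>lborel) \<partial>lborel)"
      by (simp add: h_def)
    also have "\<dots> = (\<integral>x. (\<integral>t. cnj (f x) * f (x + t) * fkernel t \<xi> \<partial>lborel) \<partial>lborel)"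
      by (rule lborel_pair.Fubini_integral[OF pk])
    also have "\<dots> = (\<integral>x. cnj (f x * fkernel x \<xi>) * fourier_integral f \<xi> \<partial>lborel)"
    proof (rule Bochner_Integration.integral_cong[OF refl])
      fix x
      \<comment> \<open>Splitting the character at t = (t + x) - x separates the variables after a
        translation, and the two integrals become conjugates of each other.\<close>
      have "cnj (f x) * f (x + t) * fkernel t \<xi>
          = cnj (f x * fkernel x \<xi>) * (f (t + x) * fkernel (t + x) \<xi>)" for t
      proof -
        have "fkernel t \<xi> = fkernel (t + x) \<xi> * cnj (fkernel x \<xi>)"
          by (simp add: fkernel_add mult.assoc)
        then show ?thesis by (simp add: add.commute mult_ac)
      qed
      then have "(\<integral>t. cnj (f x) * f (x + t) * fkernel t \<xi> \<partial>lborel)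
          = cnj (f x * fkernel x \<xi>) * (\<integral>t. f (t + x) * fkernel (t + x) \<xi> \<partial>lborel)"
        by (simp only: integral_mult_right_zero)
      also have "(\<integral>t. f (t + x) * fkernel (t + x) \<xi> \<partial>lborel) = fourier_integral f \<xi>"
        using integral_lborel_translate[of "\<lambda>t. f t * fkernel t \<xi>" x]
        by (simp add: fourier_integral_lborel)
      finally show "(\<integral>t. cnj (f x) * f (x + t) * fkernel t \<xi> \<partial>lborel)
          = cnj (f x * fkernel x \<xi>) * fourier_integral f \<xi>" .
    qed
    also have "\<dots> = cnj (\<integral>x. f x * fkernel x \<xi> \<partial>lborel) * fourier_integral f \<xi>"
      by (simp only: integral_mult_left_zero Bochner_Integration.integral_cnj)
    also have "\<dots> = of_real ((cmod (fourier_integral f \<xi>))\<^sup>2)"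
      unfolding complex_norm_square by (simp add: fourier_integral_lborel mult.commute)
    finally show ?thesis .
  qed
  \<comment> \<open>The widths grow without bound, so the Gaussians \<open>G j\<close> increase
    pointwise to 1; \<open>Suc\<close> keeps the first width positive.\<close>
  define c where "c j = real (Suc j)" for j
  have c: "c j > 0" for j by (simp add: c_def)
  define G where "G j \<xi> = gaussian (\<xi> /\<^sub>R c j)" for j and \<xi> :: 'a
  have [measurable]: "G j \<in> borel_measurable borel" for j unfolding G_def[abs_def] by measurable
  have Gi: "integrable lborel (G j)" for j
    using integrable_lborel_scaleR[OF integrable_gaussian, of "inverse (c j)"] c[of j] by (simp add: G_def[abs_def])
  have Gb: "0 < G j \<xi>" "G j \<xi> \<le> 1" for j \<xi> by (auto simp: G_def gaussian_bounds)
  let ?u = "\<lambda>\<xi>. (cmod (fourier_integral f \<xi>))\<^sup>2"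
  have int: "integrable lborel (\<lambda>\<xi>. ?u \<xi> * G j \<xi>)" for j
  proof (rule Bochner_Integration.integrable_bound)
    show "integrable lborel (\<lambda>\<xi>. (\<integral>x. cmod (f x) \<partial>lebesgue)\<^sup>2 * G j \<xi>)" using Gi by simp
    show "AE \<xi> in lborel. norm (?u \<xi> * G j \<xi>) \<le> norm ((\<integral>x. cmod (f x) \<partial>lebesgue)\<^sup>2 * G j \<xi>)"
      using fourier_integral_bound[of f] by (auto simp: abs_mult intro!: mult_right_mono power_mono)
  qed measurable
  \<comment> \<open>The swap formula moves the transform onto the Gaussian, and the substitution u =
    \<open>c j\<close> t turns a wide Gaussian in frequency into an average of \<open>h\<close> near
    the origin.\<close>
  have val: "complex_of_real (\<integral>\<xi>. ?u \<xi> * G j \<xi> \<partial>lborel) = (\<integral>u. h (u /\<^sub>R c j) * of_real (gaussian u) \<partial>lborel)" for j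
  proof -
    have Gi': "integrable lebesgue (\<lambda>x. complex_of_real (G j x))"
      using Gi by (subst integrable_lebesgue_lborel) auto
    have "complex_of_real (\<integral>\<xi>. ?u \<xi> * G j \<xi> \<partial>lborel) = (\<integral>\<xi>. of_real (?u \<xi> * G j \<xi>) \<partial>lborel)"
      by (rule integral_complex_of_real[symmetric])
    also have "\<dots> = (\<integral>\<xi>. fourier_integral h \<xi> * of_real (G j \<xi>) \<partial>lborel)"
      by (simp add: Fh)
    also have "\<dots> = (\<integral>\<xi>. fourier_integral h \<xi> * of_real (G j \<xi>) \<partial>lebesgue)"
      unfolding Fh by (rule integral_lebesgue_lborel[symmetric]) measurable
    also have "\<dots> = (\<integral>t. h t * fourier_integral (\<lambda>x. of_real (G j x)) t \<partial>lebesgue)"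
      by (rule fourier_integral_mult_swap[OF h1' Gi'])
    also have "\<dots> = (\<integral>t. h t * of_real (c j ^ DIM('a) * gaussian (c j *\<^sub>R t)) \<partial>lebesgue)"
      unfolding G_def by (simp only: fourier_gaussian_scaleR[OF c])
    also have "\<dots> = (\<integral>t. h t * of_real (c j ^ DIM('a) * gaussian (c j *\<^sub>R t)) \<partial>lborel)"
      by (rule integral_lebesgue_lborel) measurable
    also have "\<dots> = c j ^ DIM('a) *\<^sub>R (\<integral>t. h t * of_real (gaussian (c j *\<^sub>R t)) \<partial>lborel)"
      unfolding scaleR_conv_of_real integral_mult_right_zero[symmetric]
      by (intro Bochner_Integration.integral_cong) simp_all
    also have "\<dots> = (\<integral>u. h (u /\<^sub>R c j) * of_real (gaussian u) \<partial>lborel)"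
      using c[of j] by (subst integral_lborel_scaleR[OF _ c[of j]]) auto
    finally show ?thesis .
  qed
  have "(\<lambda>j. \<integral>u. h (u /\<^sub>R c j) * of_real (gaussian u) \<partial>lborel)
      \<longlonglongrightarrow> (\<integral>u. of_real (N\<^sup>2) * of_real (gaussian (u::'a)) \<partial>lborel)"
  proof (rule integral_dominated_convergence)
    show "integrable lborel (\<lambda>u::'a. N\<^sup>2 * gaussian u)"
      by (intro integrable_mult_right integrable_gaussian)
    have ci: "(\<lambda>j. inverse (c j)) \<longlonglongrightarrow> 0"
      unfolding c_def by (rule LIMSEQ_inverse_real_of_nat)
    show "AE u in lborel. (\<lambda>j. h (u /\<^sub>R c j) * of_real (gaussian u)) \<longlonglongrightarrow> of_real (N\<^sup>2) * of_real (gaussian u)"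
    proof (rule AE_I2)
      fix u :: 'a
      have "(\<lambda>j. u /\<^sub>R c j) \<longlonglongrightarrow> 0" using tendsto_scaleR[OF ci tendsto_const[of u]] by simp
      then show "(\<lambda>j. h (u /\<^sub>R c j) * of_real (gaussian u)) \<longlonglongrightarrow> of_real (N\<^sup>2) * of_real (gaussian u)"
        by (intro tendsto_mult tendsto_const h_lim)
    qed
    show "AE u in lborel. norm (h (u /\<^sub>R c j) * of_real (gaussian u)) \<le> N\<^sup>2 * gaussian u" for j
      using h_bound
      by (auto simp: norm_mult abs_of_pos[OF gaussian_bounds(1)] less_imp_le[OF gaussian_bounds(1)] intro!: mult_right_mono)
  qed measurable
  also have "(\<integral>u. of_real (N\<^sup>2) * of_real (gaussian (u::'a)) \<partial>lborel) = complex_of_real (N\<^sup>2)"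
    by (simp add: integral_gaussian del: of_real_power)
  finally have "(\<lambda>j. complex_of_real (\<integral>\<xi>. ?u \<xi> * G j \<xi> \<partial>lborel)) \<longlonglongrightarrow> of_real (N\<^sup>2)"
    unfolding val .
  then have lim: "(\<lambda>j. \<integral>\<xi>. ?u \<xi> * G j \<xi> \<partial>lborel) \<longlonglongrightarrow> N\<^sup>2" by (simp only: tendsto_of_real_iff)
  \<comment> \<open>Integrability of \<open>?u\<close> is not known yet: monotone convergence
    delivers it together with the value of the integral.\<close>
  have "has_bochner_integral lborel ?u (N\<^sup>2)"
  proof (rule has_bochner_integral_monotone_convergence[OF int _ _ lim])
    show "AE \<xi> in lborel. mono (\<lambda>j. ?u \<xi> * G j \<xi>)"
    proof (intro AE_I2 monoI mult_left_mono)
      fix \<xi> :: 'a and i j :: nat assume "i \<le> j"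
      then have "norm (\<xi> /\<^sub>R c j) \<le> norm (\<xi> /\<^sub>R c i)"
        by (auto simp: c_def intro!: mult_right_mono le_imp_inverse_le)
      then show "G i \<xi> \<le> G j \<xi>"
        unfolding G_def gaussian_def by (auto intro!: mult_left_mono power_mono)
    qed simp
    show "AE \<xi> in lborel. (\<lambda>j. ?u \<xi> * G j \<xi>) \<longlonglongrightarrow> ?u \<xi>"
    proof (rule AE_I2)
      fix \<xi> :: 'a
      have "(\<lambda>j. inverse (c j)) \<longlonglongrightarrow> 0" unfolding c_def by (rule LIMSEQ_inverse_real_of_nat)
      then have "(\<lambda>j. G j \<xi>) \<longlonglongrightarrow> exp (- pi * (norm (0 *\<^sub>R \<xi>))\<^sup>2)"
        unfolding G_def gaussian_def by (intro tendsto_intros)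
      then have "(\<lambda>j. ?u \<xi> * G j \<xi>) \<longlonglongrightarrow> ?u \<xi> * exp (- pi * (norm (0 *\<^sub>R \<xi>))\<^sup>2)"
        by (rule tendsto_mult[OF tendsto_const])
      then show "(\<lambda>j. ?u \<xi> * G j \<xi>) \<longlonglongrightarrow> ?u \<xi>" by simp
    qed
  qed measurable
  then have u: "integrable lborel ?u" "integral\<^sup>L lborel ?u = N\<^sup>2"
    by (auto simp: has_bochner_integral_iff)
  show "fourier_integral f \<in> L2_fun"
    by (rule L2_funI) (use u Fm in \<open>auto simp: integrable_lebesgue_lborel intro: measurable_lebesgueI\<close>)
  have "(L2_nrm (fourier_integral f))\<^sup>2 = N\<^sup>2"
    unfolding L2_nrm_square using u(2) by (subst integral_lebesgue_lborel) auto
  then show "L2_nrm (fourier_integral f) = L2_nrm f" by (simp add: N_def)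
qed

lemma plancherel_L1_L2:
  fixes f :: "'a::euclidean_space \<Rightarrow> complex"
  assumes f1: "integrable lebesgue f" and f2: "f \<in> L2_fun"
  shows "fourier_integral f \<in> L2_fun" and "L2_nrm (fourier_integral f) = L2_nrm f"
proof -
  obtain f' where f': "integrable lborel f'" "AE x in lebesgue. f x = f' x"
    by (rule integrable_lebesgue_ex_borel[OF f1])
  have F: "fourier_integral f = fourier_integral f'"
    using f1 f'(2) by (intro fourier_integral_cong_AE) auto
  note p = plancherel_borel[OF f'(1) L2_fun_cong_AE[OF f2 f'(2)]]
  show "fourier_integral f \<in> L2_fun" "L2_nrm (fourier_integral f) = L2_nrm f"
    using p L2_nrm_cong_AE[OF f2 f'(2)] by (simp_all add: F)
qed

section \<open>The extension to L^2 as a relation: isometry, uniqueness, existence\<close>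

lemma is_fourierE:
  assumes "is_fourier f g"
  obtains F where "\<And>k. integrable lebesgue (F k)" "\<And>k. F k \<in> L2_fun" "L2_tendsto F f"
    "L2_tendsto (\<lambda>k. fourier_integral (F k)) g"
  using assms by (auto simp: is_fourier_def L2_tendsto_def)

lemma is_fourierI:
  "(\<And>k. integrable lebesgue (F k)) \<Longrightarrow> L2_tendsto F f \<Longrightarrow> L2_tendsto (\<lambda>k. fourier_integral (F k)) g
    \<Longrightarrow> is_fourier f g"
  by (auto simp: is_fourier_def)

lemma is_fourier_L2: "is_fourier f g \<Longrightarrow> f \<in> L2_fun" "is_fourier f g \<Longrightarrow> g \<in> L2_fun"
  by (auto simp: is_fourier_def L2_tendsto_def)

lemma is_fourier_nrm:
  assumes "is_fourier f g" shows "L2_nrm g = L2_nrm f"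
proof -
  obtain F where F: "\<And>k. integrable lebesgue (F k)" "\<And>k. F k \<in> L2_fun" "L2_tendsto F f"
    "L2_tendsto (\<lambda>k. fourier_integral (F k)) g" using is_fourierE[OF assms] by metis
  have "(\<lambda>k. L2_nrm (F k)) \<longlonglongrightarrow> L2_nrm g"
    using L2_tendsto_nrm[OF F(4)] plancherel_L1_L2(2)[OF F(1,2)] by simp
  with L2_tendsto_nrm[OF F(3)] show ?thesis by (rule LIMSEQ_unique[rotated])
qed

lemma is_fourier_add:
  assumes "is_fourier f g" "is_fourier f' g'"
  shows "is_fourier (\<lambda>x. f x + f' x) (\<lambda>x. g x + g' x)"
proof -
  obtain F where F: "\<And>k. integrable lebesgue (F k)" "L2_tendsto F f"
    "L2_tendsto (\<lambda>k. fourier_integral (F k)) g" using is_fourierE[OF assms(1)] by metis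
  obtain F' where F': "\<And>k. integrable lebesgue (F' k)" "L2_tendsto F' f'"
    "L2_tendsto (\<lambda>k. fourier_integral (F' k)) g'" using is_fourierE[OF assms(2)] by metis
  have eq: "fourier_integral (\<lambda>x. F k x + F' k x) = (\<lambda>\<xi>. fourier_integral (F k) \<xi> + fourier_integral (F' k) \<xi>)" for k
    using fourier_integral_add[OF F(1) F'(1)] by auto
  show ?thesis
    by (rule is_fourierI[of "\<lambda>k x. F k x + F' k x"])
      (use F F' in \<open>auto simp: eq intro: L2_tendsto_add\<close>)
qed

lemma is_fourier_cmult:
  assumes "is_fourier f g"
  shows "is_fourier (\<lambda>x. c * f x) (\<lambda>x. c * g x)"
proof -
  obtain F where F: "\<And>k. integrable lebesgue (F k)" "L2_tendsto F f"
    "L2_tendsto (\<lambda>k. fourier_integral (F k)) g" using is_fourierE[OF assms(1)] by metis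
  have eq: "fourier_integral (\<lambda>x. c * F k x) = (\<lambda>\<xi>. c * fourier_integral (F k) \<xi>)" for k
    using fourier_integral_cmult by auto
  show ?thesis
    by (rule is_fourierI[of "\<lambda>k x. c * F k x"]) (use F in \<open>auto simp: eq intro: L2_tendsto_cmult\<close>)
qed

text \<open>The difference of two transforms of \<open>f\<close> is a transform of the zero
  function, and the isometry gives it norm zero.\<close>

lemma is_fourier_unique:
  assumes "is_fourier f g" "is_fourier f g'"
  shows "AE x in lebesgue. g x = g' x"
proof (rule L2_nrm_diff_eq_0)
  show "g \<in> L2_fun" "g' \<in> L2_fun" using assms by (auto dest: is_fourier_L2)
  have "is_fourier (\<lambda>x. f x + (-1) * f x) (\<lambda>x. g x + (-1) * g' x)"
    by (intro is_fourier_add is_fourier_cmult assms)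
  from is_fourier_nrm[OF this] show "L2_nrm (\<lambda>x. g x - g' x) = 0" by (simp add: L2_nrm_def)
qed

lemma is_fourier_cong_AE:
  assumes "is_fourier f g" "AE x in lebesgue. f x = f' x" "AE x in lebesgue. g x = g' x"
  shows "is_fourier f' g'"
proof -
  obtain F where F: "\<And>k. integrable lebesgue (F k)" "L2_tendsto F f"
    "L2_tendsto (\<lambda>k. fourier_integral (F k)) g" using is_fourierE[OF assms(1)] by metis
  show ?thesis
    by (rule is_fourierI[OF F(1) L2_tendsto_cong_AE[OF F(2) assms(2)] L2_tendsto_cong_AE[OF F(3) assms(3)]])
qed

lemma is_fourier_fourier_integral:
  "integrable lebesgue f \<Longrightarrow> f \<in> L2_fun \<Longrightarrow> is_fourier f (fourier_integral f)"
  by (rule is_fourierI[of "\<lambda>_. f"]) (auto intro!: L2_tendsto_const plancherel_L1_L2)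

text \<open>On a ball of finite measure an L^2 function is integrable, so cutting off outside balls
  yields approximants in the intersection of L^1 and L^2.\<close>

lemma L2_truncation:
  fixes f :: "'a::euclidean_space \<Rightarrow> complex"
  assumes f: "f \<in> L2_fun"
  shows "integrable lebesgue (\<lambda>x. of_real (indicator (ball 0 (real k)) x) * f x)"
    and "L2_tendsto (\<lambda>k x. of_real (indicator (ball 0 (real k)) x) * f x) f"
proof -
  have [measurable]: "f \<in> borel_measurable lebesgue" by (rule L2_fun_measurable[OF f])
  have ball: "(\<lambda>x::'a. complex_of_real (indicator (ball 0 (real k)) x)) \<in> L2_fun" for k
    using emeasure_lborel_ball_finite[of "0::'a" "real k"] by (intro L2_fun_indicator) auto
  then show "integrable lebesgue (\<lambda>x. of_real (indicator (ball 0 (real k)) x) * f x)"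
    by (rule L2_mult_integrable[OF _ f])
  have [measurable]: "(\<lambda>x::'a. complex_of_real (indicator (ball 0 (real k)) x)) \<in> borel_measurable lebesgue" for k
    by (rule L2_fun_measurable[OF ball])
  show "L2_tendsto (\<lambda>k x. of_real (indicator (ball 0 (real k)) x) * f x) f"
  proof (rule L2_tendsto_dominated[OF _ _ f])
    show "AE x in lebesgue. cmod (of_real (indicator (ball 0 (real k)) x) * f x) \<le> 1 * cmod (f x)" for k
      by (auto simp: norm_mult indicator_def)
    show "AE x in lebesgue. (\<lambda>k. of_real (indicator (ball 0 (real k)) x) * f x) \<longlonglongrightarrow> f x"
    proof (rule AE_I2)
      fix x :: 'a
      obtain K where K: "norm x < real K" using reals_Archimedean2 by blast
      have "\<forall>\<^sub>F k in sequentially. of_real (indicator (ball 0 (real k)) x) * f x = f x"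
        by (rule eventually_sequentiallyI[of K]) (use K in \<open>auto simp: indicator_def\<close>)
      then show "(\<lambda>k. of_real (indicator (ball 0 (real k)) x) * f x) \<longlonglongrightarrow> f x"
        by (rule tendsto_eventually)
    qed
  qed measurable
qed

text \<open>By Plancherel the transforms of L^2 approximants form a Cauchy sequence; completeness
  supplies their limit.\<close>

lemma is_fourier_exists:
  assumes f: "f \<in> L2_fun" shows "\<exists>g. is_fourier f g"
proof -
  define F where "F k x = of_real (indicator (ball 0 (real k)) x) * f x" for k and x :: 'a
  have F: "\<And>k. integrable lebesgue (F k)" "L2_tendsto F f"
    using L2_truncation[OF f] by (simp_all add: F_def[abs_def])
  have F2: "\<And>k. F k \<in> L2_fun" and lim: "(\<lambda>k. L2_nrm (\<lambda>x. F k x - f x)) \<longlonglongrightarrow> 0"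
    using F(2) by (auto simp: L2_tendsto_def)
  \<comment> \<open>Truncations converge without a rate. Selecting errors at most (1/2)^n produces
    the geometric increments required by \<open>L2_complete_geometric\<close>.\<close>
  have "\<forall>n. \<exists>k. L2_nrm (\<lambda>x. F k x - f x) \<le> (1/2) ^ n"
  proof
    fix n :: nat
    from LIMSEQ_D[OF lim, of "(1/2) ^ n"] obtain K where
      "\<forall>k\<ge>K. norm (L2_nrm (\<lambda>x. F k x - f x) - 0) < (1/2) ^ n" by auto
    then show "\<exists>k. L2_nrm (\<lambda>x. F k x - f x) \<le> (1/2) ^ n" by (auto intro!: exI[of _ K] less_imp_le)
  qed
  from choice[OF this] obtain r where r: "\<And>n. L2_nrm (\<lambda>x. F (r n) x - f x) \<le> (1/2) ^ n" by auto
  define G where "G n = F (r n)" for n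
  have G: "\<And>n. integrable lebesgue (G n)" "\<And>n. G n \<in> L2_fun" using F F2 by (auto simp: G_def)
  have rG: "L2_nrm (\<lambda>x. G n x - f x) \<le> (1/2) ^ n" for n using r by (simp add: G_def)
  have "(\<lambda>n. L2_nrm (\<lambda>x. G n x - f x)) \<longlonglongrightarrow> 0"
    by (rule Lim_null_comparison[OF _ LIMSEQ_realpow_zero[of "1/2"]]) (use rG in auto)
  then have Gf: "L2_tendsto G f" using G f by (simp add: L2_tendsto_def)
  \<comment> \<open>Plancherel turns this into an increment of \<open>G\<close>, bounded by two
    consecutive errors; their factor 1/2 + 1 is rounded up to 2.\<close>
  have "L2_nrm (\<lambda>\<xi>. fourier_integral (G (Suc n)) \<xi> - fourier_integral (G n) \<xi>) \<le> 2 * (1/2) ^ n" for n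
  proof -
    have "fourier_integral (\<lambda>x. G (Suc n) x - G n x)
        = (\<lambda>\<xi>. fourier_integral (G (Suc n)) \<xi> - fourier_integral (G n) \<xi>)"
      using fourier_integral_diff[OF G(1) G(1)] by auto
    then have "L2_nrm (\<lambda>\<xi>. fourier_integral (G (Suc n)) \<xi> - fourier_integral (G n) \<xi>)
        = L2_nrm (fourier_integral (\<lambda>x. G (Suc n) x - G n x))" by simp
    also have "\<dots> = L2_nrm (\<lambda>x. G (Suc n) x - G n x)"
      using G by (intro plancherel_L1_L2 L2_fun_diff) auto
    also have "\<dots> \<le> L2_nrm (\<lambda>x. G (Suc n) x - f x) + L2_nrm (\<lambda>x. f x - G n x)"
      by (intro L2_nrm_diff_triangle G f)
    also have "\<dots> \<le> (1/2) ^ Suc n + (1/2) ^ n"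
      using rG[of "Suc n"] rG[of n] by (simp add: L2_nrm_diff_commute[of f])
    also have "\<dots> \<le> 2 * (1/2) ^ n" by simp
    finally show ?thesis .
  qed
  from L2_complete_geometric[OF plancherel_L1_L2(1)[OF G] this]
  obtain g where "L2_tendsto (\<lambda>n. fourier_integral (G n)) g" by auto
  then show ?thesis using is_fourierI[OF G(1) Gf] by auto
qed

section \<open>The chosen transform: linearity, Parseval, injectivity and inversion\<close>

lemma is_fourier_fourier: "f \<in> L2_fun \<Longrightarrow> is_fourier f (fourier f)"
  unfolding fourier_def using is_fourier_exists by (rule someI_ex)

lemma fourier_L2: "f \<in> L2_fun \<Longrightarrow> fourier f \<in> L2_fun"
  by (rule is_fourier_L2(2)[OF is_fourier_fourier])

lemma fourier_nrm: "f \<in> L2_fun \<Longrightarrow> L2_nrm (fourier f) = L2_nrm f"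
  by (rule is_fourier_nrm[OF is_fourier_fourier])

lemma fourier_eqI: "is_fourier f g \<Longrightarrow> AE x in lebesgue. fourier f x = g x"
  using is_fourier_unique[OF is_fourier_fourier[OF is_fourier_L2(1)]] by blast

text \<open>Equality holds everywhere, not just almost everywhere: both sides choose from the same
  predicate, so they choose the same representative.\<close>

lemma fourier_cong_AE:
  assumes "f \<in> L2_fun" "AE x in lebesgue. f x = g x"
  shows "fourier f = fourier g"
proof -
  have sym: "AE x in lebesgue. g x = f x" using assms(2) by eventually_elim simp
  have "is_fourier f h = is_fourier g h" for h
    using is_fourier_cong_AE[OF _ assms(2), of h h] is_fourier_cong_AE[OF _ sym, of h h] by auto
  then show ?thesis by (simp add: fourier_def)
qed

lemma fourier_add:
  "f \<in> L2_fun \<Longrightarrow> g \<in> L2_fun \<Longrightarrow> AE x in lebesgue. fourier (\<lambda>x. f x + g x) x = fourier f x + fourier g x"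
  by (intro fourier_eqI is_fourier_add is_fourier_fourier)

lemma fourier_cmult:
  "f \<in> L2_fun \<Longrightarrow> AE x in lebesgue. fourier (\<lambda>x. c * f x) x = c * fourier f x"
  by (intro fourier_eqI is_fourier_cmult is_fourier_fourier)

text \<open>Polarization: the isometry applied to \<open>f + g\<close> gives the real part of the
  inner product, and replacing \<open>g\<close> by \<open>\<i> * g\<close> gives the imaginary
  part.\<close>

lemma fourier_parseval:
  assumes f: "f \<in> L2_fun" and g: "g \<in> L2_fun"
  shows "L2_ip (fourier f) (fourier g) = L2_ip f g"
proof -
  have re: "Re (L2_ip (fourier f) (fourier g)) = Re (L2_ip f g)" if g: "g \<in> L2_fun" for g
  proof -
    have "L2_nrm (\<lambda>x. fourier f x + fourier g x) = L2_nrm (\<lambda>x. f x + g x)"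
      using fourier_nrm[OF L2_fun_add[OF f g]]
        L2_nrm_cong_AE[OF fourier_L2[OF L2_fun_add[OF f g]] fourier_add[OF f g]] by simp
    then show ?thesis
      using L2_nrm_square_add[OF f g] L2_nrm_square_add[OF fourier_L2[OF f] fourier_L2[OF g]]
      by (simp add: fourier_nrm f g)
  qed
  have "L2_ip (fourier f) (fourier (\<lambda>x. \<i> * g x)) = L2_ip (fourier f) (\<lambda>x. \<i> * fourier g x)"
    using f g by (intro L2_ip_cong_AE fourier_L2 fourier_cmult L2_fun_cmult) auto
  with re[OF L2_fun_cmult[OF g, of \<i>]] have "Im (L2_ip (fourier f) (fourier g)) = Im (L2_ip f g)"
    by (simp add: L2_ip_cmult_right)
  with re[OF g] show ?thesis by (simp add: complex_eq_iff)
qed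

lemma fourier_inj:
  assumes f: "f \<in> L2_fun" and g: "g \<in> L2_fun" and eq: "AE x in lebesgue. fourier f x = fourier g x"
  shows "AE x in lebesgue. f x = g x"
proof (rule L2_nrm_diff_eq_0[OF f g])
  have "AE x in lebesgue. fourier (\<lambda>x. f x + (-1) * g x) x = 0"
    using fourier_add[OF f L2_fun_cmult[OF g, of "-1"]] fourier_cmult[OF g, of "-1"] eq
    by eventually_elim simp
  then have "L2_nrm (fourier (\<lambda>x. f x + (-1) * g x)) = 0"
    using f g by (subst L2_nrm_eq_0) (auto intro: fourier_L2 L2_fun_diff)
  then show "L2_nrm (\<lambda>x. f x - g x) = 0"
    using fourier_nrm[OF L2_fun_diff[OF f g]] by simp
qed

lemma L2_tendsto_cnj: "L2_tendsto F f \<Longrightarrow> L2_tendsto (\<lambda>k x. cnj (F k x)) (\<lambda>x. cnj (f x))"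
  unfolding L2_tendsto_def using L2_nrm_cnj[of "\<lambda>x. F k x - f x" for k] by (simp add: L2_fun_cnj)

text \<open>Both sides are continuous under L^2 convergence, so the identity for integrable
  approximants passes to the limit.\<close>

lemma fourier_mult_swap:
  assumes f: "f \<in> L2_fun" and g: "g \<in> L2_fun"
  shows "(\<integral>x. fourier f x * g x \<partial>lebesgue) = (\<integral>x. f x * fourier g x \<partial>lebesgue)"
proof -
  obtain F where F: "\<And>k. integrable lebesgue (F k)" "L2_tendsto F f"
    "L2_tendsto (\<lambda>k. fourier_integral (F k)) (fourier f)" using is_fourierE[OF is_fourier_fourier[OF f]] by metis
  obtain G where G: "\<And>k. integrable lebesgue (G k)" "L2_tendsto G g"
    "L2_tendsto (\<lambda>k. fourier_integral (G k)) (fourier g)" using is_fourierE[OF is_fourier_fourier[OF g]] by metis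
  have "(\<lambda>k. \<integral>x. fourier_integral (F k) x * G k x \<partial>lebesgue) \<longlonglongrightarrow> (\<integral>x. fourier f x * g x \<partial>lebesgue)"
    using L2_tendsto_ip[OF L2_tendsto_cnj[OF F(3)] G(2)] by (simp add: L2_ip_def)
  moreover have "(\<lambda>k. \<integral>x. F k x * fourier_integral (G k) x \<partial>lebesgue) \<longlonglongrightarrow> (\<integral>x. f x * fourier g x \<partial>lebesgue)"
    using L2_tendsto_ip[OF L2_tendsto_cnj[OF F(2)] G(3)] by (simp add: L2_ip_def)
  ultimately show ?thesis
    using fourier_integral_mult_swap[OF F(1) G(1)] by (auto intro: LIMSEQ_unique)
qed

text \<open>With \<open>q = F(cnj(F f))\<close> the swap formula gives \<open>\<integral> f q = \<parallel>f\<parallel>\<^sup>2\<close>, and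
  \<open>\<parallel>q\<parallel> = \<parallel>f\<parallel>\<close>, so \<open>f - cnj q\<close> has norm zero.\<close>

lemma fourier_inversion:
  assumes f: "f \<in> L2_fun"
  shows "AE x in lebesgue. f x = cnj (fourier (\<lambda>\<xi>. cnj (fourier f \<xi>)) x)"
proof (rule L2_nrm_diff_eq_0[OF f])
  define g where "g = (\<lambda>\<xi>. cnj (fourier f \<xi>))"
  define q where "q = fourier g"
  have g: "g \<in> L2_fun" unfolding g_def by (intro L2_fun_cnj fourier_L2 f)
  have q: "q \<in> L2_fun" unfolding q_def by (intro fourier_L2 g)
  show "(\<lambda>x. cnj (fourier (\<lambda>\<xi>. cnj (fourier f \<xi>)) x)) \<in> L2_fun"
    using L2_fun_cnj[OF q] by (simp add: q_def g_def)
  have nq: "L2_nrm q = L2_nrm f"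
    unfolding q_def fourier_nrm[OF g] unfolding g_def L2_nrm_cnj fourier_nrm[OF f] ..
  have "L2_ip f (\<lambda>x. cnj (q x)) = cnj (\<integral>x. f x * fourier g x \<partial>lebesgue)"
    by (simp add: L2_ip_def q_def flip: Bochner_Integration.integral_cnj)
  also have "\<dots> = cnj (\<integral>x. fourier f x * g x \<partial>lebesgue)"
    by (simp add: fourier_mult_swap[OF f g])
  also have "\<dots> = L2_ip (fourier f) (fourier f)"
    by (simp add: L2_ip_def g_def flip: Bochner_Integration.integral_cnj)
  also have "\<dots> = of_real ((L2_nrm f)\<^sup>2)" by (simp add: L2_ip_self fourier_nrm[OF f])
  finally have ip: "L2_ip f (\<lambda>x. cnj (q x)) = of_real ((L2_nrm f)\<^sup>2)" .
  have "(L2_nrm (\<lambda>x. f x + (-1) * cnj (q x)))\<^sup>2 = 0"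
    unfolding L2_nrm_square_add[OF f L2_fun_cmult[OF L2_fun_cnj[OF q]]] L2_ip_cmult_right L2_nrm_cmult ip
    by (simp add: L2_nrm_cnj nq del: of_real_power)
  then show "L2_nrm (\<lambda>x. f x - cnj (fourier (\<lambda>\<xi>. cnj (fourier f \<xi>)) x)) = 0"
    by (simp add: q_def g_def)
qed

text \<open>Inversion for \<open>cnj g\<close>, conjugated, says that transforming
  \<open>cnj (fourier (cnj g))\<close> returns \<open>g\<close>; that function is the
  preimage.\<close>

lemma fourier_surj:
  assumes g: "g \<in> L2_fun"
  obtains f where "f \<in> L2_fun" "AE x in lebesgue. fourier f x = g x"
proof
  let ?f = "\<lambda>x. cnj (fourier (\<lambda>\<xi>. cnj (g \<xi>)) x)"
  show "?f \<in> L2_fun" by (intro L2_fun_cnj fourier_L2 g)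
  show "AE x in lebesgue. fourier ?f x = g x"
    using fourier_inversion[OF L2_fun_cnj[OF g]]
  proof eventually_elim
    case (elim x)
    then show ?case by (metis complex_cnj_cnj)
  qed
qed

text \<open>Transport principle: an operation \<open>T\<close> on functions matched by
  \<open>S\<close> on integrable transforms extends to the L^2 transform as soon as both respect L^2
  limits.\<close>

lemma is_fourier_transfer:
  assumes "is_fourier f g"
    and "\<And>h. integrable lebesgue h \<Longrightarrow> integrable lebesgue (T h)"
    and "\<And>h. integrable lebesgue h \<Longrightarrow> fourier_integral (T h) = S (fourier_integral h)"
    and "\<And>F f. L2_tendsto F f \<Longrightarrow> L2_tendsto (\<lambda>k. T (F k)) (T f)"
    and "\<And>F f. L2_tendsto F f \<Longrightarrow> L2_tendsto (\<lambda>k. S (F k)) (S f)"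
  shows "is_fourier (T f) (S g)"
proof -
  obtain F where F: "\<And>k. integrable lebesgue (F k)" "L2_tendsto F f"
    "L2_tendsto (\<lambda>k. fourier_integral (F k)) g" using is_fourierE[OF assms(1)] by metis
  show ?thesis
    by (rule is_fourierI[of "\<lambda>k. T (F k)"]) (use F assms in auto)
qed

lemma L2_fun_mult_unimodular:
  assumes "f \<in> L2_fun" "e \<in> borel_measurable lebesgue" "\<And>x. cmod (e x) = 1"
  shows "(\<lambda>x. f x * e x) \<in> L2_fun" "L2_nrm (\<lambda>x. f x * e x) = L2_nrm f"
proof -
  have [measurable]: "f \<in> borel_measurable lebesgue" using assms(1) by (rule L2_fun_measurable)
  show "(\<lambda>x. f x * e x) \<in> L2_fun"
    by (rule L2_fun_bound[OF assms(1), where C = 1]) (use assms in \<open>auto simp: norm_mult\<close>)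
qed (simp add: L2_nrm_def norm_mult assms)

lemma is_fourier_modulate:
  assumes "is_fourier f g"
  shows "is_fourier (\<lambda>x. f x * cnj (fkernel x \<eta>)) (\<lambda>\<xi>. g (\<xi> - \<eta>))"
proof (rule is_fourier_transfer[OF assms, of "\<lambda>f x. f x * cnj (fkernel x \<eta>)" "\<lambda>g \<xi>. g (\<xi> - \<eta>)"])
  fix h :: "'a \<Rightarrow> complex" assume h: "integrable lebesgue h"
  then show "integrable lebesgue (\<lambda>x. h x * cnj (fkernel x \<eta>))"
    using integrable_fkernel[OF h, of "- \<eta>"] by (simp add: fkernel_minus)
  show "fourier_integral (\<lambda>x. h x * cnj (fkernel x \<eta>)) = (\<lambda>\<xi>. fourier_integral h (\<xi> - \<eta>))"
    by (rule ext) (simp add: fourier_integral_kernel fkernel_diff mult_ac)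
next
  note unimod = L2_fun_mult_unimodular[of _ "\<lambda>x. cnj (fkernel x \<eta>)"]
  fix F :: "nat \<Rightarrow> 'a \<Rightarrow> complex" and f assume F: "L2_tendsto F f"
  then have m: "\<And>k. F k \<in> L2_fun" "f \<in> L2_fun" by (auto simp: L2_tendsto_def)
  show "L2_tendsto (\<lambda>k x. F k x * cnj (fkernel x \<eta>)) (\<lambda>x. f x * cnj (fkernel x \<eta>))"
    using F m unimod(1)[OF m(1)] unimod(1)[OF m(2)] unimod(2)[OF L2_fun_diff[OF m]]
    by (simp add: L2_tendsto_def flip: left_diff_distrib)
  show "L2_tendsto (\<lambda>k x. F k (x - \<eta>)) (\<lambda>x. f (x - \<eta>))"
    using lebesgue_preserving_L2_tendsto[OF lebesgue_preserving_translate F, of "- \<eta>"] by simp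
qed

text \<open>A function with real transform therefore agrees almost everywhere with its reflected
  conjugate, the source of the symmetry of ground states.\<close>

lemma is_fourier_cnj_reflect:
  assumes "is_fourier f g"
  shows "is_fourier (\<lambda>x. cnj (f (- x))) (\<lambda>\<xi>. cnj (g \<xi>))"
proof (rule is_fourier_transfer[OF assms, of "\<lambda>f x. cnj (f (- x))" "\<lambda>g \<xi>. cnj (g \<xi>)"])
  fix h :: "'a \<Rightarrow> complex" assume h: "integrable lebesgue h"
  then show "integrable lebesgue (\<lambda>x. cnj (h (- x)))"
    using lebesgue_preserving_integrable[OF lebesgue_preserving_uminus h] by simp
  have [measurable]: "h \<in> borel_measurable lebesgue" using h by auto
  show "fourier_integral (\<lambda>x. cnj (h (- x))) = (\<lambda>\<xi>. cnj (fourier_integral h \<xi>))"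
  proof
    fix \<xi>
    have "fourier_integral (\<lambda>x. cnj (h (- x))) \<xi> = (\<integral>x. cnj (h (- x) * fkernel (- x) \<xi>) \<partial>lebesgue)"
      by (simp add: fourier_integral_kernel fkernel_minus)
    also have "\<dots> = (\<integral>x. cnj (h x * fkernel x \<xi>) \<partial>lebesgue)"
      by (rule lebesgue_preserving_integral[OF lebesgue_preserving_uminus]) measurable
    finally show "fourier_integral (\<lambda>x. cnj (h (- x))) \<xi> = cnj (fourier_integral h \<xi>)"
      by (simp only: fourier_integral_kernel Bochner_Integration.integral_cnj)
  qed
qed (auto intro: L2_tendsto_cnj lebesgue_preserving_L2_tendsto[OF lebesgue_preserving_uminus])

text \<open>Conjugation negates the frequency; for an even symbol this leaves the kinetic energy
  unchanged.\<close>

lemma is_fourier_cnj: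
  assumes "is_fourier f g"
  shows "is_fourier (\<lambda>x. cnj (f x)) (\<lambda>\<xi>. cnj (g (- \<xi>)))"
proof (rule is_fourier_transfer[OF assms, of "\<lambda>f x. cnj (f x)" "\<lambda>g \<xi>. cnj (g (- \<xi>))"])
  fix h :: "'a \<Rightarrow> complex" assume h: "integrable lebesgue h"
  then show "integrable lebesgue (\<lambda>x. cnj (h x))" by simp
  show "fourier_integral (\<lambda>x. cnj (h x)) = (\<lambda>\<xi>. cnj (fourier_integral h (- \<xi>)))"
    by (rule ext) (simp add: fourier_integral_kernel fkernel_minus flip: Bochner_Integration.integral_cnj)
qed (auto intro: L2_tendsto_cnj lebesgue_preserving_L2_tendsto[OF lebesgue_preserving_uminus])

section \<open>Convolution\<close>

definition conv :: "('a::euclidean_space \<Rightarrow> complex) \<Rightarrow> ('a \<Rightarrow> complex) \<Rightarrow> 'a \<Rightarrow> complex" where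
  "conv w u \<xi> = (\<integral>\<eta>. w (\<xi> - \<eta>) * u \<eta> \<partial>lebesgue)"

lemma conv_integrable:
  "w \<in> L2_fun \<Longrightarrow> u \<in> L2_fun \<Longrightarrow> integrable lebesgue (\<lambda>\<eta>. w (\<xi> - \<eta>) * u \<eta>)"
  by (intro L2_mult_integrable lebesgue_preserving_L2[OF lebesgue_preserving_reflect])

lemma conv_add:
  "w \<in> L2_fun \<Longrightarrow> u \<in> L2_fun \<Longrightarrow> v \<in> L2_fun \<Longrightarrow> conv w (\<lambda>x. u x + v x) \<xi> = conv w u \<xi> + conv w v \<xi>"
  by (simp add: conv_def distrib_left conv_integrable)

lemma conv_cmult: "conv w (\<lambda>x. a * u x) \<xi> = a * conv w u \<xi>"
  by (simp add: conv_def mult.left_commute)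

lemma conv_cong_AE:
  assumes w: "w \<in> L2_fun" and u: "u \<in> L2_fun" and eq: "AE x in lebesgue. u x = v x"
  shows "conv w u = conv w v"
proof
  fix \<xi>
  show "conv w u \<xi> = conv w v \<xi>"
    unfolding conv_def
  proof (rule integral_cong_AE)
    show "(\<lambda>\<eta>. w (\<xi> - \<eta>) * u \<eta>) \<in> borel_measurable lebesgue"
      "(\<lambda>\<eta>. w (\<xi> - \<eta>) * v \<eta>) \<in> borel_measurable lebesgue"
      using conv_integrable[OF w u, of \<xi>] conv_integrable[OF w L2_fun_cong_AE[OF u eq], of \<xi>] by auto
    show "AE \<eta> in lebesgue. w (\<xi> - \<eta>) * u \<eta> = w (\<xi> - \<eta>) * v \<eta>"
      using eq by eventually_elim simp
  qed
qed

lemma conv_commute: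
  assumes "w \<in> L2_fun" "u \<in> L2_fun"
  shows "conv w u \<xi> = conv u w \<xi>"
proof -
  have "(\<integral>\<eta>. w (\<xi> - (\<xi> - \<eta>)) * u (\<xi> - \<eta>) \<partial>lebesgue) = conv w u \<xi>"
    unfolding conv_def using conv_integrable[OF assms, of \<xi>]
    by (intro lebesgue_preserving_integral[OF lebesgue_preserving_reflect, of "\<lambda>\<eta>. w (\<xi> - \<eta>) * u \<eta>"]) auto
  then show ?thesis by (simp add: conv_def mult.commute)
qed

text \<open>The value at a point is an inner product of \<open>u\<close> with a translate of the
  reflected conjugate of \<open>w\<close>, and translates depend continuously on the shift in
  L^2.\<close>

lemma continuous_conv:
  assumes w: "w \<in> L2_fun" and u: "u \<in> L2_fun"
  shows "continuous_on UNIV (conv w u)"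
  unfolding continuous_on_sequentially comp_def
proof (intro allI impI ballI, elim conjE)
  fix X :: "nat \<Rightarrow> 'a" and a assume X: "X \<longlonglongrightarrow> a"
  have ip: "conv w u \<xi> = L2_ip (\<lambda>\<eta>. cnj (w (- (\<eta> + - \<xi>)))) u" for \<xi>
    by (simp add: conv_def L2_ip_def)
  have "L2_tendsto (\<lambda>k \<eta>. cnj (w (- (\<eta> + - X k)))) (\<lambda>\<eta>. cnj (w (- (\<eta> + - a))))"
    using L2_translate_tendsto[OF lebesgue_preserving_L2[OF lebesgue_preserving_uminus w] tendsto_minus[OF X]]
    by (rule L2_tendsto_cnj)
  then show "(\<lambda>n. conv w u (X n)) \<longlonglongrightarrow> conv w u a"
    unfolding ip by (intro L2_tendsto_ip L2_tendsto_const u)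
qed

lemma borel_measurable_conv:
  "w \<in> L2_fun \<Longrightarrow> u \<in> L2_fun \<Longrightarrow> conv w u \<in> borel_measurable borel"
  by (intro borel_measurable_continuous_onI continuous_conv)

text \<open>Fubini. Cauchy-Schwarz in the frequency variable bounds the inner integral by the
  product of the norms of \<open>z\<close> and \<open>u\<close>, uniformly in the shift, so
  integrability of \<open>w\<close> gives absolute convergence.\<close>

lemma conv_pairing:
  assumes w1: "integrable lebesgue w" and w2: "w \<in> L2_fun" and z: "z \<in> L2_fun" and u: "u \<in> L2_fun"
  shows "integrable lebesgue (\<lambda>\<xi>. cnj (z \<xi>) * conv w u \<xi>)"
    and "(\<integral>\<xi>. cnj (z \<xi>) * conv w u \<xi> \<partial>lebesgue)
        = (\<integral>\<eta>. w \<eta> * L2_ip z (\<lambda>\<xi>. u (\<xi> - \<eta>)) \<partial>lebesgue)"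
proof -
  obtain w' where w': "w' \<in> borel_measurable borel" "AE x in lebesgue. w x = w' x"
    by (rule lebesgue_ex_borel[OF L2_fun_measurable[OF w2]])
  obtain z' where z': "z' \<in> borel_measurable borel" "AE x in lebesgue. z x = z' x"
    by (rule lebesgue_ex_borel[OF L2_fun_measurable[OF z]])
  obtain u' where u': "u' \<in> borel_measurable borel" "AE x in lebesgue. u x = u' x"
    by (rule lebesgue_ex_borel[OF L2_fun_measurable[OF u]])
  have w'2: "w' \<in> L2_fun" and z'2: "z' \<in> L2_fun" and u'2: "u' \<in> L2_fun"
    using L2_fun_cong_AE[OF w2 w'(2)] L2_fun_cong_AE[OF z z'(2)] L2_fun_cong_AE[OF u u'(2)] by auto
  have [measurable]: "w' \<in> borel_measurable borel" "z' \<in> borel_measurable borel" "u' \<in> borel_measurable borel"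
    by (fact w'(1) z'(1) u'(1))+
  have [measurable]: "w \<in> borel_measurable lebesgue" "z \<in> borel_measurable lebesgue"
    "w' \<in> borel_measurable lebesgue" "z' \<in> borel_measurable lebesgue"
    using w2 z w'2 z'2 by (auto dest: L2_fun_measurable)
  have "integrable lebesgue w'"
    by (rule integrable_cong_AE_imp[OF w1 L2_fun_measurable[OF w'2]]) (use w'(2) in auto)
  then have w'1: "integrable lborel w'" by (simp add: integrable_lebesgue_lborel)
  have sh: "(\<lambda>\<xi>. u' (\<xi> - \<eta>)) \<in> L2_fun" for \<eta>
    using lebesgue_preserving_L2[OF lebesgue_preserving_translate u'2, of "- \<eta>"] by simp
  have sh_nrm: "L2_nrm (\<lambda>\<xi>. u' (\<xi> - \<eta>)) = L2_nrm u'" for \<eta>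
    using lebesgue_preserving_L2_nrm[OF lebesgue_preserving_translate u'2, of "- \<eta>"] by simp
  have pair: "integrable (lborel \<Otimes>\<^sub>M lborel) (\<lambda>(\<eta>, \<xi>). w' \<eta> * (cnj (z' \<xi>) * u' (\<xi> - \<eta>)))"
  proof (rule lborel_pair.Fubini_integrable)
    show "integrable lborel (\<lambda>\<eta>. \<integral>\<xi>. norm (case (\<eta>, \<xi>) of (\<eta>, \<xi>) \<Rightarrow> w' \<eta> * (cnj (z' \<xi>) * u' (\<xi> - \<eta>))) \<partial>lborel)"
    proof (rule Bochner_Integration.integrable_bound)
      show "integrable lborel (\<lambda>\<eta>. cmod (w' \<eta>) * (L2_nrm z' * L2_nrm u'))"
        using w'1 by (intro integrable_mult_left) simp
      have "(\<integral>\<xi>. cmod (cnj (z' \<xi>) * u' (\<xi> - \<eta>)) \<partial>lborel) \<le> L2_nrm z' * L2_nrm u'" for \<eta>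
        using L2_Cauchy_Schwarz_norm[OF L2_fun_cnj[OF z'2] sh, of \<eta>]
        by (subst (asm) integral_lebesgue_lborel) (simp_all add: L2_nrm_cnj sh_nrm)
      then show "AE \<eta> in lborel. norm (\<integral>\<xi>. norm (case (\<eta>, \<xi>) of (\<eta>, \<xi>) \<Rightarrow> w' \<eta> * (cnj (z' \<xi>) * u' (\<xi> - \<eta>))) \<partial>lborel)
          \<le> norm (cmod (w' \<eta>) * (L2_nrm z' * L2_nrm u'))"
        by (intro AE_I2) (simp add: norm_mult abs_mult integral_nonneg_AE mult_left_mono)
    qed measurable
    have "integrable lborel (\<lambda>\<xi>. cnj (z' \<xi>) * u' (\<xi> - \<eta>))" for \<eta>
      using L2_ip_integrable[OF z'2 sh] by (subst (asm) integrable_lebesgue_lborel) simp_all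
    then show "AE \<eta> in lborel. integrable lborel (\<lambda>\<xi>. case (\<eta>, \<xi>) of (\<eta>, \<xi>) \<Rightarrow> w' \<eta> * (cnj (z' \<xi>) * u' (\<xi> - \<eta>)))"
      by simp
  qed measurable
  \<comment> \<open>\<open>conv_cong_AE\<close> changes only the second factor; commuting the
    convolution makes the first one accessible as well.\<close>
  have cv: "conv w u = conv w' u'"
  proof
    fix \<xi>
    have "conv w u \<xi> = conv u' w \<xi>"
      unfolding conv_cong_AE[OF w2 u u'(2)] by (rule conv_commute[OF w2 u'2])
    also have "\<dots> = conv w' u' \<xi>"
      unfolding conv_cong_AE[OF u'2 w2 w'(2)] by (rule conv_commute[OF u'2 w'2])
    finally show "conv w u \<xi> = conv w' u' \<xi>" .
  qed
  have inner: "(\<integral>\<eta>. w' \<eta> * (cnj (z' \<xi>) * u' (\<xi> - \<eta>)) \<partial>lborel) = cnj (z' \<xi>) * conv w u \<xi>" for \<xi>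
  proof -
    have "(\<integral>\<eta>. w' \<eta> * (cnj (z' \<xi>) * u' (\<xi> - \<eta>)) \<partial>lborel) = cnj (z' \<xi>) * (\<integral>\<eta>. u' (\<xi> - \<eta>) * w' \<eta> \<partial>lborel)"
      by (simp add: mult_ac flip: integral_mult_right_zero)
    also have "(\<integral>\<eta>. u' (\<xi> - \<eta>) * w' \<eta> \<partial>lborel) = conv u' w' \<xi>"
      unfolding conv_def by (rule integral_lebesgue_lborel[symmetric]) measurable
    also have "conv u' w' \<xi> = conv w u \<xi>" unfolding cv by (rule conv_commute[OF u'2 w'2])
    finally show ?thesis .
  qed
  note [measurable] = borel_measurable_conv[OF w2 u]
  have [measurable]: "conv w u \<in> borel_measurable lebesgue"
    by (intro measurable_lebesgueI borel_measurable_conv w2 u)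
  have ae: "AE \<xi> in lebesgue. cnj (z' \<xi>) * conv w u \<xi> = cnj (z \<xi>) * conv w u \<xi>"
    using z'(2) by eventually_elim simp
  have "integrable lborel (\<lambda>\<xi>. cnj (z' \<xi>) * conv w u \<xi>)"
    using lborel_pair.integrable_snd[OF pair] by (simp add: inner)
  then have "integrable lebesgue (\<lambda>\<xi>. cnj (z' \<xi>) * conv w u \<xi>)"
    by (subst integrable_lebesgue_lborel) measurable
  then show "integrable lebesgue (\<lambda>\<xi>. cnj (z \<xi>) * conv w u \<xi>)"
    by (rule integrable_cong_AE_imp[OF _ _ ae]) measurable
  have ip: "L2_ip z (\<lambda>\<xi>. u (\<xi> - \<eta>)) = (\<integral>\<xi>. cnj (z' \<xi>) * u' (\<xi> - \<eta>) \<partial>lborel)" for \<eta>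
  proof -
    have s: "(\<lambda>\<xi>. u (\<xi> - \<eta>)) \<in> L2_fun"
      using lebesgue_preserving_L2[OF lebesgue_preserving_translate u, of "- \<eta>"] by simp
    have "AE \<xi> in lebesgue. u (\<xi> - \<eta>) = u' (\<xi> - \<eta>)"
      using lebesgue_preserving_AE[OF lebesgue_preserving_translate u'(2), of "- \<eta>"] by simp
    then have "L2_ip z (\<lambda>\<xi>. u (\<xi> - \<eta>)) = L2_ip z' (\<lambda>\<xi>. u' (\<xi> - \<eta>))"
      by (rule L2_ip_cong_AE[OF z s z'(2)])
    then show ?thesis by (simp add: L2_ip_def integral_lebesgue_lborel)
  qed
  have "(\<integral>\<xi>. cnj (z \<xi>) * conv w u \<xi> \<partial>lebesgue) = (\<integral>\<xi>. cnj (z' \<xi>) * conv w u \<xi> \<partial>lebesgue)"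
    by (rule integral_cong_AE) (use ae in \<open>auto elim: eventually_mono\<close>)
  also have "\<dots> = (\<integral>\<xi>. cnj (z' \<xi>) * conv w u \<xi> \<partial>lborel)"
    by (rule integral_lebesgue_lborel) measurable
  also have "\<dots> = (\<integral>\<xi>. (\<integral>\<eta>. w' \<eta> * (cnj (z' \<xi>) * u' (\<xi> - \<eta>)) \<partial>lborel) \<partial>lborel)"
    by (simp only: inner)
  also have "\<dots> = (\<integral>\<eta>. (\<integral>\<xi>. w' \<eta> * (cnj (z' \<xi>) * u' (\<xi> - \<eta>)) \<partial>lborel) \<partial>lborel)"
    by (rule lborel_pair.Fubini_integral[OF pair])
  also have "\<dots> = (\<integral>\<eta>. w' \<eta> * (\<integral>\<xi>. cnj (z' \<xi>) * u' (\<xi> - \<eta>) \<partial>lborel) \<partial>lborel)"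
    by simp
  also have "\<dots> = (\<integral>\<eta>. w' \<eta> * (\<integral>\<xi>. cnj (z' \<xi>) * u' (\<xi> - \<eta>) \<partial>lborel) \<partial>lebesgue)"
    by (rule integral_lebesgue_lborel[symmetric]) measurable
  also have "\<dots> = (\<integral>\<eta>. w \<eta> * (\<integral>\<xi>. cnj (z' \<xi>) * u' (\<xi> - \<eta>) \<partial>lborel) \<partial>lebesgue)"
  proof (rule integral_cong_AE)
    have "(\<lambda>\<eta>. \<integral>\<xi>. cnj (z' \<xi>) * u' (\<xi> - \<eta>) \<partial>lborel) \<in> borel_measurable borel" by measurable
    then have [measurable]: "(\<lambda>\<eta>. \<integral>\<xi>. cnj (z' \<xi>) * u' (\<xi> - \<eta>) \<partial>lborel) \<in> borel_measurable lebesgue"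
      by (rule measurable_lebesgueI)
    show "(\<lambda>\<eta>. w' \<eta> * (\<integral>\<xi>. cnj (z' \<xi>) * u' (\<xi> - \<eta>) \<partial>lborel)) \<in> borel_measurable lebesgue"
      "(\<lambda>\<eta>. w \<eta> * (\<integral>\<xi>. cnj (z' \<xi>) * u' (\<xi> - \<eta>) \<partial>lborel)) \<in> borel_measurable lebesgue"
      by measurable
    show "AE \<eta> in lebesgue. w' \<eta> * (\<integral>\<xi>. cnj (z' \<xi>) * u' (\<xi> - \<eta>) \<partial>lborel)
        = w \<eta> * (\<integral>\<xi>. cnj (z' \<xi>) * u' (\<xi> - \<eta>) \<partial>lborel)"
      using w'(2) by eventually_elim simp
  qed
  finally show "(\<integral>\<xi>. cnj (z \<xi>) * conv w u \<xi> \<partial>lebesgue)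
      = (\<integral>\<eta>. w \<eta> * L2_ip z (\<lambda>\<xi>. u (\<xi> - \<eta>)) \<partial>lebesgue)"
    by (simp add: ip)
qed

text \<open>The multiplier is the inverse transform of \<open>w\<close>, hence the reflection. After
  it is moved onto the product \<open>cnj f * g\<close>, the swap formula and
  \<open>conv_pairing\<close> produce the convolution.\<close>

lemma fourier_multiplier:
  assumes w1: "integrable lebesgue w" and w2: "w \<in> L2_fun" and f: "f \<in> L2_fun" and g: "g \<in> L2_fun"
  shows "(\<integral>x. fourier_integral w (- x) * (cnj (f x) * g x) \<partial>lebesgue)
      = (\<integral>\<xi>. cnj (fourier f \<xi>) * conv w (fourier g) \<xi> \<partial>lebesgue)"
proof -
  have [measurable]: "w \<in> borel_measurable lebesgue" using w1 by auto
  define k where "k x = cnj (f x) * g x" for x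
  have k: "integrable lebesgue k" using L2_ip_integrable[OF f g] by (simp add: k_def[abs_def])
  have k': "integrable lebesgue (\<lambda>x. k (- x))"
    by (rule lebesgue_preserving_integrable[OF lebesgue_preserving_uminus k])
  have Fw: "fourier_integral w \<in> borel_measurable lebesgue"
    by (intro measurable_lebesgueI borel_measurable_fourier_integral w1)
  \<comment> \<open>The character is absorbed into \<open>g\<close> as a modulation, which Parseval
    converts into a translate of \<open>fourier g\<close>.\<close>
  have FK: "fourier_integral (\<lambda>x. k (- x)) \<eta> = L2_ip (fourier f) (\<lambda>\<xi>. fourier g (\<xi> - \<eta>))" for \<eta>
  proof -
    have i: "is_fourier (\<lambda>x. g x * cnj (fkernel x \<eta>)) (\<lambda>\<xi>. fourier g (\<xi> - \<eta>))"
      by (rule is_fourier_modulate[OF is_fourier_fourier[OF g]])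
    have "fourier_integral (\<lambda>x. k (- x)) \<eta> = (\<integral>x. k (- x) * cnj (fkernel (- x) \<eta>) \<partial>lebesgue)"
      by (simp add: fourier_integral_kernel fkernel_minus)
    also have "\<dots> = (\<integral>x. k x * cnj (fkernel x \<eta>) \<partial>lebesgue)"
      using lebesgue_preserving_integral[OF lebesgue_preserving_uminus, of "\<lambda>x. k x * cnj (fkernel x \<eta>)"]
        borel_measurable_integrable[OF k] by simp
    also have "\<dots> = L2_ip f (\<lambda>x. g x * cnj (fkernel x \<eta>))"
      by (simp add: L2_ip_def k_def mult.assoc)
    also have "\<dots> = L2_ip (fourier f) (fourier (\<lambda>x. g x * cnj (fkernel x \<eta>)))"
      by (rule fourier_parseval[symmetric, OF f is_fourier_L2(1)[OF i]])
    also have "\<dots> = L2_ip (fourier f) (\<lambda>\<xi>. fourier g (\<xi> - \<eta>))"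
      using f is_fourier_L2(1)[OF i] fourier_eqI[OF i] by (intro L2_ip_cong_AE fourier_L2) auto
    finally show ?thesis .
  qed
  have "(\<integral>x. fourier_integral w (- x) * k x \<partial>lebesgue) = (\<integral>x. fourier_integral w x * k (- x) \<partial>lebesgue)"
    using lebesgue_preserving_integral[OF lebesgue_preserving_uminus, of "\<lambda>x. fourier_integral w (- x) * k x"]
      borel_measurable_integrable[OF k] lebesgue_preserving_measurable[OF lebesgue_preserving_uminus Fw]
    by simp
  also have "\<dots> = (\<integral>\<eta>. w \<eta> * fourier_integral (\<lambda>x. k (- x)) \<eta> \<partial>lebesgue)"
    by (rule fourier_integral_mult_swap[OF w1 k'])
  also have "\<dots> = (\<integral>\<eta>. w \<eta> * L2_ip (fourier f) (\<lambda>\<xi>. fourier g (\<xi> - \<eta>)) \<partial>lebesgue)"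
    by (simp only: FK)
  also have "(\<integral>\<eta>. w \<eta> * L2_ip (fourier f) (\<lambda>\<xi>. fourier g (\<xi> - \<eta>)) \<partial>lebesgue)
      = (\<integral>\<xi>. cnj (fourier f \<xi>) * conv w (fourier g) \<xi> \<partial>lebesgue)"
    by (rule conv_pairing(2)[symmetric, OF w1 w2 fourier_L2[OF f] fourier_L2[OF g]])
  finally show ?thesis by (simp add: k_def)
qed

text \<open>Cutting both the frequency range and the size of values gives an L^2 function for any
  measurable \<open>r\<close>; points are discarded rather than values clipped, so
  \<open>cnj (truncated k r) * r\<close> is exactly the squared modulus of the truncation.\<close>

definition truncated :: "nat \<Rightarrow> ('a::euclidean_space \<Rightarrow> complex) \<Rightarrow> 'a \<Rightarrow> complex" where
  "truncated k r \<xi> = (if norm \<xi> < real k \<and> cmod (r \<xi>) \<le> real k then r \<xi> else 0)"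

lemma truncated_measurable [measurable]:
  assumes [measurable]: "r \<in> borel_measurable lebesgue"
  shows "truncated k r \<in> borel_measurable lebesgue"
proof -
  have [measurable]: "(\<lambda>\<xi>::'a. norm \<xi>) \<in> borel_measurable lebesgue"
    by (rule measurable_lebesgueI) measurable
  show ?thesis unfolding truncated_def[abs_def] by measurable
qed

lemma truncated_L2:
  fixes r :: "'a::euclidean_space \<Rightarrow> complex"
  assumes "r \<in> borel_measurable lebesgue"
  shows "truncated k r \<in> L2_fun"
proof (rule L2_fun_bound[where C = "real k"])
  show "(\<lambda>x::'a. complex_of_real (indicator (ball 0 (real k)) x)) \<in> L2_fun"
    using emeasure_lborel_ball_finite[of "0::'a" "real k"] by (intro L2_fun_indicator) auto
qed (use assms in \<open>auto simp: truncated_def indicator_def\<close>)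

text \<open>Testing \<open>r\<close> against its own truncation returns the squared norm of that
  truncation, and every point is kept by some truncation. No integrability of \<open>r\<close> is
  assumed.\<close>

lemma AE_zero_if_orthogonal_truncated:
  assumes r: "r \<in> borel_measurable lebesgue"
    and orth: "\<And>k. Re (\<integral>\<xi>. cnj (truncated k r \<xi>) * r \<xi> \<partial>lebesgue) = 0"
  shows "AE \<xi> in lebesgue. r \<xi> = 0"
proof -
  have "AE \<xi> in lebesgue. truncated k r \<xi> = 0" for k
  proof -
    have eq: "cnj (truncated k r \<xi>) * r \<xi> = of_real ((cmod (truncated k r \<xi>))\<^sup>2)" for \<xi>
      unfolding complex_norm_square by (simp add: truncated_def mult.commute)
    have "Re (\<integral>\<xi>. cnj (truncated k r \<xi>) * r \<xi> \<partial>lebesgue) = (L2_nrm (truncated k r))\<^sup>2"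
      unfolding eq integral_complex_of_real L2_nrm_square by simp
    then show ?thesis using orth[of k] L2_nrm_eq_0[OF truncated_L2[OF r, of k]] by simp
  qed
  then have "AE \<xi> in lebesgue. \<forall>k. truncated k r \<xi> = 0" by (simp add: AE_all_countable)
  then show ?thesis
  proof eventually_elim
    case (elim \<xi>)
    obtain k where "max (norm \<xi>) (cmod (r \<xi>)) < real k" using reals_Archimedean2 by blast
    with elim[rule_format, of k] show ?case by (auto simp: truncated_def split: if_splits)
  qed
qed

lemma linear_coefficient_zero:
  fixes x y :: real
  assumes "\<And>t. 0 \<le> 2 * t * x + t\<^sup>2 * y"
  shows "x = 0"
proof (rule ccontr)
  assume x: "x \<noteq> 0"
  \<comment> \<open>At t = - x / d the quadratic equals x^2 / d * (y / d - 2), which is negative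
    because y < d; adding 1 keeps \<open>d\<close> positive when y = 0.\<close>
  define d where "d = \<bar>y\<bar> + 1"
  have d: "d > 0" "y < d" by (auto simp: d_def)
  have "0 \<le> 2 * (- x / d) * x + (- x / d)\<^sup>2 * y" by (rule assms)
  also have "\<dots> = x\<^sup>2 / d * (y / d - 2)" using d by (simp add: field_simps power2_eq_square)
  also have "\<dots> < 0" using d x by (intro mult_pos_neg) (auto simp: field_simps)
  finally show False by simp
qed

text \<open>Converts a contradiction obtained at almost every point into an actual
  contradiction.\<close>

lemma lebesgue_AE_False: "\<not> (AE x in (lebesgue :: 'a::euclidean_space measure). False)"
proof
  assume "AE x in (lebesgue :: 'a measure). False"
  then have "UNIV \<in> null_sets (lebesgue :: 'a measure)"
    by (simp add: AE_iff_null_sets)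
  then show False by (simp add: null_sets_def)
qed

lemma unimodular_exp:
  assumes "cmod z = 1" shows "\<exists>t::real. z = exp (\<i> * of_real t)"
proof -
  have "z \<noteq> 0" using assms by auto
  from Arg_eq[OF this] assms show ?thesis by auto
qed

section \<open>The quadratic form on the Fourier side\<close>

locale schroedinger =
  fixes p V :: "'a::euclidean_space \<Rightarrow> real" and s A B c :: real
  assumes s: "s > 0" and p_cont: "continuous_on UNIV p"
    and A: "A > 0" and B: "B > 0"
    and p_lower: "\<And>\<xi>. A * norm \<xi> powr (2 * s) + c \<le> p \<xi>"
    and p_upper: "\<And>\<xi>. p \<xi> \<le> B * norm \<xi> powr (2 * s)"
    and V_L2: "(\<lambda>x. complex_of_real (V x)) \<in> L2_fun"
    and FV_L1: "integrable lebesgue (fourier (\<lambda>x. complex_of_real (V x)))"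
    and FV_L2: "fourier (\<lambda>x. complex_of_real (V x)) \<in> L2_fun"
    and FV_neg: "AE \<xi> in lebesgue. Im (fourier (\<lambda>x. complex_of_real (V x)) \<xi>) = 0 \<and>
                            Re (fourier (\<lambda>x. complex_of_real (V x)) \<xi>) < 0"
    and gap: "ground_energy s p V < (INF \<xi>. p \<xi>)"
begin

definition E where "E = ground_energy s p V"
text \<open>The symbol of \<open>P(D) - E\<close>; the gap assumption makes it positive
  everywhere.\<close>

definition gap_symbol where "gap_symbol \<xi> = p \<xi> - E"
text \<open>The real part is taken so that \<open>w\<close> is real at every point; the identity
  with minus the transform of \<open>V\<close> then holds almost everywhere.\<close>

definition w where "w \<xi> = - Re (fourier (\<lambda>x. complex_of_real (V x)) \<xi>)"
definition W where "W \<xi> = complex_of_real (w \<xi>)"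
definition weight where "weight \<xi> = (1 + (norm \<xi>)\<^sup>2) powr (s / 2)" for \<xi> :: 'a
text \<open>The Sobolev space seen from the frequency side: up to null sets its elements are the
  transforms of functions in \<open>sobolev s\<close>.\<close>

definition form_dom where "form_dom = {u \<in> L2_fun. (\<lambda>\<xi>. of_real (weight \<xi>) * u \<xi>) \<in> L2_fun}"
text \<open>The operator \<open>P(D) + V - E\<close> in frequency space; the convolution is
  subtracted because \<open>W\<close> is minus the transform of \<open>V\<close>.\<close>

definition eigen_op where "eigen_op u \<xi> = of_real (gap_symbol \<xi>) * u \<xi> - conv W u \<xi>"
text \<open>The sesquilinear form of \<open>P(D) + V - E\<close>, written so that a vanishing first
  variation reads directly as orthogonality to \<open>eigen_op u\<close>.\<close>

definition qform where "qform z u = (\<integral>\<xi>. cnj (z \<xi>) * eigen_op u \<xi> \<partial>lebesgue)"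
definition V_mult where "V_mult f x = of_real (V x) * f x" for f :: "'a \<Rightarrow> complex"

lemma FV_W: "AE \<xi> in lebesgue. fourier (\<lambda>x. complex_of_real (V x)) \<xi> = - W \<xi>"
  using FV_neg by eventually_elim (simp add: W_def w_def complex_eq_iff)

lemma w_pos: "AE \<xi> in lebesgue. 0 < w \<xi>"
  using FV_neg by eventually_elim (simp add: w_def)

lemma W_L2: "W \<in> L2_fun"
proof -
  have "AE \<xi> in lebesgue. - fourier (\<lambda>x. complex_of_real (V x)) \<xi> = W \<xi>"
    using FV_W by eventually_elim simp
  then show ?thesis by (rule L2_fun_cong_AE[OF L2_fun_minus[OF FV_L2]])
qed

lemma W_L1: "integrable lebesgue W"
  by (rule integrable_cong_AE_imp[of _ "\<lambda>\<xi>. - fourier (\<lambda>x. complex_of_real (V x)) \<xi>"])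
    (use FV_L1 FV_W L2_fun_measurable[OF W_L2] in \<open>auto elim: eventually_mono\<close>)

lemma w_measurable [measurable]: "w \<in> borel_measurable lebesgue"
  using borel_measurable_Re[THEN measurable_compose[OF L2_fun_measurable[OF W_L2]]]
  by (simp add: W_def comp_def)

text \<open>Inversion applied to the transform of \<open>V\<close>, which is \<open>- W\<close> up
  to a null set. As \<open>W\<close> is integrable, this represents \<open>V\<close> by an
  absolutely convergent integral.\<close>

lemma V_eq: "AE x in lebesgue. complex_of_real (V x) = - fourier_integral W (- x)"
proof -
  let ?F = "fourier (\<lambda>x. complex_of_real (V x))"
  have "AE \<xi> in lebesgue. cnj (?F \<xi>) = (-1) * W \<xi>"
    using FV_W by eventually_elim (simp add: W_def)
  then have 1: "fourier (\<lambda>\<xi>. cnj (?F \<xi>)) = fourier (\<lambda>\<xi>. (-1) * W \<xi>)"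
    by (rule fourier_cong_AE[OF L2_fun_cnj[OF FV_L2]])
  have 2: "AE x in lebesgue. fourier (\<lambda>\<xi>. (-1) * W \<xi>) x = (-1) * fourier_integral W x"
    by (intro fourier_eqI is_fourier_cmult is_fourier_fourier_integral W_L1 W_L2)
  have 3: "cnj (fourier_integral W x) = fourier_integral W (- x)" for x
    by (simp add: fourier_integral_kernel fkernel_minus W_def flip: Bochner_Integration.integral_cnj)
  from fourier_inversion[OF V_L2] 2 show ?thesis
    unfolding 1 by eventually_elim (simp add: 3)
qed

lemma V_measurable [measurable]: "V \<in> borel_measurable lebesgue"
  using borel_measurable_Re[THEN measurable_compose[OF L2_fun_measurable[OF V_L2]]]
  by (simp add: comp_def)

definition V_bnd where "V_bnd = (\<integral>x. cmod (W x) \<partial>lebesgue)"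

lemma V_bound: "AE x in lebesgue. \<bar>V x\<bar> \<le> V_bnd"
  using V_eq
proof eventually_elim
  case (elim x)
  have "\<bar>V x\<bar> = cmod (complex_of_real (V x))" by simp
  also have "\<dots> \<le> V_bnd" unfolding elim V_bnd_def using fourier_integral_bound[of W "- x"] by simp
  finally show ?case .
qed

lemma V_mult_L2: assumes "f \<in> L2_fun" shows "V_mult f \<in> L2_fun"
proof (rule L2_fun_bound[OF assms, where C = V_bnd])
  have [measurable]: "f \<in> borel_measurable lebesgue" by (rule L2_fun_measurable[OF assms])
  show "V_mult f \<in> borel_measurable lebesgue" unfolding V_mult_def[abs_def] by measurable
  show "AE x in lebesgue. cmod (V_mult f x) \<le> V_bnd * cmod (f x)"
    using V_bound by eventually_elim (auto simp: V_mult_def norm_mult intro: mult_right_mono)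
qed

lemma V_mult_form:
  assumes f: "f \<in> L2_fun" and g: "g \<in> L2_fun"
  shows "L2_ip f (V_mult g) = - (\<integral>\<xi>. cnj (fourier f \<xi>) * conv W (fourier g) \<xi> \<partial>lebesgue)"
proof -
  have "L2_ip f (V_mult g) = (\<integral>x. - (fourier_integral W (- x) * (cnj (f x) * g x)) \<partial>lebesgue)"
    unfolding L2_ip_def
  proof (rule integral_cong_AE)
    have [measurable]: "f \<in> borel_measurable lebesgue" "g \<in> borel_measurable lebesgue"
      "V_mult g \<in> borel_measurable lebesgue"
      using f g V_mult_L2[OF g] by (auto dest: L2_fun_measurable)
    have [measurable]: "(\<lambda>x. fourier_integral W (- x)) \<in> borel_measurable lebesgue"
      by (intro lebesgue_preserving_measurable[OF lebesgue_preserving_uminus] measurable_lebesgueI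
          borel_measurable_fourier_integral W_L1)
    show "(\<lambda>x. cnj (f x) * V_mult g x) \<in> borel_measurable lebesgue"
      "(\<lambda>x. - (fourier_integral W (- x) * (cnj (f x) * g x))) \<in> borel_measurable lebesgue"
      by measurable
    show "AE x in lebesgue. cnj (f x) * V_mult g x = - (fourier_integral W (- x) * (cnj (f x) * g x))"
      using V_eq by eventually_elim (simp add: V_mult_def)
  qed
  then show ?thesis using fourier_multiplier[OF W_L1 W_L2 f g] by simp
qed

lemma conv_W_pairing: "z \<in> L2_fun \<Longrightarrow> u \<in> L2_fun \<Longrightarrow> integrable lebesgue (\<lambda>\<xi>. cnj (z \<xi>) * conv W u \<xi>)"
  by (rule conv_pairing(1)[OF W_L1 W_L2])

lemma conv_W_measurable: "u \<in> L2_fun \<Longrightarrow> conv W u \<in> borel_measurable lebesgue"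
  by (intro measurable_lebesgueI borel_measurable_conv W_L2)

text \<open>Square integrability of the convolution is not presupposed. The difference of the two
  sides is tested against its truncations, each of which is the transform of some \<open>g\<close>,
  so that Parseval and \<open>V_mult_form\<close> apply.\<close>

lemma fourier_V_mult:
  assumes f: "f \<in> L2_fun"
  shows "AE \<xi> in lebesgue. fourier (V_mult f) \<xi> = - conv W (fourier f) \<xi>"
proof -
  define r where "r \<xi> = fourier (V_mult f) \<xi> + conv W (fourier f) \<xi>" for \<xi>
  have [measurable]: "fourier (V_mult f) \<in> borel_measurable lebesgue" "conv W (fourier f) \<in> borel_measurable lebesgue"
    using f by (auto intro!: L2_fun_measurable fourier_L2 V_mult_L2 conv_W_measurable)
  have r: "r \<in> borel_measurable lebesgue" unfolding r_def[abs_def] by measurable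
  have "AE \<xi> in lebesgue. r \<xi> = 0"
  proof (rule AE_zero_if_orthogonal_truncated[OF r])
    fix k
    let ?z = "truncated k r"
    have z: "?z \<in> L2_fun" by (rule truncated_L2[OF r])
    obtain g where g: "g \<in> L2_fun" "AE x in lebesgue. fourier g x = ?z x" using fourier_surj[OF z] .
    have [measurable]: "fourier g \<in> borel_measurable lebesgue" "?z \<in> borel_measurable lebesgue"
      using g z by (auto intro!: L2_fun_measurable fourier_L2)
    have "(\<integral>\<xi>. cnj (?z \<xi>) * r \<xi> \<partial>lebesgue)
        = L2_ip ?z (fourier (V_mult f)) + (\<integral>\<xi>. cnj (?z \<xi>) * conv W (fourier f) \<xi> \<partial>lebesgue)"
    proof -
      have "(\<integral>\<xi>. cnj (?z \<xi>) * r \<xi> \<partial>lebesgue)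
          = (\<integral>\<xi>. cnj (?z \<xi>) * fourier (V_mult f) \<xi> + cnj (?z \<xi>) * conv W (fourier f) \<xi> \<partial>lebesgue)"
        by (rule Bochner_Integration.integral_cong) (simp_all add: r_def distrib_left)
      also have "\<dots> = L2_ip ?z (fourier (V_mult f)) + (\<integral>\<xi>. cnj (?z \<xi>) * conv W (fourier f) \<xi> \<partial>lebesgue)"
        unfolding L2_ip_def
        by (rule Bochner_Integration.integral_add[OF L2_ip_integrable[OF z fourier_L2[OF V_mult_L2[OF f]]]
              conv_W_pairing[OF z fourier_L2[OF f]]])
      finally show ?thesis .
    qed
    also have "L2_ip ?z (fourier (V_mult f)) = L2_ip (fourier g) (fourier (V_mult f))"
      using g f by (intro L2_ip_cong_AE[symmetric] fourier_L2 V_mult_L2) auto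
    also have "\<dots> = L2_ip g (V_mult f)" by (intro fourier_parseval g V_mult_L2 f)
    also have "\<dots> = - (\<integral>\<xi>. cnj (fourier g \<xi>) * conv W (fourier f) \<xi> \<partial>lebesgue)"
      by (rule V_mult_form[OF g(1) f])
    also have "(\<integral>\<xi>. cnj (fourier g \<xi>) * conv W (fourier f) \<xi> \<partial>lebesgue)
        = (\<integral>\<xi>. cnj (?z \<xi>) * conv W (fourier f) \<xi> \<partial>lebesgue)"
    proof (rule integral_cong_AE)
      show "AE \<xi> in lebesgue. cnj (fourier g \<xi>) * conv W (fourier f) \<xi> = cnj (?z \<xi>) * conv W (fourier f) \<xi>"
        using g(2) by eventually_elim simp
    qed measurable
    finally show "Re (\<integral>\<xi>. cnj (?z \<xi>) * r \<xi> \<partial>lebesgue) = 0" by simp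
  qed
  then show ?thesis by eventually_elim (simp add: r_def add_eq_0_iff2)
qed

text \<open>Reflects that \<open>V\<close> is real: both pairings are carried back to multiplication
  by \<open>V\<close> through surjectivity of the transform.\<close>

lemma conv_W_hermitian:
  assumes z: "z \<in> L2_fun" and u: "u \<in> L2_fun"
  shows "(\<integral>\<xi>. cnj (z \<xi>) * conv W u \<xi> \<partial>lebesgue) = cnj (\<integral>\<xi>. cnj (u \<xi>) * conv W z \<xi> \<partial>lebesgue)"
proof -
  obtain f where f: "f \<in> L2_fun" "AE x in lebesgue. fourier f x = z x" using fourier_surj[OF z] .
  obtain g where g: "g \<in> L2_fun" "AE x in lebesgue. fourier g x = u x" using fourier_surj[OF u] .
  have [measurable]: "fourier f \<in> borel_measurable lebesgue" "fourier g \<in> borel_measurable lebesgue"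
    "z \<in> borel_measurable lebesgue" "u \<in> borel_measurable lebesgue"
    "conv W u \<in> borel_measurable lebesgue" "conv W z \<in> borel_measurable lebesgue"
    using f g z u by (auto intro!: L2_fun_measurable fourier_L2 conv_W_measurable)
  have 1: "L2_ip f (V_mult g) = - (\<integral>\<xi>. cnj (z \<xi>) * conv W u \<xi> \<partial>lebesgue)"
    unfolding V_mult_form[OF f(1) g(1)] conv_cong_AE[OF W_L2 fourier_L2[OF g(1)] g(2)]
  proof (rule arg_cong[of _ _ uminus], rule integral_cong_AE)
    show "AE \<xi> in lebesgue. cnj (fourier f \<xi>) * conv W u \<xi> = cnj (z \<xi>) * conv W u \<xi>"
      using f(2) by eventually_elim simp
  qed measurable
  have 2: "L2_ip g (V_mult f) = - (\<integral>\<xi>. cnj (u \<xi>) * conv W z \<xi> \<partial>lebesgue)"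
    unfolding V_mult_form[OF g(1) f(1)] conv_cong_AE[OF W_L2 fourier_L2[OF f(1)] f(2)]
  proof (rule arg_cong[of _ _ uminus], rule integral_cong_AE)
    show "AE \<xi> in lebesgue. cnj (fourier g \<xi>) * conv W z \<xi> = cnj (u \<xi>) * conv W z \<xi>"
      using g(2) by eventually_elim simp
  qed measurable
  have "L2_ip f (V_mult g) = cnj (L2_ip g (V_mult f))"
    by (simp add: L2_ip_def V_mult_def mult_ac flip: Bochner_Integration.integral_cnj)
  with 1 2 show ?thesis by (metis complex_cnj_minus neg_equal_iff_equal)
qed

section \<open>Bounds on the symbol and properties of the form domain\<close>

lemma p_ge: "c \<le> p \<xi>"
  using p_lower[of \<xi>] A by (smt (verit) mult_nonneg_nonneg powr_ge_zero)

lemma p_bounded_below: "bdd_below (range p)"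
  using p_ge by (rule bdd_belowI2)

lemma gap_symbol_pos: "0 < gap_symbol \<xi>"
  using gap cINF_lower[OF p_bounded_below, of \<xi>] by (simp add: gap_symbol_def E_def)

lemma gap_symbol_cont: "continuous_on UNIV gap_symbol"
  unfolding gap_symbol_def[abs_def] by (intro continuous_intros p_cont)

lemma weight_cont: "continuous_on UNIV weight"
proof -
  have "1 + (norm \<xi>)\<^sup>2 \<noteq> 0" for \<xi> :: 'a by (smt (verit) zero_le_power2)
  then show ?thesis unfolding weight_def[abs_def] by (intro continuous_intros) auto
qed

lemma p_measurable [measurable]: "p \<in> borel_measurable lebesgue"
  by (intro measurable_lebesgueI borel_measurable_continuous_onI p_cont)

lemma gap_symbol_measurable [measurable]: "gap_symbol \<in> borel_measurable lebesgue"
  by (intro measurable_lebesgueI borel_measurable_continuous_onI gap_symbol_cont)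

lemma weight_measurable [measurable]: "weight \<in> borel_measurable lebesgue"
  by (intro measurable_lebesgueI borel_measurable_continuous_onI weight_cont)

lemma weight_square: "(weight \<xi>)\<^sup>2 = (1 + (norm \<xi>)\<^sup>2) powr s"
proof -
  have "0 < 1 + (norm \<xi>)\<^sup>2" by (smt (verit) zero_le_power2)
  then show ?thesis by (simp add: weight_def powr_power)
qed

lemma weight_ge_1: "1 \<le> weight \<xi>"
  unfolding weight_def using s by (intro ge_one_powr_ge_zero) auto

text \<open>The squared weight dominates |xi|^(2s), which handles the upper bound on
  \<open>p\<close>, and is at least 1, which absorbs the constant from the lower bound.\<close>

lemma p_bound: "\<bar>p \<xi>\<bar> \<le> (B + \<bar>c\<bar>) * (weight \<xi>)\<^sup>2"
proof -
  have w1: "1 \<le> (weight \<xi>)\<^sup>2" using weight_ge_1[of \<xi>] by (simp add: one_le_power)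
  have "norm \<xi> powr (2 * s) \<le> (weight \<xi>)\<^sup>2"
  proof (cases "\<xi> = 0")
    case True
    then show ?thesis by simp
  next
    case False
    then have "norm \<xi> powr (2 * s) = ((norm \<xi>)\<^sup>2) powr s"
      by (simp add: powr_powr flip: powr_numeral)
    also have "\<dots> \<le> (weight \<xi>)\<^sup>2" unfolding weight_square using s by (intro powr_mono2) auto
    finally show ?thesis .
  qed
  then have "p \<xi> \<le> B * (weight \<xi>)\<^sup>2"
    using p_upper[of \<xi>] B by (smt (verit) mult_left_mono)
  moreover have "- \<bar>c\<bar> \<le> p \<xi>" using p_ge[of \<xi>] by linarith
  moreover have "\<bar>c\<bar> * 1 \<le> \<bar>c\<bar> * (weight \<xi>)\<^sup>2" using w1 by (intro mult_left_mono) auto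
  moreover have "0 \<le> B * (weight \<xi>)\<^sup>2" using B by simp
  moreover have "0 \<le> \<bar>c\<bar> * (weight \<xi>)\<^sup>2" by simp
  ultimately show ?thesis unfolding distrib_right by (intro abs_leI) linarith+
qed

lemma form_dom_L2: "u \<in> form_dom \<Longrightarrow> u \<in> L2_fun"
  by (simp add: form_dom_def)

lemma form_dom_weighted: "u \<in> form_dom \<Longrightarrow> (\<lambda>\<xi>. of_real (weight \<xi>) * u \<xi>) \<in> L2_fun"
  by (simp add: form_dom_def)

lemma form_dom_add: "u \<in> form_dom \<Longrightarrow> v \<in> form_dom \<Longrightarrow> (\<lambda>\<xi>. u \<xi> + v \<xi>) \<in> form_dom"
  using L2_fun_add[of "\<lambda>\<xi>. of_real (weight \<xi>) * u \<xi>" "\<lambda>\<xi>. of_real (weight \<xi>) * v \<xi>"]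
  by (simp add: form_dom_def L2_fun_add distrib_left)

lemma form_dom_cmult: "u \<in> form_dom \<Longrightarrow> (\<lambda>\<xi>. a * u \<xi>) \<in> form_dom"
  using L2_fun_cmult[of "\<lambda>\<xi>. of_real (weight \<xi>) * u \<xi>" a]
  by (simp add: form_dom_def L2_fun_cmult mult.left_commute)

lemma form_dom_cong_AE:
  assumes "u \<in> form_dom" "AE \<xi> in lebesgue. u \<xi> = v \<xi>" shows "v \<in> form_dom"
proof -
  have "AE \<xi> in lebesgue. of_real (weight \<xi>) * u \<xi> = of_real (weight \<xi>) * v \<xi>"
    using assms(2) by eventually_elim simp
  then show ?thesis
    using L2_fun_cong_AE[OF form_dom_weighted[OF assms(1)]] L2_fun_cong_AE[OF form_dom_L2[OF assms(1)] assms(2)]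
    by (simp add: form_dom_def)
qed

lemma form_dom_cmod: "u \<in> form_dom \<Longrightarrow> (\<lambda>\<xi>. complex_of_real (cmod (u \<xi>))) \<in> form_dom"
  using L2_fun_cmod[of "\<lambda>\<xi>. of_real (weight \<xi>) * u \<xi>"] weight_ge_1
  by (simp add: form_dom_def L2_fun_cmod norm_mult abs_of_nonneg[OF order_trans[OF zero_le_one weight_ge_1]])

text \<open>On the ball of radius \<open>k\<close> the weight is at most its boundary value, so
  truncations are admissible variations.\<close>

lemma form_dom_truncated:
  assumes r: "r \<in> borel_measurable lebesgue" shows "truncated k r \<in> form_dom"
proof -
  have "(\<lambda>\<xi>. of_real (weight \<xi>) * truncated k r \<xi>) \<in> L2_fun"
  proof (rule L2_fun_bound[OF truncated_L2[OF r]])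
    show "(\<lambda>\<xi>. of_real (weight \<xi>) * truncated k r \<xi>) \<in> borel_measurable lebesgue"
      using truncated_measurable[OF r] by measurable
    show "AE \<xi> in lebesgue. cmod (of_real (weight \<xi>) * truncated k r \<xi>)
        \<le> (1 + (real k)\<^sup>2) powr (s / 2) * cmod (truncated k r \<xi>)"
    proof (rule AE_I2)
      fix \<xi>
      show "cmod (of_real (weight \<xi>) * truncated k r \<xi>)
        \<le> (1 + (real k)\<^sup>2) powr (s / 2) * cmod (truncated k r \<xi>)"
      proof (cases "norm \<xi> < real k")
        case True
        then have "(norm \<xi>)\<^sup>2 \<le> (real k)\<^sup>2" by (intro power_mono) auto
        then have "weight \<xi> \<le> (1 + (real k)\<^sup>2) powr (s / 2)"
          unfolding weight_def using s by (intro powr_mono2) auto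
        then show ?thesis using weight_ge_1[of \<xi>] by (simp add: norm_mult mult_right_mono)
      qed (simp add: truncated_def)
    qed
  qed
  then show ?thesis using truncated_L2[OF r] by (simp add: form_dom_def)
qed

lemma sobolev_iff: "f \<in> sobolev s \<longleftrightarrow> f \<in> L2_fun \<and> fourier f \<in> form_dom"
  by (auto simp: sobolev_def form_dom_def weight_def fourier_L2)

text \<open>The squared weight is shared between the two factors, leaving a product of two weighted
  L^2 functions.\<close>

lemma form_dom_form_integrable:
  assumes q: "q \<in> borel_measurable lebesgue" "\<And>\<xi>. \<bar>q \<xi>\<bar> \<le> K * (weight \<xi>)\<^sup>2" and z: "z \<in> form_dom" and u: "u \<in> form_dom"
  shows "integrable lebesgue (\<lambda>\<xi>. cnj (z \<xi>) * (of_real (q \<xi>) * u \<xi>))"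
proof (rule Bochner_Integration.integrable_bound)
  show "integrable lebesgue (\<lambda>\<xi>. of_real K * (cnj (of_real (weight \<xi>) * z \<xi>) * (of_real (weight \<xi>) * u \<xi>)))"
    by (intro integrable_mult_right L2_ip_integrable form_dom_weighted z u)
  have [measurable]: "z \<in> borel_measurable lebesgue" "u \<in> borel_measurable lebesgue" "q \<in> borel_measurable lebesgue"
    using z u q by (auto dest: form_dom_L2 L2_fun_measurable)
  show "(\<lambda>\<xi>. cnj (z \<xi>) * (of_real (q \<xi>) * u \<xi>)) \<in> borel_measurable lebesgue" by measurable
  show "AE \<xi> in lebesgue. norm (cnj (z \<xi>) * (of_real (q \<xi>) * u \<xi>))
      \<le> norm (of_real K * (cnj (of_real (weight \<xi>) * z \<xi>) * (of_real (weight \<xi>) * u \<xi>)))"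
  proof (rule AE_I2)
    fix \<xi>
    have "\<bar>q \<xi>\<bar> \<le> \<bar>K\<bar> * (weight \<xi>)\<^sup>2"
      by (rule order_trans[OF q(2) mult_right_mono[OF abs_ge_self zero_le_power2]])
    then have "\<bar>q \<xi>\<bar> * (cmod (z \<xi>) * cmod (u \<xi>)) \<le> \<bar>K\<bar> * (weight \<xi>)\<^sup>2 * (cmod (z \<xi>) * cmod (u \<xi>))"
      by (intro mult_right_mono) auto
    then show "norm (cnj (z \<xi>) * (of_real (q \<xi>) * u \<xi>))
        \<le> norm (of_real K * (cnj (of_real (weight \<xi>) * z \<xi>) * (of_real (weight \<xi>) * u \<xi>)))"
      by (simp add: norm_mult power2_eq_square mult_ac)
  qed
qed

lemma gap_symbol_bound: "\<bar>gap_symbol \<xi>\<bar> \<le> (B + \<bar>c\<bar> + \<bar>E\<bar>) * (weight \<xi>)\<^sup>2"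
proof -
  have "1 \<le> (weight \<xi>)\<^sup>2" using weight_ge_1[of \<xi>] by (simp add: one_le_power)
  then have "\<bar>E\<bar> * 1 \<le> \<bar>E\<bar> * (weight \<xi>)\<^sup>2" by (intro mult_left_mono) auto
  then show ?thesis using p_bound[of \<xi>] by (simp add: gap_symbol_def distrib_right)
qed

lemmas gap_symbol_integrable = form_dom_form_integrable[OF gap_symbol_measurable gap_symbol_bound]

lemma qform_integrable: "z \<in> form_dom \<Longrightarrow> u \<in> form_dom \<Longrightarrow> integrable lebesgue (\<lambda>\<xi>. cnj (z \<xi>) * eigen_op u \<xi>)"
  using gap_symbol_integrable[of z u] conv_W_pairing[of z u] by (simp add: eigen_op_def right_diff_distrib form_dom_L2)

lemma qform_eq:
  "z \<in> form_dom \<Longrightarrow> u \<in> form_dom \<Longrightarrow> qform z u = (\<integral>\<xi>. cnj (z \<xi>) * (of_real (gap_symbol \<xi>) * u \<xi>) \<partial>lebesgue)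
      - (\<integral>\<xi>. cnj (z \<xi>) * conv W u \<xi> \<partial>lebesgue)"
  using gap_symbol_integrable[of z u] conv_W_pairing[of z u] by (simp add: qform_def eigen_op_def right_diff_distrib form_dom_L2)

lemma eigen_op_add: "u \<in> form_dom \<Longrightarrow> v \<in> form_dom \<Longrightarrow> eigen_op (\<lambda>\<xi>. u \<xi> + v \<xi>) \<xi> = eigen_op u \<xi> + eigen_op v \<xi>"
  by (simp add: eigen_op_def conv_add W_L2 form_dom_L2 distrib_left)

lemma eigen_op_cmult: "eigen_op (\<lambda>\<xi>. a * u \<xi>) \<xi> = a * eigen_op u \<xi>"
  by (simp add: eigen_op_def conv_cmult right_diff_distrib mult.left_commute)

lemma eigen_op_measurable: "u \<in> form_dom \<Longrightarrow> eigen_op u \<in> borel_measurable lebesgue"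
  unfolding eigen_op_def[abs_def]
  using conv_W_measurable[OF form_dom_L2, of u] L2_fun_measurable[OF form_dom_L2, of u] by measurable

lemma qform_hermitian:
  assumes "z \<in> form_dom" "u \<in> form_dom" shows "qform u z = cnj (qform z u)"
proof -
  have "(\<integral>\<xi>. cnj (u \<xi>) * (of_real (gap_symbol \<xi>) * z \<xi>) \<partial>lebesgue) = cnj (\<integral>\<xi>. cnj (z \<xi>) * (of_real (gap_symbol \<xi>) * u \<xi>) \<partial>lebesgue)"
    by (simp add: mult_ac flip: Bochner_Integration.integral_cnj)
  then show ?thesis
    using assms by (simp add: qform_eq conv_W_hermitian[of u z] form_dom_L2)
qed

lemma qform_add_right: "z \<in> form_dom \<Longrightarrow> u \<in> form_dom \<Longrightarrow> v \<in> form_dom \<Longrightarrow> qform z (\<lambda>\<xi>. u \<xi> + v \<xi>) = qform z u + qform z v"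
  by (simp add: qform_def eigen_op_add distrib_left qform_integrable)

lemma qform_cmult_right: "qform z (\<lambda>\<xi>. a * u \<xi>) = a * qform z u"
  by (simp add: qform_def eigen_op_cmult mult.left_commute)

text \<open>Hermitian symmetry makes the cross terms conjugate, so together they contribute twice a
  real part.\<close>

lemma qform_square_add:
  assumes u: "u \<in> form_dom" and v: "v \<in> form_dom"
  shows "Re (qform (\<lambda>\<xi>. u \<xi> + of_real t * v \<xi>) (\<lambda>\<xi>. u \<xi> + of_real t * v \<xi>))
      = Re (qform u u) + 2 * t * Re (qform v u) + t\<^sup>2 * Re (qform v v)"
proof -
  let ?t = "complex_of_real t"
  have tv: "(\<lambda>\<xi>. ?t * v \<xi>) \<in> form_dom" by (rule form_dom_cmult[OF v])
  have uv: "(\<lambda>\<xi>. u \<xi> + ?t * v \<xi>) \<in> form_dom" by (rule form_dom_add[OF u tv])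
  have l: "qform (\<lambda>\<xi>. u \<xi> + ?t * v \<xi>) y = qform u y + ?t * qform v y" if y: "y \<in> form_dom" for y
  proof -
    have "qform (\<lambda>\<xi>. u \<xi> + ?t * v \<xi>) y = cnj (qform y u + ?t * qform y v)"
      using qform_hermitian[OF y uv] y u v tv by (simp add: qform_add_right qform_cmult_right)
    then show ?thesis by (simp add: qform_hermitian[OF y u] qform_hermitian[OF y v])
  qed
  have "qform (\<lambda>\<xi>. u \<xi> + ?t * v \<xi>) (\<lambda>\<xi>. u \<xi> + ?t * v \<xi>) = qform u u + ?t * qform u v + ?t * (qform v u + ?t * qform v v)"
    using l[OF uv] u v tv by (simp add: qform_add_right qform_cmult_right)
  then show ?thesis
    by (simp add: qform_hermitian[OF v u] power2_eq_square algebra_simps)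
qed

lemma qform_diag:
  assumes u: "u \<in> form_dom"
  shows "Re (qform u u) = (\<integral>\<xi>. gap_symbol \<xi> * (cmod (u \<xi>))\<^sup>2 \<partial>lebesgue) - Re (\<integral>\<xi>. cnj (u \<xi>) * conv W u \<xi> \<partial>lebesgue)"
proof -
  have "cnj (u \<xi>) * (of_real (gap_symbol \<xi>) * u \<xi>) = of_real (gap_symbol \<xi> * (cmod (u \<xi>))\<^sup>2)" for \<xi>
    unfolding of_real_mult complex_norm_square by (simp add: mult_ac)
  then show ?thesis by (simp only: qform_eq[OF u u] minus_complex.simps integral_complex_of_real Re_complex_of_real)
qed

lemma p_square_integrable:
  assumes u: "u \<in> form_dom" shows "integrable lebesgue (\<lambda>\<xi>. p \<xi> * (cmod (u \<xi>))\<^sup>2)"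
proof -
  have sq: "cnj (u \<xi>) * (of_real (p \<xi>) * u \<xi>) = of_real (p \<xi> * (cmod (u \<xi>))\<^sup>2)" for \<xi>
    unfolding of_real_mult complex_norm_square by (simp add: mult_ac)
  show ?thesis using integrable_Re[OF form_dom_form_integrable[OF p_measurable p_bound u u]] unfolding sq by simp
qed

text \<open>On the unit sphere the energy is the shifted form plus the constant \<open>E\<close>; a
  normalized function is thus minimizing exactly when the form vanishes.\<close>

lemma energy_eq:
  assumes f: "f \<in> sobolev s"
  shows "energy_form p V f = Re (qform (fourier f) (fourier f)) + E * (L2_nrm f)\<^sup>2"
proof -
  have f2: "f \<in> L2_fun" and u: "fourier f \<in> form_dom" using f by (auto simp: sobolev_iff)
  let ?u = "fourier f"
  note pi = p_square_integrable[OF u]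
  have "(\<integral>\<xi>. gap_symbol \<xi> * (cmod (?u \<xi>))\<^sup>2 \<partial>lebesgue)
      = (\<integral>\<xi>. p \<xi> * (cmod (?u \<xi>))\<^sup>2 - E * (cmod (?u \<xi>))\<^sup>2 \<partial>lebesgue)"
    by (simp add: gap_symbol_def left_diff_distrib)
  also have "\<dots> = (\<integral>\<xi>. p \<xi> * (cmod (?u \<xi>))\<^sup>2 \<partial>lebesgue) - E * (L2_nrm f)\<^sup>2"
    using pi L2_fun_integrable[OF fourier_L2[OF f2]] fourier_nrm[OF f2]
    by (simp flip: L2_nrm_square)
  finally have 1: "(\<integral>\<xi>. gap_symbol \<xi> * (cmod (?u \<xi>))\<^sup>2 \<partial>lebesgue)
      = (\<integral>\<xi>. p \<xi> * (cmod (?u \<xi>))\<^sup>2 \<partial>lebesgue) - E * (L2_nrm f)\<^sup>2" .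
  have "cnj (f x) * V_mult f x = of_real (V x * (cmod (f x))\<^sup>2)" for x
    unfolding V_mult_def of_real_mult complex_norm_square by (simp add: mult_ac)
  then have "L2_ip f (V_mult f) = of_real (\<integral>x. V x * (cmod (f x))\<^sup>2 \<partial>lebesgue)"
    by (simp only: L2_ip_def integral_complex_of_real)
  with V_mult_form[OF f2 f2] have 2: "Re (\<integral>\<xi>. cnj (?u \<xi>) * conv W ?u \<xi> \<partial>lebesgue)
      = - (\<integral>x. V x * (cmod (f x))\<^sup>2 \<partial>lebesgue)"
    by (metis Re_complex_of_real add.inverse_inverse uminus_complex.simps(1))
  show ?thesis unfolding qform_diag[OF u] 1 2 by (simp add: energy_form_def)
qed

text \<open>A real \<open>Inf\<close> is a lower bound only for a set that is bounded below;
  \<open>c - V_bnd\<close> is the bound here.\<close>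

lemma energy_bounded_below: "bdd_below {energy_form p V f | f. f \<in> sobolev s \<and> L2_nrm f = 1}"
proof (rule bdd_belowI)
  fix x assume "x \<in> {energy_form p V f | f. f \<in> sobolev s \<and> L2_nrm f = 1}"
  then obtain f where x: "x = energy_form p V f" and f: "f \<in> L2_fun" "fourier f \<in> form_dom" and n: "L2_nrm f = 1"
    by (auto simp: sobolev_iff)
  have "(\<integral>\<xi>. c * (cmod (fourier f \<xi>))\<^sup>2 \<partial>lebesgue) \<le> (\<integral>\<xi>. p \<xi> * (cmod (fourier f \<xi>))\<^sup>2 \<partial>lebesgue)"
  proof (rule integral_mono)
    show "integrable lebesgue (\<lambda>\<xi>. c * (cmod (fourier f \<xi>))\<^sup>2)"
      using L2_fun_integrable[OF fourier_L2[OF f(1)]] by simp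
    show "integrable lebesgue (\<lambda>\<xi>. p \<xi> * (cmod (fourier f \<xi>))\<^sup>2)"
      by (rule p_square_integrable[OF f(2)])
    show "c * (cmod (fourier f \<xi>))\<^sup>2 \<le> p \<xi> * (cmod (fourier f \<xi>))\<^sup>2" for \<xi>
      using p_ge by (rule mult_right_mono) simp
  qed
  then have 1: "c \<le> (\<integral>\<xi>. p \<xi> * (cmod (fourier f \<xi>))\<^sup>2 \<partial>lebesgue)"
    using fourier_nrm[OF f(1)] n by (simp flip: L2_nrm_square)
  have Vi: "integrable lebesgue (\<lambda>x. V x * (cmod (f x))\<^sup>2)"
  proof (rule Bochner_Integration.integrable_bound)
    show "integrable lebesgue (\<lambda>x. V_bnd * (cmod (f x))\<^sup>2)" using L2_fun_integrable[OF f(1)] by simp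
    have [measurable]: "f \<in> borel_measurable lebesgue" by (rule L2_fun_measurable[OF f(1)])
    show "(\<lambda>x. V x * (cmod (f x))\<^sup>2) \<in> borel_measurable lebesgue" by measurable
    show "AE x in lebesgue. norm (V x * (cmod (f x))\<^sup>2) \<le> norm (V_bnd * (cmod (f x))\<^sup>2)"
      using V_bound by eventually_elim (auto simp: abs_mult intro!: mult_right_mono)
  qed
  have "(\<integral>x. - V_bnd * (cmod (f x))\<^sup>2 \<partial>lebesgue) \<le> (\<integral>x. V x * (cmod (f x))\<^sup>2 \<partial>lebesgue)"
  proof (rule integral_mono_AE[OF _ Vi])
    show "integrable lebesgue (\<lambda>x. - V_bnd * (cmod (f x))\<^sup>2)" using L2_fun_integrable[OF f(1)] by simp
    show "AE x in lebesgue. - V_bnd * (cmod (f x))\<^sup>2 \<le> V x * (cmod (f x))\<^sup>2"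
      using V_bound by eventually_elim (intro mult_right_mono, auto)
  qed
  then have "- V_bnd \<le> (\<integral>x. V x * (cmod (f x))\<^sup>2 \<partial>lebesgue)"
    using n by (simp flip: L2_nrm_square)
  with 1 show "c - V_bnd \<le> x" by (simp add: x energy_form_def)
qed

text \<open>Minimality of \<open>E\<close>, extended by scaling: a nonzero \<open>u\<close> is
  normalized, realized as a transform by surjectivity, and compared with the infimum.\<close>

lemma qform_nonneg:
  assumes u: "u \<in> form_dom" shows "0 \<le> Re (qform u u)"
proof (cases "L2_nrm u = 0")
  case True
  then have "AE \<xi> in lebesgue. u \<xi> = 0" using L2_nrm_eq_0[OF form_dom_L2[OF u]] by simp
  then have "AE \<xi> in lebesgue. cnj (u \<xi>) * eigen_op u \<xi> = 0" by eventually_elim simp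
  then have "qform u u = 0" unfolding qform_def by (rule integral_eq_zero_AE)
  then show ?thesis by simp
next
  case False
  define a where "a = complex_of_real (1 / L2_nrm u)"
  define v where "v \<xi> = a * u \<xi>" for \<xi>
  have v: "v \<in> form_dom" unfolding v_def[abs_def] by (rule form_dom_cmult[OF u])
  have nv: "L2_nrm v = 1"
    unfolding v_def[abs_def] L2_nrm_cmult using False by (simp add: a_def norm_divide)
  obtain f where f: "f \<in> L2_fun" "AE \<xi> in lebesgue. fourier f \<xi> = v \<xi>" using fourier_surj[OF form_dom_L2[OF v]] .
  have fv: "AE \<xi> in lebesgue. v \<xi> = fourier f \<xi>" using f(2) by eventually_elim simp
  have fX: "fourier f \<in> form_dom" by (rule form_dom_cong_AE[OF v fv])
  have nf: "L2_nrm f = 1"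
    using fourier_nrm[OF f(1)] L2_nrm_cong_AE[OF form_dom_L2[OF v] fv] nv by simp
  have sob: "f \<in> sobolev s" using f(1) fX by (simp add: sobolev_iff)
  have "E \<le> energy_form p V f"
    unfolding E_def ground_energy_def by (rule cInf_lower[OF _ energy_bounded_below]) (use sob nf in auto)
  then have "0 \<le> Re (qform (fourier f) (fourier f))" using energy_eq[OF sob] nf by simp
  also have "qform (fourier f) (fourier f) = qform v v"
    unfolding qform_def
  proof (rule integral_cong_AE)
    show "AE \<xi> in lebesgue. cnj (fourier f \<xi>) * eigen_op (fourier f) \<xi> = cnj (v \<xi>) * eigen_op v \<xi>"
      using f(2) unfolding eigen_op_def conv_cong_AE[OF W_L2 fourier_L2[OF f(1)] f(2)] by eventually_elim simp
  qed (use qform_integrable[OF fX fX] qform_integrable[OF v v] in auto)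
  also have "qform v v = cnj a * a * qform u u"
    by (simp add: qform_def v_def[abs_def] eigen_op_cmult mult_ac flip: integral_mult_right_zero)
  also have "cnj a * a = of_real ((1 / L2_nrm u)\<^sup>2)" by (simp add: a_def power2_eq_square)
  finally have "0 \<le> (1 / L2_nrm u)\<^sup>2 * Re (qform u u)" by simp
  moreover have "0 < (1 / L2_nrm u)\<^sup>2" using False by simp
  ultimately show ?thesis by (simp add: zero_le_mult_iff)
qed

lemma ground_state_iff:
  "ground_state s p V \<psi> \<longleftrightarrow> \<psi> \<in> sobolev s \<and> L2_nrm \<psi> = 1 \<and> Re (qform (fourier \<psi>) (fourier \<psi>)) = 0"
  using energy_eq[of \<psi>] by (auto simp: ground_state_def E_def)

text \<open>Since the form is nonnegative on the whole domain and zero at \<open>u\<close>, its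
  linear term in any direction vanishes. Taking truncations of \<open>eigen_op u\<close> as
  directions forces \<open>eigen_op u\<close> to vanish.\<close>

lemma euler_lagrange:
  assumes u: "u \<in> form_dom" and q: "Re (qform u u) = 0"
  shows "AE \<xi> in lebesgue. eigen_op u \<xi> = 0"
proof (rule AE_zero_if_orthogonal_truncated[OF eigen_op_measurable[OF u]])
  fix k
  let ?v = "truncated k (eigen_op u)"
  have v: "?v \<in> form_dom" by (rule form_dom_truncated[OF eigen_op_measurable[OF u]])
  have "0 \<le> 2 * t * Re (qform ?v u) + t\<^sup>2 * Re (qform ?v ?v)" for t
    using qform_nonneg[OF form_dom_add[OF u form_dom_cmult[OF v]], of "of_real t"] unfolding qform_square_add[OF u v] q by simp
  then have "Re (qform ?v u) = 0" by (rule linear_coefficient_zero)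
  then show "Re (\<integral>\<xi>. cnj (?v \<xi>) * eigen_op u \<xi> \<partial>lebesgue) = 0" by (simp add: qform_def)
qed

lemma qform_zero_if_L_zero:
  assumes "AE \<xi> in lebesgue. eigen_op u \<xi> = 0" shows "qform z u = 0"
  unfolding qform_def by (rule integral_eq_zero_AE) (use assms in \<open>auto elim: eventually_mono\<close>)

lemma solves_iff:
  assumes \<psi>: "\<psi> \<in> sobolev s"
  shows "solves_eigen_eq p V E \<psi> \<longleftrightarrow> (AE \<xi> in lebesgue. eigen_op (fourier \<psi>) \<xi> = 0)"
proof -
  have \<psi>2: "\<psi> \<in> L2_fun" using \<psi> by (simp add: sobolev_iff)
  \<comment> \<open>The equation determines \<open>P(D) \<psi>\<close> almost everywhere, and
    \<open>g\<close> is the only candidate for it.\<close>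
  define g where "g x = of_real E * \<psi> x + (-1) * V_mult \<psi> x" for x
  have g: "g \<in> L2_fun" unfolding g_def[abs_def] by (intro L2_fun_add L2_fun_cmult V_mult_L2 \<psi>2)
  have "AE \<xi> in lebesgue. fourier g \<xi> = fourier (\<lambda>x. of_real E * \<psi> x) \<xi> + fourier (\<lambda>x. (-1) * V_mult \<psi> x) \<xi>"
    unfolding g_def[abs_def] by (intro fourier_add L2_fun_cmult V_mult_L2 \<psi>2)
  moreover have "AE \<xi> in lebesgue. fourier (\<lambda>x. of_real E * \<psi> x) \<xi> = of_real E * fourier \<psi> \<xi>"
    by (intro fourier_cmult \<psi>2)
  moreover have "AE \<xi> in lebesgue. fourier (\<lambda>x. (-1) * V_mult \<psi> x) \<xi> = (-1) * fourier (V_mult \<psi>) \<xi>"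
    by (intro fourier_cmult V_mult_L2 \<psi>2)
  ultimately have Fg: "AE \<xi> in lebesgue. of_real (p \<xi>) * fourier \<psi> \<xi> - fourier g \<xi> = eigen_op (fourier \<psi>) \<xi>"
    using fourier_V_mult[OF \<psi>2]
    by eventually_elim (simp add: eigen_op_def gap_symbol_def left_diff_distrib)
  have eq: "h x = g x \<longleftrightarrow> h x + of_real (V x) * \<psi> x = of_real E * \<psi> x" for h :: "'a \<Rightarrow> complex" and x
    by (auto simp: g_def V_mult_def algebra_simps)
  show ?thesis
  proof
    assume "solves_eigen_eq p V E \<psi>"
    then obtain h where h: "is_PD p \<psi> h" "AE x in lebesgue. h x = g x"
      unfolding solves_eigen_eq_def eq by blast
    have h2: "h \<in> L2_fun" using h(1) by (simp add: is_PD_def)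
    have "AE \<xi> in lebesgue. fourier g \<xi> = of_real (p \<xi>) * fourier \<psi> \<xi>"
      using h(1) fourier_cong_AE[OF h2 h(2)] by (simp add: is_PD_def)
    with Fg show "AE \<xi> in lebesgue. eigen_op (fourier \<psi>) \<xi> = 0" by eventually_elim simp
  next
    assume "AE \<xi> in lebesgue. eigen_op (fourier \<psi>) \<xi> = 0"
    with Fg have "AE \<xi> in lebesgue. fourier g \<xi> = of_real (p \<xi>) * fourier \<psi> \<xi>"
      by eventually_elim simp
    then have "is_PD p \<psi> g" using \<psi>2 g by (simp add: is_PD_def)
    moreover have "AE x in lebesgue. g x + of_real (V x) * \<psi> x = of_real E * \<psi> x"
      unfolding eq[symmetric] by simp
    ultimately show "solves_eigen_eq p V E \<psi>" unfolding solves_eigen_eq_def by blast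
  qed
qed

lemma ground_state_iff_solves:
  "ground_state s p V \<psi> \<longleftrightarrow> \<psi> \<in> sobolev s \<and> L2_nrm \<psi> = 1 \<and> solves_eigen_eq p V E \<psi>"
proof -
  have "Re (qform (fourier \<psi>) (fourier \<psi>)) = 0 \<longleftrightarrow> solves_eigen_eq p V E \<psi>" if "\<psi> \<in> sobolev s"
    using that euler_lagrange[of "fourier \<psi>"] qform_zero_if_L_zero[of "fourier \<psi>" "fourier \<psi>"]
    by (auto simp: solves_iff sobolev_iff)
  then show ?thesis unfolding ground_state_iff by blast
qed

section \<open>Ground states\<close>

definition conv_abs where "conv_abs u \<xi> = (\<integral>\<eta>. w (\<xi> - \<eta>) * cmod (u \<eta>) \<partial>lebesgue)"

lemma w_reflect_pos: "AE \<eta> in lebesgue. 0 < w (\<xi> - \<eta>)"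
  by (rule lebesgue_preserving_AE[OF lebesgue_preserving_reflect w_pos])

lemma conv_abs_integrable:
  assumes "u \<in> L2_fun" shows "integrable lebesgue (\<lambda>\<eta>. w (\<xi> - \<eta>) * cmod (u \<eta>))"
  using integrable_Re[OF conv_integrable[OF W_L2 L2_fun_cmod[OF assms], of \<xi>]] by (simp add: W_def)

lemma conv_W_cmod: "conv W (\<lambda>\<eta>. of_real (cmod (u \<eta>))) \<xi> = of_real (conv_abs u \<xi>)"
  unfolding conv_def conv_abs_def W_def of_real_mult[symmetric] by (rule integral_complex_of_real)

lemma cmod_conv_W_le: assumes u: "u \<in> L2_fun" shows "cmod (conv W u \<xi>) \<le> conv_abs u \<xi>"
proof -
  have "cmod (conv W u \<xi>) \<le> (\<integral>\<eta>. cmod (W (\<xi> - \<eta>) * u \<eta>) \<partial>lebesgue)"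
    unfolding conv_def by (rule integral_norm_bound)
  also have "\<dots> = conv_abs u \<xi>"
    unfolding conv_abs_def
  proof (rule integral_cong_AE)
    show "AE \<eta> in lebesgue. cmod (W (\<xi> - \<eta>) * u \<eta>) = w (\<xi> - \<eta>) * cmod (u \<eta>)"
      using w_reflect_pos[of \<xi>] by eventually_elim (simp add: W_def norm_mult)
    show "(\<lambda>\<eta>. cmod (W (\<xi> - \<eta>) * u \<eta>)) \<in> borel_measurable lebesgue"
      using integrable_norm[OF conv_integrable[OF W_L2 u]] by (rule borel_measurable_integrable)
    show "(\<lambda>\<eta>. w (\<xi> - \<eta>) * cmod (u \<eta>)) \<in> borel_measurable lebesgue"
      using conv_abs_integrable[OF u] by (rule borel_measurable_integrable)
  qed
  finally show ?thesis .
qed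

text \<open>The kernel is positive almost everywhere, so the nonnegative integrand can integrate to
  zero only if \<open>u\<close> vanishes almost everywhere. This holds at each frequency, with no
  exceptional set.\<close>

lemma conv_abs_pos:
  assumes u: "u \<in> L2_fun" and nz: "\<not> (AE \<eta> in lebesgue. u \<eta> = 0)"
  shows "0 < conv_abs u \<xi>"
proof -
  have nn: "AE \<eta> in lebesgue. 0 \<le> w (\<xi> - \<eta>) * cmod (u \<eta>)"
    using w_reflect_pos[of \<xi>] by eventually_elim simp
  have "conv_abs u \<xi> \<noteq> 0"
  proof
    assume "conv_abs u \<xi> = 0"
    then have "AE \<eta> in lebesgue. w (\<xi> - \<eta>) * cmod (u \<eta>) = 0"
      using integral_nonneg_eq_0_iff_AE[OF conv_abs_integrable[OF u] nn] by (simp add: conv_abs_def)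
    then have "AE \<eta> in lebesgue. u \<eta> = 0"
      using w_reflect_pos[of \<xi>] by eventually_elim auto
    with nz show False ..
  qed
  moreover have "0 \<le> conv_abs u \<xi>" unfolding conv_abs_def by (rule integral_nonneg_AE[OF nn])
  ultimately show ?thesis by simp
qed

text \<open>Since \<open>W > 0\<close>, replacing \<open>u\<close> by \<open>|u|\<close> does not increase the form, so for a minimizer
  the triangle inequality for \<open>\<integral> W(\<xi> - \<eta>) u(\<eta>) d\<eta>\<close> is an equality at almost every \<open>\<xi>\<close>
  with \<open>u(\<xi>) \<noteq> 0\<close>; a single such \<open>\<xi>\<close> already fixes the phase of \<open>u\<close>.\<close>

lemma minimizer_phase:
  assumes u: "u \<in> form_dom" and q: "Re (qform u u) = 0" and nz: "\<not> (AE \<xi> in lebesgue. u \<xi> = 0)"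
  obtains \<zeta> where "cmod \<zeta> = 1" "AE \<xi> in lebesgue. \<zeta> * u \<xi> = of_real (cmod (u \<xi>))"
proof -
  have u2: "u \<in> L2_fun" by (rule form_dom_L2[OF u])
  let ?a = "\<lambda>\<xi>. complex_of_real (cmod (u \<xi>))"
  have a: "?a \<in> form_dom" by (rule form_dom_cmod[OF u])
  \<comment> \<open>The pointwise deficit in the triangle inequality, weighted by
    \<open>cmod (u \<xi>)\<close>. Its integral is the form at \<open>u\<close> minus the form at
    the modulus, since the symbol terms agree.\<close>
  define d where "d \<xi> = cmod (u \<xi>) * conv_abs u \<xi> - Re (cnj (u \<xi>) * conv W u \<xi>)" for \<xi>
  have eq: "cnj (?a \<xi>) * conv W ?a \<xi> = of_real (cmod (u \<xi>) * conv_abs u \<xi>)" for \<xi>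
    by (simp add: conv_W_cmod)
  have i1: "integrable lebesgue (\<lambda>\<xi>. cmod (u \<xi>) * conv_abs u \<xi>)"
    using integrable_Re[OF conv_W_pairing[OF form_dom_L2[OF a] form_dom_L2[OF a]]] unfolding eq by simp
  have i2: "integrable lebesgue (\<lambda>\<xi>. Re (cnj (u \<xi>) * conv W u \<xi>))"
    by (rule integrable_Re[OF conv_W_pairing[OF u2 u2]])
  have d_int: "integrable lebesgue d"
    unfolding d_def[abs_def] using i1 i2 by (rule Bochner_Integration.integrable_diff)
  have d_nonneg: "0 \<le> d \<xi>" for \<xi>
  proof -
    have "Re (cnj (u \<xi>) * conv W u \<xi>) \<le> cmod (u \<xi>) * cmod (conv W u \<xi>)"
      using complex_Re_le_cmod[of "cnj (u \<xi>) * conv W u \<xi>"] by (simp add: norm_mult)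
    also have "\<dots> \<le> cmod (u \<xi>) * conv_abs u \<xi>"
      by (intro mult_left_mono cmod_conv_W_le u2) simp
    finally show ?thesis by (simp add: d_def)
  qed
  have Re_int: "Re (\<integral>\<xi>. cnj (u \<xi>) * conv W u \<xi> \<partial>lebesgue) = (\<integral>\<xi>. Re (cnj (u \<xi>) * conv W u \<xi>) \<partial>lebesgue)"
    by (rule integral_Re[symmetric, OF conv_W_pairing[OF u2 u2]])
  have a_int: "Re (\<integral>\<xi>. cnj (?a \<xi>) * conv W ?a \<xi> \<partial>lebesgue) = (\<integral>\<xi>. cmod (u \<xi>) * conv_abs u \<xi> \<partial>lebesgue)"
    unfolding eq integral_complex_of_real by simp
  have "(\<integral>\<xi>. d \<xi> \<partial>lebesgue) = Re (qform u u) - Re (qform ?a ?a)"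
    unfolding qform_diag[OF u] qform_diag[OF a] Re_int a_int d_def
    by (simp only: Bochner_Integration.integral_diff[OF i1 i2]) simp
  then have "(\<integral>\<xi>. d \<xi> \<partial>lebesgue) \<le> 0" using q qform_nonneg[OF a] by simp
  moreover have "0 \<le> (\<integral>\<xi>. d \<xi> \<partial>lebesgue)"
    by (rule integral_nonneg_AE) (simp add: d_nonneg)
  ultimately have "(\<integral>\<xi>. d \<xi> \<partial>lebesgue) = 0" by (rule antisym)
  then have "AE \<xi> in lebesgue. d \<xi> = 0"
    using integral_nonneg_eq_0_iff_AE[OF d_int] d_nonneg by simp
  \<comment> \<open>Without such a point, vanishing of \<open>d\<close> almost everywhere would make
    \<open>u\<close> vanish almost everywhere.\<close>
  then have "\<exists>\<xi>. d \<xi> = 0 \<and> u \<xi> \<noteq> 0"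
    using nz by (metis (mono_tags, lifting) eventually_mono)
  then obtain \<xi> where \<xi>: "d \<xi> = 0" "u \<xi> \<noteq> 0" by auto
  \<comment> \<open>The inverse of the phase of \<open>u\<close> at the chosen frequency; equality
    in the triangle inequality makes it the inverse phase at almost every other one.\<close>
  define \<zeta> where "\<zeta> = cnj (u \<xi>) / of_real (cmod (u \<xi>))"
  have \<zeta>: "cmod \<zeta> = 1" using \<xi>(2) by (simp add: \<zeta>_def norm_divide)
  have "cmod (u \<xi>) * conv_abs u \<xi> = cmod (u \<xi>) * Re (\<zeta> * conv W u \<xi>)"
    using \<xi> by (simp add: d_def \<zeta>_def)
  then have c: "conv_abs u \<xi> = Re (\<zeta> * conv W u \<xi>)" using \<xi>(2) by simp
  have i3: "integrable lebesgue (\<lambda>\<eta>. \<zeta> * (W (\<xi> - \<eta>) * u \<eta>))"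
    by (intro integrable_mult_right conv_integrable W_L2 u2)
  have Re_eq: "Re (\<zeta> * (W (\<xi> - \<eta>) * u \<eta>)) = w (\<xi> - \<eta>) * Re (\<zeta> * u \<eta>)" for \<eta>
    by (simp add: W_def algebra_simps)
  have "(\<integral>\<eta>. w (\<xi> - \<eta>) * Re (\<zeta> * u \<eta>) \<partial>lebesgue) = Re (\<zeta> * conv W u \<xi>)"
    using integral_Re[OF i3] unfolding Re_eq by (simp only: conv_def integral_mult_right_zero)
  then have z: "(\<integral>\<eta>. w (\<xi> - \<eta>) * cmod (u \<eta>) - w (\<xi> - \<eta>) * Re (\<zeta> * u \<eta>) \<partial>lebesgue) = 0"
    using c conv_abs_integrable[OF u2, of \<xi>] integrable_Re[OF i3] unfolding Re_eq by (simp add: conv_abs_def)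
  have i4: "integrable lebesgue (\<lambda>\<eta>. w (\<xi> - \<eta>) * cmod (u \<eta>) - w (\<xi> - \<eta>) * Re (\<zeta> * u \<eta>))"
    using conv_abs_integrable[OF u2, of \<xi>] integrable_Re[OF i3] unfolding Re_eq
    by (rule Bochner_Integration.integrable_diff)
  have le: "Re (\<zeta> * u \<eta>) \<le> cmod (u \<eta>)" for \<eta>
    using complex_Re_le_cmod[of "\<zeta> * u \<eta>"] \<zeta> by (simp add: norm_mult)
  have "AE \<eta> in lebesgue. 0 \<le> w (\<xi> - \<eta>) * cmod (u \<eta>) - w (\<xi> - \<eta>) * Re (\<zeta> * u \<eta>)"
    using w_reflect_pos[of \<xi>] by eventually_elim (use le in \<open>auto intro: mult_left_mono\<close>)
  then have "AE \<eta> in lebesgue. w (\<xi> - \<eta>) * cmod (u \<eta>) - w (\<xi> - \<eta>) * Re (\<zeta> * u \<eta>) = 0"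
    using integral_nonneg_eq_0_iff_AE[OF i4] z by simp
  then have "AE \<eta> in lebesgue. \<zeta> * u \<eta> = of_real (cmod (u \<eta>))"
    using w_reflect_pos[of \<xi>]
  proof eventually_elim
    case (elim \<eta>)
    then have re: "Re (\<zeta> * u \<eta>) = cmod (u \<eta>)" by simp
    \<comment> \<open>A number whose real part equals its modulus has no imaginary part.\<close>
    have "(cmod (\<zeta> * u \<eta>))\<^sup>2 = (Re (\<zeta> * u \<eta>))\<^sup>2 + (Im (\<zeta> * u \<eta>))\<^sup>2" by (rule cmod_power2)
    then have "Im (\<zeta> * u \<eta>) = 0" unfolding re by (simp add: norm_mult \<zeta>)
    with re show ?case by (simp only: complex_eq_iff Re_complex_of_real Im_complex_of_real)
  qed
  with \<zeta> show thesis by (rule that)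
qed

text \<open>After removal of the phase, the Euler-Lagrange equation expresses \<open>u\<close>
  through a convolution. Defining \<open>h\<close> by that expression, rather than as
  \<open>cmod (u \<xi>)\<close>, makes continuity and positivity hold everywhere.\<close>

lemma minimizer_positive:
  assumes u: "u \<in> form_dom" and q: "Re (qform u u) = 0" and nz: "\<not> (AE \<xi> in lebesgue. u \<xi> = 0)"
  obtains \<zeta> h where "cmod \<zeta> = 1" "continuous_on UNIV h" "\<And>\<xi>. 0 < h \<xi>"
    "AE \<xi> in lebesgue. \<zeta> * u \<xi> = of_real (h \<xi>)"
proof -
  obtain \<zeta> where \<zeta>: "cmod \<zeta> = 1" "AE \<xi> in lebesgue. \<zeta> * u \<xi> = of_real (cmod (u \<xi>))"
    using minimizer_phase[OF u q nz] .
  have u2: "u \<in> L2_fun" by (rule form_dom_L2[OF u])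
  define h where "h \<xi> = conv_abs u \<xi> / gap_symbol \<xi>" for \<xi>
  have "continuous_on UNIV (\<lambda>\<xi>. Re (conv W (\<lambda>\<eta>. of_real (cmod (u \<eta>))) \<xi>))"
    by (intro continuous_intros continuous_conv W_L2 L2_fun_cmod u2)
  then have "continuous_on UNIV (conv_abs u)" by (simp add: conv_W_cmod)
  then have h: "continuous_on UNIV h"
    unfolding h_def[abs_def] using gap_symbol_pos by (intro continuous_on_divide gap_symbol_cont) (auto simp: less_imp_neq[symmetric])
  have hp: "0 < h \<xi>" for \<xi>
    unfolding h_def by (intro divide_pos_pos conv_abs_pos u2 nz gap_symbol_pos)
  have conv_eq: "conv W (\<lambda>\<eta>. \<zeta> * u \<eta>) = conv W (\<lambda>\<eta>. of_real (cmod (u \<eta>)))"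
    by (rule conv_cong_AE[OF W_L2 L2_fun_cmult[OF u2] \<zeta>(2)])
  have "AE \<xi> in lebesgue. \<zeta> * u \<xi> = of_real (h \<xi>)"
    using \<zeta>(2) euler_lagrange[OF u q]
  proof eventually_elim
    case (elim \<xi>)
    have "of_real (gap_symbol \<xi>) * (\<zeta> * u \<xi>) = \<zeta> * conv W u \<xi>"
      using elim(2) by (simp add: eigen_op_def mult.left_commute)
    also have "\<dots> = of_real (conv_abs u \<xi>)"
      using fun_cong[OF conv_eq, of \<xi>] by (simp add: conv_cmult conv_W_cmod)
    finally show ?case using gap_symbol_pos[of \<xi>] by (simp add: h_def field_simps)
  qed
  with \<zeta>(1) h hp show thesis by (rule that)
qed

section \<open>Uniqueness, positivity and symmetry of ground states\<close>

lemma ground_state_fourier: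
  assumes "ground_state s p V \<psi>"
  shows "\<psi> \<in> L2_fun" "fourier \<psi> \<in> form_dom" "Re (qform (fourier \<psi>) (fourier \<psi>)) = 0"
    "L2_nrm (fourier \<psi>) = 1" "\<not> (AE \<xi> in lebesgue. fourier \<psi> \<xi> = 0)"
proof -
  show 1: "\<psi> \<in> L2_fun" and "fourier \<psi> \<in> form_dom" "Re (qform (fourier \<psi>) (fourier \<psi>)) = 0"
    using assms by (auto simp: ground_state_iff sobolev_iff)
  show 2: "L2_nrm (fourier \<psi>) = 1"
    using assms fourier_nrm[OF 1] by (simp add: ground_state_iff)
  show "\<not> (AE \<xi> in lebesgue. fourier \<psi> \<xi> = 0)"
    using L2_nrm_eq_0[OF fourier_L2[OF 1]] 2 by simp
qed

text \<open>The difference solves the same linear equation, so it is again a zero of the form and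
  \<open>minimizer_positive\<close> applies to it. A phase times \<open>h - k\<close> is then
  positive, which rules out equal norms.\<close>

lemma positive_minimizer_unique:
  assumes u: "u \<in> form_dom" "Re (qform u u) = 0" "L2_nrm u = 1" "AE \<xi> in lebesgue. \<zeta> * u \<xi> = of_real (h \<xi>)" "\<And>\<xi>. 0 < h \<xi>"
    and v: "v \<in> form_dom" "Re (qform v v) = 0" "L2_nrm v = 1" "AE \<xi> in lebesgue. \<zeta>' * v \<xi> = of_real (k \<xi>)" "\<And>\<xi>. 0 < k \<xi>"
    and \<zeta>: "cmod \<zeta> = 1" "cmod \<zeta>' = 1"
  shows "AE \<xi> in lebesgue. \<zeta> * u \<xi> = \<zeta>' * v \<xi>"
proof (rule ccontr)
  assume ne: "\<not> (AE \<xi> in lebesgue. \<zeta> * u \<xi> = \<zeta>' * v \<xi>)"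
  define d where "d \<xi> = \<zeta> * u \<xi> + (- \<zeta>') * v \<xi>" for \<xi>
  have d: "d \<in> form_dom" unfolding d_def[abs_def] by (intro form_dom_add form_dom_cmult u v)
  have Ld: "eigen_op d \<xi> = \<zeta> * eigen_op u \<xi> + (- \<zeta>') * eigen_op v \<xi>" for \<xi>
    unfolding d_def[abs_def] using eigen_op_add[OF form_dom_cmult[OF u(1), of \<zeta>] form_dom_cmult[OF v(1), of "- \<zeta>'"]]
    by (simp only: eigen_op_cmult)
  have "AE \<xi> in lebesgue. eigen_op d \<xi> = 0"
    using euler_lagrange[OF u(1,2)] euler_lagrange[OF v(1,2)] by eventually_elim (simp add: Ld)
  then have bd: "Re (qform d d) = 0" by (simp add: qform_zero_if_L_zero)
  have nz: "\<not> (AE \<xi> in lebesgue. d \<xi> = 0)"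
    using ne by (simp add: d_def)
  obtain \<omega> g where \<omega>: "cmod \<omega> = 1" "\<And>\<xi>. 0 < g \<xi>" "AE \<xi> in lebesgue. \<omega> * d \<xi> = of_real (g \<xi>)"
    using minimizer_positive[OF d bd nz] by metis
  have hk: "AE \<xi> in lebesgue. \<omega> * of_real (h \<xi> - k \<xi>) = of_real (g \<xi>)"
    using \<omega>(3) u(4) v(4)
  proof eventually_elim
    case (elim \<xi>)
    then show ?case by (simp add: d_def)
  qed
  have re: "AE \<xi> in lebesgue. Re \<omega> * (h \<xi> - k \<xi>) = g \<xi>"
    using hk
  proof eventually_elim
    case (elim \<xi>)
    from arg_cong[OF this, of Re] show ?case by simp
  qed
  \<comment> \<open>The normalization concerns squares, so the sign of \<open>h - k\<close> is
    multiplied by the positive \<open>h + k\<close> to reach a quantity whose integral is known to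
    be zero.\<close>
  define e where "e \<xi> = (cmod (u \<xi>))\<^sup>2 - (cmod (v \<xi>))\<^sup>2" for \<xi>
  have sq: "AE \<xi> in lebesgue. Re \<omega> * e \<xi> = g \<xi> * (h \<xi> + k \<xi>)"
    using re u(4) v(4)
  proof eventually_elim
    case (elim \<xi>)
    have "cmod (u \<xi>) = h \<xi>" "cmod (v \<xi>) = k \<xi>"
      using arg_cong[OF elim(2), of cmod] arg_cong[OF elim(3), of cmod] \<zeta> u(5)[of \<xi>] v(5)[of \<xi>]
      by (simp_all add: norm_mult)
    then have "Re \<omega> * e \<xi> = (Re \<omega> * (h \<xi> - k \<xi>)) * (h \<xi> + k \<xi>)"
      by (simp add: e_def power2_eq_square algebra_simps)
    then show ?case unfolding elim(1) .
  qed
  have ei: "integrable lebesgue (\<lambda>\<xi>. Re \<omega> * e \<xi>)"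
    unfolding e_def using u(1) v(1)
    by (intro integrable_mult_right Bochner_Integration.integrable_diff L2_fun_integrable form_dom_L2)
  have "(\<integral>\<xi>. e \<xi> \<partial>lebesgue) = 0"
    unfolding e_def using L2_fun_integrable[OF form_dom_L2[OF u(1)]] L2_fun_integrable[OF form_dom_L2[OF v(1)]] u(3) v(3)
    by (simp flip: L2_nrm_square)
  then have "(\<integral>\<xi>. Re \<omega> * e \<xi> \<partial>lebesgue) = 0" by simp
  moreover have "AE \<xi> in lebesgue. 0 \<le> Re \<omega> * e \<xi>"
    using sq by eventually_elim (simp add: \<omega>(2) u(5) v(5) less_imp_le add_nonneg_nonneg)
  ultimately have "AE \<xi> in lebesgue. Re \<omega> * e \<xi> = 0"
    using integral_nonneg_eq_0_iff_AE[OF ei] by simp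
  with sq have "AE x in (lebesgue :: 'a measure). False"
  proof eventually_elim
    case (elim \<xi>)
    moreover have "0 < g \<xi> * (h \<xi> + k \<xi>)" by (intro mult_pos_pos add_pos_pos \<omega>(2) u(5) v(5))
    ultimately show ?case by (metis less_irrefl)
  qed
  then show False by (rule notE[OF lebesgue_AE_False])
qed

text \<open>Once their phases are removed, both transforms agree almost everywhere with one positive
  function; the quotient of the phases is the constant, and injectivity carries the identity
  back.\<close>

lemma ground_state_unique:
  assumes g1: "ground_state s p V \<psi>1" and g2: "ground_state s p V \<psi>2"
  shows "\<exists>\<alpha>::real. AE x in lebesgue. \<psi>2 x = exp (\<i> * of_real \<alpha>) * \<psi>1 x"
proof -
  note f1 = ground_state_fourier[OF g1] and f2 = ground_state_fourier[OF g2]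
  obtain \<zeta> h where h: "cmod \<zeta> = 1" "\<And>\<xi>. 0 < h \<xi>" "AE \<xi> in lebesgue. \<zeta> * fourier \<psi>1 \<xi> = of_real (h \<xi>)"
    using minimizer_positive[OF f1(2,3,5)] by metis
  obtain \<zeta>' k where k: "cmod \<zeta>' = 1" "\<And>\<xi>. 0 < k \<xi>" "AE \<xi> in lebesgue. \<zeta>' * fourier \<psi>2 \<xi> = of_real (k \<xi>)"
    using minimizer_positive[OF f2(2,3,5)] by metis
  have eq: "AE \<xi> in lebesgue. \<zeta> * fourier \<psi>1 \<xi> = \<zeta>' * fourier \<psi>2 \<xi>"
    by (rule positive_minimizer_unique[OF f1(2,3,4) h(3,2) f2(2,3,4) k(3,2) h(1) k(1)])
  have cn: "cnj \<zeta>' * \<zeta>' = 1"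
    using complex_norm_square[of \<zeta>'] k(1) by (simp add: mult.commute)
  have "cmod (cnj \<zeta>' * \<zeta>) = 1" using h(1) k(1) by (simp add: norm_mult)
  then obtain \<alpha> :: real where \<alpha>: "cnj \<zeta>' * \<zeta> = exp (\<i> * of_real \<alpha>)"
    using unimodular_exp by blast
  have "AE \<xi> in lebesgue. fourier \<psi>2 \<xi> = fourier (\<lambda>x. exp (\<i> * of_real \<alpha>) * \<psi>1 x) \<xi>"
    using fourier_cmult[OF f1(1), of "exp (\<i> * of_real \<alpha>)"] eq
  proof eventually_elim
    case (elim \<xi>)
    have "fourier \<psi>2 \<xi> = (cnj \<zeta>' * \<zeta>') * fourier \<psi>2 \<xi>" by (simp add: cn)
    also have "\<dots> = (cnj \<zeta>' * \<zeta>) * fourier \<psi>1 \<xi>" using elim(2) by (simp add: mult.assoc)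
    finally show ?case using elim(1) by (simp add: \<alpha>)
  qed
  then show ?thesis
    using fourier_inj[OF f2(1) L2_fun_cmult[OF f1(1)]] by blast
qed

lemma ground_state_fourier_positive:
  assumes g: "ground_state s p V \<psi>"
  shows "\<exists>h. continuous_on UNIV h \<and> (AE \<xi> in lebesgue. h \<xi> = fourier \<psi> \<xi>) \<and>
          (\<exists>\<theta>::real. \<forall>\<xi>. Im (exp (\<i> * of_real \<theta>) * h \<xi>) = 0 \<and> Re (exp (\<i> * of_real \<theta>) * h \<xi>) > 0)"
proof -
  note f = ground_state_fourier[OF g]
  obtain \<zeta> h where h: "cmod \<zeta> = 1" "continuous_on UNIV h" "\<And>\<xi>. 0 < h \<xi>"
    "AE \<xi> in lebesgue. \<zeta> * fourier \<psi> \<xi> = of_real (h \<xi>)"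
    using minimizer_positive[OF f(2,3,5)] by metis
  have cn: "\<zeta> * cnj \<zeta> = 1" using complex_norm_square[of \<zeta>] h(1) by simp
  obtain \<theta> :: real where \<theta>: "\<zeta> = exp (\<i> * of_real \<theta>)" using unimodular_exp[OF h(1)] by blast
  have eq: "exp (\<i> * of_real \<theta>) * (cnj \<zeta> * of_real (h \<xi>)) = of_real (h \<xi>)" for \<xi>
    unfolding \<theta>[symmetric] mult.assoc[symmetric] cn by simp
  show ?thesis
  proof (intro exI conjI allI)
    \<comment> \<open>The continuous representative of \<open>fourier \<psi>\<close> restores the
      phase: multiplying by \<open>cnj \<zeta>\<close> inverts multiplication by
      \<open>\<zeta>\<close>.\<close>
    show "continuous_on UNIV (\<lambda>\<xi>. cnj \<zeta> * of_real (h \<xi>))" by (intro continuous_intros h(2))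
    show "AE \<xi> in lebesgue. cnj \<zeta> * of_real (h \<xi>) = fourier \<psi> \<xi>"
      using h(4)
    proof eventually_elim
      case (elim \<xi>)
      show ?case unfolding elim[symmetric] mult.assoc[symmetric] using cn by (simp add: mult.commute)
    qed
    show "Im (exp (\<i> * of_real \<theta>) * (cnj \<zeta> * of_real (h \<xi>))) = 0" for \<xi> unfolding eq by simp
    show "0 < Re (exp (\<i> * of_real \<theta>) * (cnj \<zeta> * of_real (h \<xi>)))" for \<xi> unfolding eq using h(3) by simp
  qed
qed

text \<open>The phase that makes the transform real also makes it equal to its conjugate, which is
  the transform of the reflected conjugate; injectivity concludes.\<close>

lemma ground_state_symmetric:
  assumes g: "ground_state s p V \<psi>"
  shows "\<exists>z. cmod z = 1 \<and> (AE x in lebesgue. z * \<psi> (- x) = cnj (z * \<psi> x))"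
proof -
  note f = ground_state_fourier[OF g]
  obtain \<zeta> h where h: "cmod \<zeta> = 1" "continuous_on UNIV h" "\<And>\<xi>. 0 < h \<xi>"
    "AE \<xi> in lebesgue. \<zeta> * fourier \<psi> \<xi> = of_real (h \<xi>)"
    using minimizer_positive[OF f(2,3,5)] by metis
  define \<phi> where "\<phi> x = \<zeta> * \<psi> x" for x
  have i1: "is_fourier \<phi> (\<lambda>\<xi>. \<zeta> * fourier \<psi> \<xi>)"
    unfolding \<phi>_def[abs_def] by (intro is_fourier_cmult is_fourier_fourier f(1))
  note i2 = is_fourier_cnj_reflect[OF i1]
  have "AE \<xi> in lebesgue. fourier \<phi> \<xi> = fourier (\<lambda>x. cnj (\<phi> (- x))) \<xi>"
    using fourier_eqI[OF i1] fourier_eqI[OF i2] h(4)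
  proof eventually_elim
    case (elim \<xi>)
    show ?case unfolding elim(1,2) unfolding elim(3) by simp
  qed
  then have "AE x in lebesgue. \<phi> x = cnj (\<phi> (- x))"
    by (rule fourier_inj[OF is_fourier_L2(1)[OF i1] is_fourier_L2(1)[OF i2]])
  then have "AE x in lebesgue. \<zeta> * \<psi> (- x) = cnj (\<zeta> * \<psi> x)"
    unfolding \<phi>_def by eventually_elim simp
  with h(1) show ?thesis by blast
qed

text \<open>Conjugation leaves the potential energy and the norm untouched; reflecting the frequency
  leaves the kinetic energy untouched because the symbol is even.\<close>

lemma ground_state_cnj:
  assumes even: "\<And>\<xi>. p (- \<xi>) = p \<xi>" and g: "ground_state s p V \<psi>"
  shows "ground_state s p V (\<lambda>x. cnj (\<psi> x))"
proof -
  note f = ground_state_fourier[OF g]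
  have F: "AE \<xi> in lebesgue. fourier (\<lambda>x. cnj (\<psi> x)) \<xi> = cnj (fourier \<psi> (- \<xi>))"
    by (rule fourier_eqI[OF is_fourier_cnj[OF is_fourier_fourier[OF f(1)]]])
  have F': "AE \<xi> in lebesgue. cnj (fourier \<psi> (- \<xi>)) = fourier (\<lambda>x. cnj (\<psi> x)) \<xi>"
    using F by eventually_elim simp
  have "(\<lambda>\<xi>. cnj (fourier \<psi> (- \<xi>))) \<in> form_dom"
  proof -
    have "(\<lambda>\<xi>. cnj (of_real (weight (- \<xi>)) * fourier \<psi> (- \<xi>))) \<in> L2_fun"
      by (intro L2_fun_cnj lebesgue_preserving_L2[OF lebesgue_preserving_uminus form_dom_weighted[OF f(2)]])
    moreover have "(\<lambda>\<xi>. cnj (fourier \<psi> (- \<xi>))) \<in> L2_fun"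
      by (intro L2_fun_cnj lebesgue_preserving_L2[OF lebesgue_preserving_uminus] fourier_L2 f(1))
    ultimately show ?thesis by (simp add: form_dom_def weight_def)
  qed
  then have "fourier (\<lambda>x. cnj (\<psi> x)) \<in> form_dom" by (rule form_dom_cong_AE[OF _ F'])
  then have sob: "(\<lambda>x. cnj (\<psi> x)) \<in> sobolev s" using f(1) by (simp add: sobolev_iff L2_fun_cnj)
  have [measurable]: "fourier \<psi> \<in> borel_measurable lebesgue" "fourier (\<lambda>x. cnj (\<psi> x)) \<in> borel_measurable lebesgue"
    using f(1) by (auto intro!: L2_fun_measurable fourier_L2 L2_fun_cnj)
  have [measurable]: "(\<lambda>\<xi>. fourier \<psi> (- \<xi>)) \<in> borel_measurable lebesgue"
    by (intro lebesgue_preserving_measurable[OF lebesgue_preserving_uminus] L2_fun_measurable fourier_L2 f(1))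
  have "(\<integral>\<xi>. p \<xi> * (cmod (fourier (\<lambda>x. cnj (\<psi> x)) \<xi>))\<^sup>2 \<partial>lebesgue)
      = (\<integral>\<xi>. p (- \<xi>) * (cmod (fourier \<psi> (- \<xi>)))\<^sup>2 \<partial>lebesgue)"
    unfolding even
  proof (rule integral_cong_AE)
    show "AE \<xi> in lebesgue. p \<xi> * (cmod (fourier (\<lambda>x. cnj (\<psi> x)) \<xi>))\<^sup>2 = p \<xi> * (cmod (fourier \<psi> (- \<xi>)))\<^sup>2"
      using F by eventually_elim simp
  qed measurable
  also have "\<dots> = (\<integral>\<xi>. p \<xi> * (cmod (fourier \<psi> \<xi>))\<^sup>2 \<partial>lebesgue)"
    by (rule lebesgue_preserving_integral[OF lebesgue_preserving_uminus]) measurable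
  finally have "energy_form p V (\<lambda>x. cnj (\<psi> x)) = energy_form p V \<psi>"
    by (simp add: energy_form_def)
  with g sob show ?thesis by (simp add: ground_state_def L2_nrm_cnj)
qed

lemma ground_state_real:
  assumes even: "\<And>\<xi>. p (- \<xi>) = p \<xi>" and g: "ground_state s p V \<psi>"
  shows "\<exists>z. cmod z = 1 \<and> (AE x in lebesgue. z * \<psi> x \<in> \<real>)"
proof -
  obtain \<alpha> :: real where \<alpha>: "AE x in lebesgue. cnj (\<psi> x) = exp (\<i> * of_real \<alpha>) * \<psi> x"
    using ground_state_unique[OF g ground_state_cnj[OF even g]] by blast
  \<comment> \<open>Half the phase: from \<open>cnj (\<psi> x) = z * z * \<psi> x\<close> and
    \<open>cnj z * z = 1\<close> it follows that \<open>z * \<psi> x\<close> equals its own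
    conjugate.\<close>
  define z where "z = exp (\<i> * of_real (\<alpha> / 2))"
  have z2: "z * z = exp (\<i> * of_real \<alpha>)" by (simp add: z_def flip: exp_add)
  have z1: "cmod z = 1" by (simp add: z_def norm_exp_eq_Re)
  have zc: "cnj z * z = 1" using complex_norm_square[of z] z1 by (simp add: mult.commute)
  have "AE x in lebesgue. z * \<psi> x \<in> \<real>"
    using \<alpha>
  proof eventually_elim
    case (elim x)
    have "cnj (z * \<psi> x) = (cnj z * z) * (z * \<psi> x)" using elim by (simp add: z2[symmetric] mult_ac)
    then show ?case by (simp only: zc mult_1 Reals_cnj_iff)
  qed
  with z1 show ?thesis by blast
qed

end

theorem theorem1:
  fixes p V :: "real ^ 'n \<Rightarrow> real" and s A B c :: real
  assumes "s > 0"
    and "continuous_on UNIV p"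
    and "A > 0" and "B > 0"
    and "\<And>\<xi>. A * norm \<xi> powr (2 * s) + c \<le> p \<xi>"
    and "\<And>\<xi>. p \<xi> \<le> B * norm \<xi> powr (2 * s)"
    and "(\<lambda>x. complex_of_real (V x)) \<in> L2_fun"
    and "integrable lebesgue (fourier (\<lambda>x. complex_of_real (V x)))"
    and "fourier (\<lambda>x. complex_of_real (V x)) \<in> L2_fun"
    and "AE \<xi> in lebesgue. Im (fourier (\<lambda>x. complex_of_real (V x)) \<xi>) = 0 \<and>
                            Re (fourier (\<lambda>x. complex_of_real (V x)) \<xi>) < 0"
    and "ground_energy s p V < (INF \<xi>. p \<xi>)"
  shows
    "(\<forall>\<psi>. ground_state s p V \<psi> \<longleftrightarrow>
        \<psi> \<in> sobolev s \<and> L2_nrm \<psi> = 1 \<and> solves_eigen_eq p V (ground_energy s p V) \<psi>)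
     \<and> (\<forall>\<psi>\<^sub>1 \<psi>\<^sub>2. ground_state s p V \<psi>\<^sub>1 \<and> ground_state s p V \<psi>\<^sub>2 \<longrightarrow>
        (\<exists>\<alpha>::real. AE x in lebesgue. \<psi>\<^sub>2 x = exp (\<i> * of_real \<alpha>) * \<psi>\<^sub>1 x))
     \<and> (\<forall>\<psi>. ground_state s p V \<psi> \<longrightarrow>
        (\<exists>h. continuous_on UNIV h \<and> (AE \<xi> in lebesgue. h \<xi> = fourier \<psi> \<xi>) \<and>
          (\<exists>\<theta>::real. \<forall>\<xi>. Im (exp (\<i> * of_real \<theta>) * h \<xi>) = 0 \<and>
                            Re (exp (\<i> * of_real \<theta>) * h \<xi>) > 0)))
     \<and> (\<forall>\<psi>. ground_state s p V \<psi> \<longrightarrow>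
        (\<exists>z. cmod z = 1 \<and> (AE x in lebesgue. z * \<psi> (- x) = cnj (z * \<psi> x))))
     \<and> ((\<forall>\<xi>. p (- \<xi>) = p \<xi>) \<longrightarrow>
        (\<forall>\<psi>. ground_state s p V \<psi> \<longrightarrow>
          (\<exists>z. cmod z = 1 \<and> (AE x in lebesgue. z * \<psi> x \<in> \<real>))))"
proof -
  interpret schroedinger p V s A B c
    by (unfold_locales) (fact assms)+
  show ?thesis
    using ground_state_iff_solves[unfolded E_def] ground_state_unique ground_state_fourier_positive
      ground_state_symmetric ground_state_real
    by blast
qed

end
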